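(* Let $1<p<\infty$, $0<\alpha<\frac Qp$, $\frac1q=\frac1p-\frac\alpha Q$, $b\in BMO(H_n)$, and let $\varphi_1,\varphi_2$ be positive measurable functions on $H_n\times(0,\infty)$ such that $$\int_r^\infty\Big(1+\ln\frac{\tau}{r}\Big)\,\frac{\operatorname*{ess\,inf}_{\tau<s<\infty}\varphi_1(g,s)\,s^{Q/p}}{\tau^{\frac Qq+1}}\,d\tau\le C\,\varphi_2(g,r)$$ for all $g\in H_n$ and $r>0$, where $C$ does not depend on $g$ and $r$. Then the operators $M_{b,\alpha}$ and $[b,\overline T_\alpha]$ are bounded from $M_{p,\varphi_1}(H_n)$ to $M_{q,\varphi_2}(H_n)$.
   Context: The Heisenberg group $H_n$ is $\mathbb{R}^{2n}\times\mathbb{R}$ with group law $(x,t)\circ(x',t')=\big(x+x',\,t+t'+2\sum_{j=1}^n(x_{2j}x'_{2j-1}-x_{2j-1}x'_{2j})\big)$; $Q=2n+2$ is its homogeneous dimension; Haar measure is Lebesgue measure on $\mathbb{R}^{2n+1}$, and $|E|$ denotes the measure of a measurable set $E$. The homogeneous norm is $|(x,t)|=\big[(\sum_{j=1}^{2n}x_j^2)^2+t^2\big]^{1/4}$, and $B(g,r)=\{h\in H_n:|g^{-1}h|<r\}$. $BMO(H_n)$ is the set of $b\in L_1^{loc}(H_n)$ with $\|b\|_*=\sup_{g\in H_n,r>0}\frac1{|B(g,r)|}\int_{B(g,r)}|b(h)-b_{B(g,r)}|\,dh<\infty$, where $b_{B(g,r)}=\frac1{|B(g,r)|}\int_{B(g,r)}b(h)\,dh$.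 For $1\le p<\infty$ and a positive measurable function $\varphi$ on $H_n\times(0,\infty)$, the generalized Morrey space $M_{p,\varphi}(H_n)$ is the set of $f\in L_p^{loc}(H_n)$ with $\|f\|_{M_{p,\varphi}}=\sup_{g\in H_n,r>0}\varphi(g,r)^{-1}|B(g,r)|^{-1/p}\|f\|_{L_p(B(g,r))}<\infty$. The commutators are $$M_{b,\alpha}f(g)=\sup_{r>0}|B(g,r)|^{-1+\frac\alpha Q}\int_{B(g,r)}|b(g)-b(h)||f(h)|\,dh,\qquad [b,\overline T_\alpha]f(g)=\int_{H_n}[b(g)-b(h)]\frac{f(h)}{|g^{-1}h|^{Q-\alpha}}\,dh.$$ *)

theory Defs
  imports "HOL-Analysis.Analysis"
begin

text \<open>
  The index type \<open>'n\<close> has \<open>n\<close> elements. A point \<open>((u, v), t)\<close> stands for \<open>(x, t)\<close> with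
  \<open>u $ j = x\<^sub>2\<^sub>j\<^sub>-\<^sub>1\<close> (odd coordinates) and \<open>v $ j = x\<^sub>2\<^sub>j\<close> (even coordinates).
\<close>

type_synonym 'n heis = "((real ^ 'n) \<times> (real ^ 'n)) \<times> real"

definition heis_mult :: "'n::finite heis \<Rightarrow> 'n heis \<Rightarrow> 'n heis" (infixl \<open>\<odot>\<close> 70) where
  "g \<odot> h = (case (g, h) of (((u, v), t), ((u', v'), t')) \<Rightarrow>
     ((u + u', v + v'), t + t' + 2 * (\<Sum>j\<in>UNIV. v $ j * u' $ j - u $ j * v' $ j)))"

definition heis_inv :: "'n::finite heis \<Rightarrow> 'n heis" where
  "heis_inv g = - g"

lemma heis_mult_assoc: "(a \<odot> b) \<odot> c = a \<odot> (b \<odot> c)"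
  by (auto simp: heis_mult_def sum.distrib sum_subtractf algebra_simps split: prod.splits)

lemma heis_mult_zero: "0 \<odot> g = g" "g \<odot> 0 = g"
  by (auto simp: heis_mult_def zero_prod_def split: prod.splits)

lemma heis_mult_inv: "heis_inv g \<odot> g = 0" "g \<odot> heis_inv g = 0"
  by (auto simp: heis_mult_def heis_inv_def zero_prod_def mult.commute split: prod.splits)

definition heis_dim :: "'n::finite itself \<Rightarrow> real" where
  "heis_dim _ = 2 * real CARD('n) + 2"

definition heis_norm :: "'n::finite heis \<Rightarrow> real" where
  "heis_norm g = (case g of ((u, v), t) \<Rightarrow>
     root 4 ((\<Sum>j\<in>UNIV. (u $ j)\<^sup>2 + (v $ j)\<^sup>2)\<^sup>2 + t\<^sup>2))"

definition heis_ball :: "'n::finite heis \<Rightarrow> real \<Rightarrow> 'n heis set" where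
  "heis_ball g r = {h. heis_norm (heis_inv g \<odot> h) < r}"

definition Lp_loc :: "real \<Rightarrow> ('n::finite heis \<Rightarrow> real) set" where
  "Lp_loc p = {f. f \<in> borel_measurable lebesgue \<and>
     (\<forall>K. compact K \<longrightarrow> set_integrable lebesgue K (\<lambda>h. \<bar>f h\<bar> powr p))}"

text \<open>
  The real-valued integrals in the definitions below are only meaningful for locally integrable
  functions; the corresponding spaces are cut out of \<open>Lp_loc\<close>. The suprema are taken in \<open>[0, \<infinity>]\<close>.
\<close>

definition heis_avg :: "('n::finite heis \<Rightarrow> real) \<Rightarrow> 'n heis \<Rightarrow> real \<Rightarrow> real" where
  "heis_avg b g r =
     (LINT h:heis_ball g r|lebesgue. b h) / measure lebesgue (heis_ball g r)"

definition BMO_norm :: "('n::finite heis \<Rightarrow> real) \<Rightarrow> ennreal" where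
  "BMO_norm b = (SUP g. SUP r\<in>{0<..}.
     ennreal ((LINT h:heis_ball g r|lebesgue. \<bar>b h - heis_avg b g r\<bar>)
       / measure lebesgue (heis_ball g r)))"

definition BMO :: "('n::finite heis \<Rightarrow> real) set" where
  "BMO = {b \<in> Lp_loc 1. BMO_norm b < \<infinity>}"

definition Lp_norm_on :: "real \<Rightarrow> 'n::finite heis set \<Rightarrow> ('n heis \<Rightarrow> real) \<Rightarrow> real" where
  "Lp_norm_on p A f = (LINT h:A|lebesgue. \<bar>f h\<bar> powr p) powr (1 / p)"

definition morrey_norm ::
    "real \<Rightarrow> ('n::finite heis \<Rightarrow> real \<Rightarrow> real) \<Rightarrow> ('n heis \<Rightarrow> real) \<Rightarrow> ennreal" where
  "morrey_norm p \<phi> f = (SUP g. SUP r\<in>{0<..}.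
     ennreal (inverse (\<phi> g r) * measure lebesgue (heis_ball g r) powr (- 1 / p)
       * Lp_norm_on p (heis_ball g r) f))"

definition morrey :: "real \<Rightarrow> ('n::finite heis \<Rightarrow> real \<Rightarrow> real) \<Rightarrow> ('n heis \<Rightarrow> real) set" where
  "morrey p \<phi> = {f \<in> Lp_loc p. morrey_norm p \<phi> f < \<infinity>}"

definition pos_measurable :: "('n::finite heis \<Rightarrow> real \<Rightarrow> real) \<Rightarrow> bool" where
  "pos_measurable \<phi> \<longleftrightarrow>
     (\<lambda>(g, r). \<phi> g r) \<in> borel_measurable (lebesgue_on (UNIV \<times> {0<..})) \<and>
     (\<forall>g. \<forall>r>0. \<phi> g r > 0)"

text \<open>
  Sections \<open>\<phi> g\<close> of a Lebesgue measurable function may fail to be measurable for exceptional \<open>g\<close>.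
  Unlike \<open>esssup\<close> from the probability library, which takes a default value on non-measurable
  functions, this definition keeps its meaning for such sections.
\<close>

definition ess_inf :: "'a measure \<Rightarrow> ('a \<Rightarrow> 'b::complete_lattice) \<Rightarrow> 'b" where
  "ess_inf M f = Sup {c. AE x in M. c \<le> f x}"

definition max_commutator ::
    "('n::finite heis \<Rightarrow> real) \<Rightarrow> real \<Rightarrow> ('n heis \<Rightarrow> real) \<Rightarrow> 'n heis \<Rightarrow> ennreal" where
  "max_commutator b \<alpha> f g = (SUP r\<in>{0<..}.
     ennreal (measure lebesgue (heis_ball g r) powr (- 1 + \<alpha> / heis_dim TYPE('n)))
       * (\<integral>\<^sup>+ h\<in>heis_ball g r. ennreal (\<bar>b g - b h\<bar> * \<bar>f h\<bar>) \<partial>lebesgue))"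

definition riesz_commutator_kernel ::
    "('n::finite heis \<Rightarrow> real) \<Rightarrow> real \<Rightarrow> ('n heis \<Rightarrow> real) \<Rightarrow> 'n heis \<Rightarrow> 'n heis \<Rightarrow> real" where
  "riesz_commutator_kernel b \<alpha> f g h =
     (b g - b h) * (f h / heis_norm (heis_inv g \<odot> h) powr (heis_dim TYPE('n) - \<alpha>))"

definition riesz_commutator ::
    "('n::finite heis \<Rightarrow> real) \<Rightarrow> real \<Rightarrow> ('n heis \<Rightarrow> real) \<Rightarrow> 'n heis \<Rightarrow> real" where
  "riesz_commutator b \<alpha> f g = (LINT h|lebesgue. riesz_commutator_kernel b \<alpha> f g h)"

text \<open>
  The library integral is \<open>0\<close> for non-integrable functions, so boundedness of
  \<open>riesz_commutator\<close> in the sense below has to be accompanied by integrability of the kernel for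
  almost every \<open>g\<close>; likewise \<open>max_commutator\<close> has to be finite almost everywhere before it is
  turned into a real-valued function. At \<open>h = g\<close> the kernel is \<open>0\<close> by convention.
\<close>

definition morrey_bounded ::
    "(('n::finite heis \<Rightarrow> real) \<Rightarrow> 'n heis \<Rightarrow> real)
      \<Rightarrow> real \<Rightarrow> ('n heis \<Rightarrow> real \<Rightarrow> real) \<Rightarrow> real \<Rightarrow> ('n heis \<Rightarrow> real \<Rightarrow> real) \<Rightarrow> bool" where
  "morrey_bounded T p \<phi> q \<psi> \<longleftrightarrow>
     (\<exists>C::real. \<forall>f\<in>morrey p \<phi>.
        T f \<in> morrey q \<psi> \<and> morrey_norm q \<psi> (T f) \<le> ennreal C * morrey_norm p \<phi> f)"

end

(*
Both commutators are dominated pointwise by the positive operator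
  S f(g) = int |b(g) - b(h)| |f(h)| |g^-1 h|^(alpha - Q) dh.
Put w = 1 + |b - b_B| for a ball B; then |b(g) - b(h)| <= w(g) w(h), and by the John-Nirenberg
inequality all moments of w over B are bounded. Writing |g^-1 h|^(alpha - Q) as a superposition of
indicators of balls containing g and h, Hoelder's inequality and Hedberg's trick bound the pairing
of S f and F by maximal functions of f and F, whence S maps L_p to L_q by duality. On a ball
B(g, r), the part of f in B(g, 2r) is estimated by this L_p-L_q bound, the part outside by means of
|b_B(g,tau) - b_B(g,r)| <= C (1 + ln(tau/r)); this gives

  ||S f||_{L_q(B(g,r))} <= C r^(Q/q) int_r^oo (1 + ln(tau/r)) ||f||_{L_p(B(g,tau))} tau^(-Q/q-1) dtau.

As ||f||_{L_p(B(g,tau))} increases with tau, it is at most a multiple of the essential infimum of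
phi_1(g,s) s^(Q/p) over s > tau, so the hypothesis bounds the right-hand side.
*)

theory Submission
  imports Defs "HOL-Real_Asymp.Real_Asymp"
begin

subsection \<open>Geometry of the Heisenberg group\<close>

text \<open>The weight in |b(g) - b(h)| \<le> w(g) w(h) is centred at the average over one ball, so
  no single choice serves all pairs (g, h). Hence the kernel is cut into balls first and the bound
  is used inside each of them. This leaves a factor w(g) on the outer variable, which no pointwise
  estimate by maximal functions removes; pairing with F turns it into one more factor for Hoelder's
  inequality. The two Hoelder exponents s < p and t < q' leave room on both sides: their conjugates
  only cost higher moments of w, and the maximal theorem is needed only for p/s > 1 and q'/t > 1.
  All estimates are made for Borel functions with values in [0, infinity] over
  \<open>lborel\<close>, where Fubini's theorem and suprema ask for no integrability. Lebesgue
  measurable b and f, and real integrals with their default value 0, occur only where the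
  definitions of BMO, of the Morrey norms and of the operators are translated.\<close>

definition heis_dist :: "'n::finite heis \<Rightarrow> 'n heis \<Rightarrow> real" where
  "heis_dist g h = heis_norm (heis_inv g \<odot> h)"

lemma heis_norm_eq:
  "heis_norm ((u, v), t) = root 4 ((norm (u, v))^4 + t\<^sup>2)"
proof -
  have "(\<Sum>j\<in>UNIV. (u $ j)\<^sup>2 + (v $ j)\<^sup>2) = (norm (u, v))\<^sup>2"
    by (simp add: norm_Pair norm_vec_def L2_set_def sum.distrib sum_nonneg)
  then show ?thesis by (simp add: heis_norm_def flip: power_mult)
qed

lemma heis_norm_nonneg [simp]: "0 \<le> heis_norm g"
  by (cases g) (auto simp: heis_norm_def split: prod.split)

lemma heis_norm_pow4: "heis_norm ((u, v), t) ^ 4 = (norm (u, v))^4 + t\<^sup>2"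
  by (simp add: heis_norm_eq real_root_pow_pos2)

text \<open>Together with \<open>abs_le_heis_norm\<close> this encloses the balls around 0 in
  Euclidean boxes, which is how balls are seen to be bounded.\<close>

lemma norm_le_heis_norm: "norm (fst g) \<le> heis_norm g"
proof (cases g)
  case (Pair z t)
  obtain u v where z: "z = (u, v)" by (cases z)
  have "norm z ^ 4 \<le> heis_norm g ^ 4"
    unfolding Pair z heis_norm_pow4 by simp
  then show ?thesis using Pair by (metis fst_conv heis_norm_nonneg power_mono_iff norm_ge_zero zero_less_numeral)
qed

lemma abs_le_heis_norm: "\<bar>snd g\<bar> \<le> (heis_norm g)\<^sup>2"
proof (cases g)
  case (Pair z t)
  obtain u v where z: "z = (u, v)" by (cases z)
  have "t\<^sup>2 \<le> heis_norm g ^ 4"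
    unfolding Pair z heis_norm_pow4 by simp
  then have "\<bar>t\<bar>\<^sup>2 \<le> ((heis_norm g)\<^sup>2)\<^sup>2" by (simp flip: power_mult)
  then show ?thesis using Pair
    by (metis abs_le_square_iff abs_abs abs_of_nonneg power2_abs snd_conv zero_le_power2)
qed

lemma heis_norm_0 [simp]: "heis_norm 0 = 0"
  by (simp add: heis_norm_def zero_prod_def)

lemma heis_norm_eq_0_iff: "heis_norm g = 0 \<longleftrightarrow> g = 0"
proof
  assume "heis_norm g = 0"
  with norm_le_heis_norm[of g] abs_le_heis_norm[of g] show "g = 0"
    by (auto simp: prod_eq_iff)
qed simp

lemma heis_norm_inv: "heis_norm (heis_inv g) = heis_norm g"
  by (cases g) (auto simp: heis_norm_def heis_inv_def split: prod.split)

text \<open>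
  With \<open>z\<^sub>j = u\<^sub>j + i v\<^sub>j\<close> the fourth power of the norm is \<open>|A(z, t)|\<^sup>2\<close> for \<open>A(z, t) = |z|\<^sup>2 + i t\<close>, and
  \<open>A((z, t) \<odot> (z', t')) = A(z, t) + A(z', t') + 2 \<langle>z, z'\<rangle>\<close> with the Hermitian product, so that
  the triangle inequality reduces to that of \<open>\<complex>\<close> and the Cauchy-Schwarz inequality.
\<close>

lemma heis_norm_mult: "heis_norm (g \<odot> h) \<le> heis_norm g + heis_norm h"
proof -
  obtain u v t where g: "g = ((u, v), t)" by (metis surj_pair)
  obtain u' v' t' where h: "h = ((u', v'), t')" by (metis surj_pair)
  define A :: "'a heis \<Rightarrow> complex" where "A = (\<lambda>((u, v), t). Complex ((norm (u, v))\<^sup>2) t)"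
  have A: "norm (A k) = (heis_norm k)\<^sup>2" for k
  proof -
    obtain u v t where k: "k = ((u, v), t)" by (metis surj_pair)
    have "(norm (A k))\<^sup>2 = ((heis_norm k)\<^sup>2)\<^sup>2"
      using heis_norm_pow4[of u v t] by (simp add: A_def k cmod_power2 flip: power_mult)
    then show ?thesis by (rule power2_eq_imp_eq) auto
  qed
  define H :: complex where
    "H = (\<Sum>j\<in>UNIV. cnj (Complex (u $ j) (v $ j)) * Complex (u' $ j) (v' $ j))"
  have ReH: "Re H = (\<Sum>j\<in>UNIV. u $ j * u' $ j + v $ j * v' $ j)"
    and ImH: "Im H = (\<Sum>j\<in>UNIV. u $ j * v' $ j - v $ j * u' $ j)"
    by (simp_all add: H_def)
  have "norm H \<le> (\<Sum>j\<in>UNIV. norm (Complex (u $ j) (v $ j)) * norm (Complex (u' $ j) (v' $ j)))"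
    unfolding H_def by (rule order_trans[OF norm_sum]) (simp only: norm_mult complex_mod_cnj order_refl)
  also have "\<dots> \<le> L2_set (\<lambda>j. norm (Complex (u $ j) (v $ j))) UNIV
      * L2_set (\<lambda>j. norm (Complex (u' $ j) (v' $ j))) UNIV"
    using L2_set_mult_ineq[of "\<lambda>j. norm (Complex (u $ j) (v $ j))" "\<lambda>j. norm (Complex (u' $ j) (v' $ j))" UNIV] by simp
  also have "\<dots> = norm (u, v) * norm (u', v')"
    by (simp add: L2_set_def norm_Pair norm_vec_def cmod_power2 sum.distrib sum_nonneg)
  also have "\<dots> \<le> heis_norm g * heis_norm h"
    using norm_le_heis_norm[of g] norm_le_heis_norm[of h] by (intro mult_mono) (auto simp: g h)
  finally have H: "norm H \<le> heis_norm g * heis_norm h" .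
  have nsq: "(norm (u + u', v + v'))\<^sup>2 = (norm (u, v))\<^sup>2 + (norm (u', v'))\<^sup>2 + 2 * Re H"
    unfolding ReH
    by (simp add: power2_norm_eq_inner inner_add_left inner_add_right inner_vec_def sum.distrib sum_distrib_left algebra_simps)
  have "A (g \<odot> h) = A g + A h + 2 * cnj H"
    by (simp add: A_def g h heis_mult_def complex_eq_iff nsq ImH sum_subtractf)
  then have "(heis_norm (g \<odot> h))\<^sup>2 \<le> norm (A g + A h) + norm (2 * cnj H)"
    unfolding A[symmetric] by (metis norm_triangle_ineq)
  also have "\<dots> \<le> (heis_norm g)\<^sup>2 + (heis_norm h)\<^sup>2 + 2 * (heis_norm g * heis_norm h)"
    using H norm_triangle_ineq[of "A g" "A h"] by (simp add: A norm_mult)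
  also have "\<dots> = (heis_norm g + heis_norm h)\<^sup>2" by (simp add: power2_sum)
  finally show ?thesis by (rule power2_le_imp_le) simp
qed

section \<open>The left-invariant metric and its balls\<close>

lemma heis_inv_mult: "heis_inv (g \<odot> h) = heis_inv h \<odot> heis_inv g"
  by (auto simp: heis_mult_def heis_inv_def sum_negf[symmetric] mult.commute split: prod.splits)

lemma heis_inv_0 [simp]: "heis_inv 0 = 0"
  by (simp add: heis_inv_def)

lemma heis_inv_inv [simp]: "heis_inv (heis_inv g) = g"
  by (simp add: heis_inv_def)

lemma heis_cancel [simp]: "heis_inv g \<odot> (g \<odot> h) = h" "g \<odot> (heis_inv g \<odot> h) = h"
  by (metis heis_mult_assoc heis_mult_inv heis_mult_zero)+

lemma heis_dist_nonneg [simp]: "0 \<le> heis_dist g h"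
  by (simp add: heis_dist_def)

lemma heis_dist_commute: "heis_dist g h = heis_dist h g"
  unfolding heis_dist_def by (metis heis_norm_inv heis_inv_mult heis_inv_inv)

lemma heis_dist_self [simp]: "heis_dist g g = 0"
  by (simp add: heis_dist_def heis_mult_inv)

lemma heis_dist_triangle: "heis_dist g k \<le> heis_dist g h + heis_dist h k"
proof -
  have "heis_inv g \<odot> k = (heis_inv g \<odot> h) \<odot> (heis_inv h \<odot> k)"
    by (simp add: heis_mult_assoc)
  then show ?thesis unfolding heis_dist_def by (metis heis_norm_mult)
qed

lemma heis_dist_eq_0_iff: "heis_dist g h = 0 \<longleftrightarrow> g = h"
  unfolding heis_dist_def heis_norm_eq_0_iff by (metis heis_cancel(2) heis_mult_inv(1) heis_mult_zero(2))

lemma heis_ball_eq: "heis_ball g r = {h. heis_dist g h < r}"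
  by (simp add: heis_ball_def heis_dist_def)

lemma mem_heis_ball: "h \<in> heis_ball g r \<longleftrightarrow> heis_dist g h < r"
  by (simp add: heis_ball_eq)

lemma heis_ball_mono: "r \<le> s \<Longrightarrow> heis_ball g r \<subseteq> heis_ball g s"
  by (auto simp: heis_ball_eq)

lemma heis_ball_subset: "heis_dist g h + r \<le> s \<Longrightarrow> heis_ball h r \<subseteq> heis_ball g s"
proof
  fix x assume "heis_dist g h + r \<le> s" "x \<in> heis_ball h r"
  then show "x \<in> heis_ball g s" using heis_dist_triangle[of g x h] by (simp add: mem_heis_ball)
qed

section \<open>Continuity, measurability and the topology of balls\<close>

lemma continuous_on_heis_mult:
  fixes f g :: "'b::topological_space \<Rightarrow> 'n::finite heis"
  assumes "continuous_on A f" "continuous_on A g"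
  shows "continuous_on A (\<lambda>x. f x \<odot> g x)"
proof -
  have "continuous_on A (\<lambda>x. ((fst (fst (f x)) + fst (fst (g x)), snd (fst (f x)) + snd (fst (g x))),
     snd (f x) + snd (g x) + 2 * (\<Sum>j\<in>UNIV. snd (fst (f x)) $ j * fst (fst (g x)) $ j
        - fst (fst (f x)) $ j * snd (fst (g x)) $ j)))"
    using assms by (intro continuous_intros)
  then show ?thesis by (simp add: heis_mult_def case_prod_beta)
qed

lemma continuous_on_heis_norm: "continuous_on A (heis_norm :: 'n::finite heis \<Rightarrow> real)"
  unfolding heis_norm_def case_prod_beta by (intro continuous_intros)

lemma continuous_on_heis_dist [continuous_intros]:
  fixes f g :: "'b::topological_space \<Rightarrow> 'n::finite heis"
  assumes "continuous_on A f" "continuous_on A g"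
  shows "continuous_on A (\<lambda>x. heis_dist (f x) (g x))"
  unfolding heis_dist_def heis_inv_def
  by (intro continuous_on_compose2[OF continuous_on_heis_norm[of UNIV]] continuous_on_heis_mult
      continuous_intros assms) auto

lemma borel_measurable_heis_dist [measurable]:
  fixes f g :: "'b \<Rightarrow> 'n::finite heis"
  assumes "f \<in> borel_measurable M" "g \<in> borel_measurable M"
  shows "(\<lambda>x. heis_dist (f x) (g x)) \<in> borel_measurable M"
proof (rule borel_measurable_continuous_Pair[where H = heis_dist, OF assms])
  show "continuous_on UNIV (\<lambda>x. heis_dist (fst x) (snd x :: 'n heis))"
    by (rule continuous_on_heis_dist) (intro continuous_intros)+
qed

lemma open_heis_ball [simp]: "open (heis_ball g r)"
  unfolding heis_ball_eq by (intro open_Collect_less continuous_intros)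

lemma sets_heis_ball [measurable, simp]: "heis_ball g r \<in> sets borel"
  by simp

text \<open>Left translation by \<open>g\<close> carries a box around 0 onto a compact set that
  contains the ball.\<close>

lemma bounded_heis_ball: "bounded (heis_ball (g::'n::finite heis) r)"
proof -
  have "heis_ball g r \<subseteq> (\<lambda>h. g \<odot> h) ` (cball 0 r \<times> cball 0 (r\<^sup>2))"
  proof
    fix h assume h: "h \<in> heis_ball g r"
    let ?k = "heis_inv g \<odot> h"
    have k: "heis_norm ?k < r" using h by (simp add: heis_ball_def)
    then have "(heis_norm ?k)\<^sup>2 \<le> r\<^sup>2" by (intro power_mono) auto
    then have "?k \<in> cball 0 r \<times> cball 0 (r\<^sup>2)"
      using norm_le_heis_norm[of ?k] abs_le_heis_norm[of ?k] k by (simp add: mem_Times_iff dist_norm)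
    then show "h \<in> (\<lambda>h. g \<odot> h) ` (cball 0 r \<times> cball 0 (r\<^sup>2))"
      by (metis heis_cancel(2) imageI)
  qed
  moreover have "compact ((\<lambda>h. g \<odot> h) ` (cball 0 r \<times> cball 0 (r\<^sup>2)))"
    by (intro compact_continuous_image continuous_on_heis_mult continuous_intros compact_Times) auto
  ultimately show ?thesis by (meson bounded_subset compact_imp_bounded)
qed

text \<open>The link between \<open>Lp_loc\<close>, which speaks of compact sets, and the estimates,
  which are all made on balls.\<close>

lemma compact_subset_heis_ball:
  assumes "compact K" obtains r where "r > 0" "K \<subseteq> heis_ball (g::'n::finite heis) r"
proof -
  have "bounded ((\<lambda>h. heis_dist g h) ` K)"
    by (intro compact_imp_bounded compact_continuous_image assms continuous_intros)
  then obtain R where "\<And>h. h \<in> K \<Longrightarrow> heis_dist g h \<le> R" by (auto simp: bounded_iff)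
  then have "K \<subseteq> heis_ball g (max R 0 + 1)" by (force simp: mem_heis_ball)
  then show thesis by (intro that[of "max R 0 + 1"]) auto
qed

text \<open>The distance from \<open>g\<close> attains its minimum on the compact set that remains
  of the closed unit ball after removal of \<open>U\<close>; the minimum is positive because
  \<open>g\<close> is in \<open>U\<close>, and it serves as the radius. This connects
  differentiation along balls with the Euclidean regularity of Lebesgue measure.\<close>

lemma open_contains_heis_ball:
  assumes "open U" "g \<in> U" obtains r where "r > 0" "heis_ball (g::'n::finite heis) r \<subseteq> U"
proof -
  have "compact (closure (heis_ball g 1))" using bounded_heis_ball by (simp add: compact_closure)
  then have K: "compact (closure (heis_ball g 1) - U)" using assms by (intro compact_diff)
  show thesis
  proof (cases "closure (heis_ball g 1) - U = {}")
    case True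
    then show ?thesis using closure_subset by (intro that[of 1]) auto
  next
    case False
    obtain h where h: "h \<in> closure (heis_ball g 1) - U"
      "\<And>y. y \<in> closure (heis_ball g 1) - U \<Longrightarrow> heis_dist g h \<le> heis_dist g y"
      using continuous_attains_inf[OF K False, of "heis_dist g"] continuous_on_heis_dist[of _ "\<lambda>_. g" "\<lambda>x. x"]
      by (auto intro: continuous_intros)
    have "heis_dist g h > 0"
      using h(1) assms by (metis DiffE heis_dist_eq_0_iff heis_dist_nonneg less_eq_real_def)
    moreover have "heis_ball g (min 1 (heis_dist g h)) \<subseteq> U"
    proof
      fix y assume y: "y \<in> heis_ball g (min 1 (heis_dist g h))"
      then have "y \<in> heis_ball g 1" by (simp add: mem_heis_ball)
      then have "y \<in> closure (heis_ball g 1)" using closure_subset by blast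
      then show "y \<in> U" using h(2)[of y] y by (force simp: mem_heis_ball)
    qed
    ultimately show ?thesis by (intro that[of "min 1 (heis_dist g h)"]) auto
  qed
qed

subsection \<open>Haar measure\<close>

text \<open>For a fixed horizontal part \<open>z\<close> the central coordinate is only translated,
  by \<open>t + w z\<close>. Integrating over it first removes this shift, and a Euclidean
  translation in \<open>z\<close> is left.\<close>

lemma lborel_heis_left_invariant:
  fixes f :: "'n::finite heis \<Rightarrow> ennreal"
  assumes [measurable]: "f \<in> borel_measurable borel"
  shows "(\<integral>\<^sup>+ h. f (g \<odot> h) \<partial>lborel) = (\<integral>\<^sup>+ h. f h \<partial>lborel)"
proof -
  obtain u v t where g: "g = ((u, v), t)" by (metis surj_pair)
  define w where "w = (\<lambda>z::(real^'n)\<times>(real^'n). 2 * (\<Sum>j\<in>UNIV. v $ j * fst z $ j - u $ j * snd z $ j))"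
  have w [measurable]: "w \<in> borel_measurable borel"
    unfolding w_def by (intro borel_measurable_continuous_onI continuous_intros)
  have gm: "g \<odot> (z, s) = ((u, v) + z, (t + w z) + s)" for z s
    by (cases z) (simp add: g heis_mult_def w_def)
  have m: "(\<lambda>h. f (g \<odot> h)) \<in> borel_measurable (lborel \<Otimes>\<^sub>M lborel)"
  proof -
    have "continuous_on UNIV (\<lambda>h. g \<odot> h)"
      by (rule continuous_on_heis_mult) (rule continuous_on_const continuous_on_id)+
    then have "(\<lambda>h. g \<odot> h) \<in> borel_measurable borel" by (rule borel_measurable_continuous_onI)
    then show ?thesis unfolding lborel_prod by simp
  qed
  have f': "f \<in> borel_measurable (lborel \<Otimes>\<^sub>M lborel)" unfolding lborel_prod by simp
  have tr: "(\<integral>\<^sup>+ s. k (a + s) \<partial>lborel) = (\<integral>\<^sup>+ s. k s \<partial>lborel)" if "k \<in> borel_measurable borel"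
    for k :: "'b::euclidean_space \<Rightarrow> ennreal" and a
  proof -
    have "(\<integral>\<^sup>+ s. k s \<partial>lborel) = (\<integral>\<^sup>+ s. k s \<partial>distr lborel borel ((+) a))" by (simp add: lborel_distr_plus)
    also have "\<dots> = (\<integral>\<^sup>+ s. k (a + s) \<partial>lborel)" using that by (subst nn_integral_distr) auto
    finally show ?thesis by simp
  qed
  have fz: "(\<lambda>z. \<integral>\<^sup>+ s. f (z, s) \<partial>lborel) \<in> borel_measurable borel"
    using lborel.borel_measurable_nn_integral_fst[OF f'] by simp
  have "(\<integral>\<^sup>+ h. f (g \<odot> h) \<partial>lborel) = (\<integral>\<^sup>+ z. \<integral>\<^sup>+ s. f (g \<odot> (z, s)) \<partial>lborel \<partial>lborel)"
    using lborel.nn_integral_fst[OF m] by (simp add: lborel_prod)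
  also have "\<dots> = (\<integral>\<^sup>+ z. \<integral>\<^sup>+ s. f ((u, v) + z, s) \<partial>lborel \<partial>lborel)"
  proof (rule nn_integral_cong)
    fix z
    have "(\<lambda>s. f ((u, v) + z, s)) \<in> borel_measurable borel"
      by (rule measurable_compose[OF _ assms]) (intro borel_measurable_continuous_onI continuous_intros)
    from tr[OF this, of "t + w z"] show "(\<integral>\<^sup>+ s. f (g \<odot> (z, s)) \<partial>lborel) = (\<integral>\<^sup>+ s. f ((u, v) + z, s) \<partial>lborel)"
      by (simp add: gm)
  qed
  also have "\<dots> = (\<integral>\<^sup>+ z. \<integral>\<^sup>+ s. f (z, s) \<partial>lborel \<partial>lborel)"
    using tr[OF fz, of "(u, v)"] .
  also have "\<dots> = (\<integral>\<^sup>+ h. f h \<partial>lborel)"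
    using lborel.nn_integral_fst[OF f'] by (simp add: lborel_prod)
  finally show ?thesis .
qed

text \<open>Weight 2 on the centre matches the quadratic term of the group law. It makes
  \<open>heis_norm\<close> homogeneous of degree 1 and the Jacobian equal to r^(2n) r^2 =
  r^Q.\<close>

definition heis_dil :: "real \<Rightarrow> 'n::finite heis \<Rightarrow> 'n heis" where
  "heis_dil r g = (r *\<^sub>R fst g, r\<^sup>2 * snd g)"

lemma heis_norm_dil: "r > 0 \<Longrightarrow> heis_norm (heis_dil r g) = r * heis_norm g"
proof -
  assume r: "r > 0"
  obtain u v t where g: "g = ((u, v), t)" by (metis surj_pair)
  have "norm (r *\<^sub>R u, r *\<^sub>R v) = r * norm (u, v)"
    using r norm_scaleR[of r "(u, v)"] by simp
  then have "heis_norm (heis_dil r g) ^ 4 = (r * heis_norm g) ^ 4"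
    using r by (simp add: heis_dil_def g heis_norm_pow4 power_mult_distrib algebra_simps flip: power_mult)
  then show ?thesis using r by (metis heis_norm_nonneg less_eq_real_def mult_nonneg_nonneg power_eq_iff_eq_base zero_less_numeral)
qed

lemma lborel_heis_dil:
  fixes f :: "'n::finite heis \<Rightarrow> ennreal"
  assumes [measurable]: "f \<in> borel_measurable borel" and r: "r > 0"
  shows "(\<integral>\<^sup>+ h. f h \<partial>lborel) = ennreal (r powr heis_dim TYPE('n)) * (\<integral>\<^sup>+ h. f (heis_dil r h) \<partial>lborel)"
proof -
  \<comment> \<open>The dilation is diagonal in the standard basis: factor \<open>r\<close> on the
    horizontal vectors, which are those with \<open>snd j = 0\<close>, and \<open>r\<^sup>2\<close>
    on the central one.\<close>
  define c :: "'n heis \<Rightarrow> real" where "c = (\<lambda>j. if snd j = 0 then r else r\<^sup>2)"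
  have B: "(Basis :: 'n heis set) = (\<lambda>u. (u, 0)) ` Basis \<union> {(0, 1)}"
    by (simp add: Basis_prod_def)
  have nz: "(u::(real^'n)\<times>(real^'n)) \<in> Basis \<Longrightarrow> u \<noteq> 0" for u using nonzero_Basis by blast
  have inj: "inj_on (\<lambda>u::(real^'n)\<times>(real^'n). (u, 0::real)) Basis" by (auto intro: inj_onI)
  have dis: "(\<lambda>u::(real^'n)\<times>(real^'n). (u, 0::real)) ` Basis \<inter> {(0, 1)} = {}" by auto
  have dil: "(\<Sum>j\<in>Basis. (c j * (x \<bullet> j)) *\<^sub>R j) = heis_dil r x" for x
  proof -
    have "(\<Sum>j\<in>Basis. (c j * (x \<bullet> j)) *\<^sub>R j) =
       (\<Sum>j\<in>Basis. (r * (fst x \<bullet> j)) *\<^sub>R (j, 0)) + (r\<^sup>2 * snd x) *\<^sub>R (0, 1)"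
      unfolding B by (subst sum.union_disjoint[OF _ _ dis])
        (auto simp: sum.reindex[OF inj] c_def inner_prod_def)
    also have "(\<Sum>j\<in>Basis. (r * (fst x \<bullet> j)) *\<^sub>R (j, 0::real)) = (\<Sum>j\<in>Basis. (r * (fst x \<bullet> j)) *\<^sub>R j, 0)"
      by (simp add: prod_eq_iff fst_sum snd_sum)
    also have "(\<Sum>j\<in>Basis. (r * (fst x \<bullet> j)) *\<^sub>R j) = r *\<^sub>R fst x"
      by (simp add: scaleR_sum_right[symmetric] euclidean_representation flip: scaleR_scaleR)
    finally show ?thesis by (simp add: heis_dil_def)
  qed
  have "(\<Prod>j\<in>Basis. \<bar>c j\<bar>) = r ^ (2 * CARD('n)) * r\<^sup>2"
    unfolding B using r by (subst prod.union_disjoint[OF _ _ dis])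
      (auto simp: prod.reindex[OF inj] c_def mult_2)
  also have "\<dots> = r ^ (2 * CARD('n) + 2)" by (simp only: power_add)
  also have "\<dots> = r powr heis_dim TYPE('n)"
    using r powr_realpow[of r "2 * CARD('n) + 2"] by (simp add: heis_dim_def add.commute)
  finally have P: "(\<Prod>j\<in>Basis. \<bar>c j\<bar>) = r powr heis_dim TYPE('n)" .
  have [measurable]: "heis_dil r \<in> borel_measurable borel"
    unfolding heis_dil_def by (intro borel_measurable_continuous_onI continuous_intros)
  have "(lborel :: 'n heis measure) =
      density (distr lborel borel (heis_dil r)) (\<lambda>_. ennreal (r powr heis_dim TYPE('n)))"
  proof -
    have "\<And>j. j \<in> Basis \<Longrightarrow> c j \<noteq> 0" using r by (simp add: c_def)
    from lborel_affine_euclidean[of c 0, OF this] show ?thesis by (simp add: dil P)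
  qed
  then have "(\<integral>\<^sup>+ h. f h \<partial>lborel) =
      (\<integral>\<^sup>+ h. f h \<partial>density (distr lborel borel (heis_dil r)) (\<lambda>_. ennreal (r powr heis_dim TYPE('n))))"
    by simp
  also have "\<dots> = ennreal (r powr heis_dim TYPE('n)) * (\<integral>\<^sup>+ h. f (heis_dil r h) \<partial>lborel)"
    by (simp add: nn_integral_density nn_integral_distr nn_integral_cmult)
  finally show ?thesis .
qed

section \<open>Volume of balls\<close>

definition heis_vol :: "'n::finite itself \<Rightarrow> real" where
  "heis_vol _ = measure lborel (heis_ball (0::'n heis) 1)"

lemma emeasure_heis_ball_finite: "emeasure lborel (heis_ball g r) < \<infinity>"
  using emeasure_bounded_finite[OF bounded_heis_ball[of g r]] by simp

lemma heis_vol_pos: "heis_vol TYPE('n::finite) > 0"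
proof -
  have "emeasure lborel (heis_ball (0::'n heis) 1) > 0"
  proof (rule ccontr)
    assume "\<not> ?thesis"
    then have "heis_ball (0::'n heis) 1 \<in> null_sets lborel" by (intro null_setsI) auto
    then have "negligible (heis_ball (0::'n heis) 1)"
      by (simp add: negligible_iff_null_sets null_sets_completionI)
    moreover have "0 \<in> heis_ball (0::'n heis) 1" by (simp add: mem_heis_ball)
    ultimately show False using open_not_negligible[OF open_heis_ball] by blast
  qed
  then show ?thesis
    unfolding heis_vol_def measure_def using emeasure_heis_ball_finite[of "0::'n heis" 1]
    by (simp add: enn2real_positive_iff)
qed

lemma emeasure_heis_ball:
  fixes g :: "'n::finite heis"
  assumes "r > 0"
  shows "emeasure lborel (heis_ball g r) = ennreal (heis_vol TYPE('n) * r powr heis_dim TYPE('n))"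
proof -
  have "emeasure lborel (heis_ball g r) = (\<integral>\<^sup>+ h. indicator (heis_ball g r) (g \<odot> h) \<partial>lborel)"
    by (subst lborel_heis_left_invariant) auto
  also have "\<dots> = (\<integral>\<^sup>+ h. indicator (heis_ball (0::'n heis) r) h \<partial>lborel)"
    by (intro nn_integral_cong) (simp add: indicator_def heis_ball_def heis_inv_0 heis_mult_zero)
  also have "\<dots> = ennreal (r powr heis_dim TYPE('n)) * (\<integral>\<^sup>+ h. indicator (heis_ball (0::'n heis) r) (heis_dil r h) \<partial>lborel)"
    using assms by (intro lborel_heis_dil) auto
  also have "(\<integral>\<^sup>+ h. indicator (heis_ball (0::'n heis) r) (heis_dil r h) \<partial>lborel) = (\<integral>\<^sup>+ h. indicator (heis_ball (0::'n heis) 1) h \<partial>lborel)"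
    using assms by (intro nn_integral_cong) (simp add: indicator_def heis_ball_def heis_inv_0 heis_mult_zero heis_norm_dil)
  also have "\<dots> = ennreal (heis_vol TYPE('n))"
    using emeasure_heis_ball_finite[of "0::'n heis" 1] by (simp add: heis_vol_def emeasure_eq_ennreal_measure)
  finally show ?thesis by (simp add: ennreal_mult'' mult.commute heis_vol_pos less_imp_le)
qed

lemma measure_heis_ball:
  fixes g :: "'n::finite heis"
  assumes "r > 0"
  shows "measure lborel (heis_ball g r) = heis_vol TYPE('n) * r powr heis_dim TYPE('n)"
  using emeasure_heis_ball[OF assms, of g] heis_vol_pos[where 'n='n] by (simp add: measure_def)

lemma heis_dim_pos: "heis_dim TYPE('n::finite) > 0" by (simp add: heis_dim_def add_pos_pos)

subsection \<open>Powers of extended reals and Hoelder's inequality\<close>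

text \<open>For every exponent \<open>top\<close> goes to \<open>top\<close> and 0 goes to 0, even
  for exponent 0. Together with \<open>0 * top = 0\<close> this makes \<open>epowr_mult\<close>,
  \<open>epowr_add\<close> and \<open>epowr_epowr\<close> hold without side conditions.\<close>

definition epowr :: "ennreal \<Rightarrow> real \<Rightarrow> ennreal" where
  "epowr x a = (if x = top then top else ennreal (enn2real x powr a))"

lemma epowr_ennreal: "0 \<le> x \<Longrightarrow> epowr (ennreal x) a = ennreal (x powr a)"
  by (simp add: epowr_def)

lemma epowr_top [simp]: "epowr top a = top"
  by (simp add: epowr_def)

lemma epowr_0 [simp]: "epowr 0 a = 0"
  by (simp add: epowr_def)

lemma epowr_1 [simp]: "epowr x 1 = x"
  by (cases x) (auto simp: epowr_ennreal)

lemma epowr_eq_0_iff [simp]: "epowr x a = 0 \<longleftrightarrow> x = 0"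
  by (cases x) (auto simp: epowr_ennreal ennreal_eq_0_iff)

lemma epowr_eq_top_iff [simp]: "epowr x a = top \<longleftrightarrow> x = top"
  by (simp add: epowr_def)

lemma epowr_mono: "x \<le> y \<Longrightarrow> 0 \<le> a \<Longrightarrow> epowr x a \<le> epowr y a"
  by (cases x; cases y) (auto simp: epowr_ennreal top_unique intro!: ennreal_leI powr_mono2)

lemma epowr_mult: "epowr (x * y) a = epowr x a * epowr y a"
  by (cases x; cases y; cases "x = 0"; cases "y = 0")
    (auto simp: epowr_ennreal ennreal_mult_top ennreal_top_mult powr_mult ennreal_eq_0_iff simp flip: ennreal_mult)

lemma epowr_epowr: "epowr (epowr x a) b = epowr x (a * b)"
  by (cases x) (auto simp: epowr_ennreal powr_powr)

lemma epowr_add: "epowr x (a + b) = epowr x a * epowr x b"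
  by (cases x) (auto simp: epowr_ennreal powr_add ennreal_mult_top simp flip: ennreal_mult)

lemma epowr_inverse [simp]: "a \<noteq> 0 \<Longrightarrow> epowr (epowr x a) (1 / a) = x" "a \<noteq> 0 \<Longrightarrow> epowr (epowr x (1 / a)) a = x"
  by (simp_all add: epowr_epowr)

lemma borel_measurable_epowr [measurable]:
  assumes [measurable]: "f \<in> borel_measurable M"
  shows "(\<lambda>x. epowr (f x) a) \<in> borel_measurable M"
proof -
  have "(\<lambda>x. epowr (f x) a) = (\<lambda>x. if f x < top then ennreal (enn2real (f x) powr a) else top)"
    by (auto simp: epowr_def fun_eq_iff less_top)
  then show ?thesis by simp
qed

text \<open>Continuity along truncations, used to remove the cutoff in
  \<open>pos_comm_strong\<close>. The inverse power is monotone and reduces the claim to the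
  supremum of \<open>min x n\<close>.\<close>

lemma SUP_epowr_min:
  assumes "0 < a" shows "(SUP n::nat. epowr (min x (of_nat n)) a) = epowr x a"
proof (rule antisym)
  show "(SUP n::nat. epowr (min x (of_nat n)) a) \<le> epowr x a"
    using assms by (intro SUP_least epowr_mono) auto
  have "x \<le> epowr (SUP n::nat. epowr (min x (of_nat n)) a) (1 / a)"
  proof -
    have "min x (of_nat n) \<le> epowr (SUP n::nat. epowr (min x (of_nat n)) a) (1 / a)" for n :: nat
    proof -
      have "epowr (epowr (min x (of_nat n)) a) (1 / a) \<le> epowr (SUP n::nat. epowr (min x (of_nat n)) a) (1 / a)"
        using assms by (intro epowr_mono SUP_upper) auto
      then show ?thesis using assms by simp
    qed
    then have "(SUP n::nat. min x (of_nat n)) \<le> epowr (SUP n::nat. epowr (min x (of_nat n)) a) (1 / a)"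
      by (intro SUP_least)
    moreover have "(SUP n::nat. min x (of_nat n)) = x"
      using inf_SUP[of x "\<lambda>n::nat. of_nat n :: ennreal" UNIV]
      by (simp add: inf_min ennreal_SUP_of_nat_eq_top)
    ultimately show ?thesis by simp
  qed
  from epowr_mono[OF this, of a] assms show "epowr x a \<le> (SUP n::nat. epowr (min x (of_nat n)) a)"
    by simp
qed

lemma holder_inequality:
  fixes u v :: "'a \<Rightarrow> ennreal"
  assumes [measurable]: "u \<in> borel_measurable M" "v \<in> borel_measurable M"
    and pq: "p > 1" "1 / p + 1 / q = 1"
  shows "(\<integral>\<^sup>+ x. u x * v x \<partial>M) \<le> epowr (\<integral>\<^sup>+ x. epowr (u x) p \<partial>M) (1 / p) * epowr (\<integral>\<^sup>+ x. epowr (v x) q \<partial>M) (1 / q)"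
proof -
  have q: "q > 1"
  proof -
    have "0 < 1 / p" "1 / p < 1" using pq by auto
    then have "0 < 1 / q" "1 / q < 1" using pq(2) by linarith+
    then show ?thesis by (simp add: divide_less_eq split: if_splits)
  qed
  let ?A = "\<integral>\<^sup>+ x. epowr (u x) p \<partial>M" and ?B = "\<integral>\<^sup>+ x. epowr (v x) q \<partial>M"
  \<comment> \<open>Because \<open>0 * top = 0\<close>, one vanishing factor makes the right side 0
    even if the other factor is infinite; then the integrand on the left has to vanish almost
    everywhere.\<close>
  consider "?A = 0" | "?B = 0" | "?A \<noteq> 0" "?B \<noteq> 0" "?A = top \<or> ?B = top"
    | "?A \<noteq> 0" "?B \<noteq> 0" "?A \<noteq> top" "?B \<noteq> top" by blast
  then show ?thesis
  proof cases
    case 1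
    then have "AE x in M. u x = 0" by (simp add: nn_integral_0_iff_AE)
    then have "(\<integral>\<^sup>+ x. u x * v x \<partial>M) = 0" by (subst nn_integral_0_iff_AE) auto
    then show ?thesis by simp
  next
    case 2
    then have "AE x in M. v x = 0" by (simp add: nn_integral_0_iff_AE)
    then have "(\<integral>\<^sup>+ x. u x * v x \<partial>M) = 0" by (subst nn_integral_0_iff_AE) auto
    then show ?thesis by simp
  next
    case 3
    then show ?thesis by (auto simp: ennreal_mult_top ennreal_top_mult)
  next
    case 4
    obtain A where A: "?A = ennreal A" "A > 0" using 4 by (cases ?A) (auto simp: less_le)
    obtain B where B: "?B = ennreal B" "B > 0" using 4 by (cases ?B) (auto simp: less_le)
    define a b where "a = A powr (1 / p)" and "b = B powr (1 / q)"
    have ab: "a > 0" "b > 0" using A B by (auto simp: a_def b_def)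
    have ap: "a powr p = A" "b powr q = B" using A B pq q by (auto simp: a_def b_def powr_powr)
    \<comment> \<open>Young's inequality for u/a and v/b, where a and b are the two norms,
      multiplied by ab. After integration the two terms become ab/p and ab/q.\<close>
    have young: "u x * v x \<le> ennreal (a * b / (p * A)) * epowr (u x) p + ennreal (a * b / (q * B)) * epowr (v x) q" for x
    proof (cases "u x"; cases "v x")
      fix s t assume st: "u x = ennreal s" "v x = ennreal t" "0 \<le> s" "0 \<le> t"
      have "(s / a) * (t / b) \<le> (s / a) powr p / p + (t / b) powr q / q"
        using pq q st ab by (intro Youngs_inequality) auto
      also have "\<dots> = s powr p / (p * A) + t powr q / (q * B)"
        using st ab by (simp add: powr_divide ap field_simps)
      finally have "s * t \<le> (a * b) * (s powr p / (p * A) + t powr q / (q * B))"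
        using ab by (simp add: field_simps)
      then show ?thesis using st ab A B pq q
        by (simp add: epowr_ennreal algebra_simps flip: ennreal_mult ennreal_plus)
    qed (use ab A B pq q in \<open>auto simp: ennreal_mult_top ennreal_top_mult\<close>)
    have "(\<integral>\<^sup>+ x. u x * v x \<partial>M) \<le> (\<integral>\<^sup>+ x. ennreal (a * b / (p * A)) * epowr (u x) p + ennreal (a * b / (q * B)) * epowr (v x) q \<partial>M)"
      by (intro nn_integral_mono young)
    also have "\<dots> = ennreal (a * b / (p * A)) * ennreal A + ennreal (a * b / (q * B)) * ennreal B"
      by (simp add: nn_integral_add nn_integral_cmult A B)
    also have "\<dots> = ennreal (a * b / p + a * b / q)"
      using ab A B pq q by (simp flip: ennreal_mult ennreal_plus)
    also have "a * b / p + a * b / q = a * b * (1 / p + 1 / q)" by (simp add: algebra_simps)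
    also have "ennreal \<dots> = ennreal a * ennreal b" using pq ab by (simp add: ennreal_mult)
    also have "\<dots> = epowr ?A (1 / p) * epowr ?B (1 / q)" using A B by (simp add: epowr_ennreal a_def b_def)
    finally show ?thesis .
  qed
qed

subsection \<open>Integrals of powers\<close>

lemma nn_integral_powr_less:
  assumes "a > 0" "0 \<le> R"
  shows "(\<integral>\<^sup>+ t\<in>{0<..<R}. ennreal (t powr (a - 1)) \<partial>lborel) = ennreal (R powr a / a)"
proof -
  have "((\<lambda>t. t powr (a - 1)) has_integral R powr a / a) {0..R}"
    using has_integral_powr_from_0[of "a - 1" R] assms by simp
  from nn_integral_has_integral_lebesgue[OF _ this]
  have "(\<integral>\<^sup>+ t. indicator {0..R} t * ennreal (t powr (a - 1)) \<partial>lborel) = ennreal (R powr a / a)"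
    by (simp add: ennreal_mult' ennreal_indicator)
  moreover have "AE t in lborel. t \<noteq> R" "AE t in lborel. t \<noteq> 0"
    by (rule AE_lborel_singleton)+
  ultimately show ?thesis
    by (subst nn_integral_cong_AE[of _ "\<lambda>t. indicator {0..R} t * ennreal (t powr (a - 1))"]) (auto simp: indicator_def)
qed

lemma nn_integral_powr_greater:
  assumes "a > 0" "0 < R"
  shows "(\<integral>\<^sup>+ t\<in>{R<..}. ennreal (t powr (- a - 1)) \<partial>lborel) = ennreal (R powr (- a) / a)"
proof -
  have "((\<lambda>t. t powr (- a - 1)) has_integral R powr (- a) / a) {R..}"
    using has_integral_powr_to_inf[of "- a - 1" R] assms by simp
  from nn_integral_has_integral_lebesgue[OF _ this]
  have "(\<integral>\<^sup>+ t. indicator {R..} t * ennreal (t powr (- a - 1)) \<partial>lborel) = ennreal (R powr (- a) / a)"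
    by (simp add: ennreal_mult' ennreal_indicator)
  moreover have "AE t in lborel. t \<noteq> R"
    by (rule AE_lborel_singleton)
  ultimately show ?thesis
    by (subst nn_integral_cong_AE[of _ "\<lambda>t. indicator {R..} t * ennreal (t powr (- a - 1))"]) (auto simp: indicator_def)
qed

text \<open>The layer cake formula for a value that may be infinite. With
  \<open>y = HLmax u x\<close> and with \<open>y = 2 * u x\<close> it supplies both ends of
  \<open>HLmax_strong\<close>.\<close>

lemma nn_integral_powr_less_ennreal:
  assumes "a > 0"
  shows "(\<integral>\<^sup>+ t\<in>{t. 0 < t \<and> ennreal t < y}. ennreal (t powr (a - 1)) \<partial>lborel) = epowr y a * ennreal (1 / a)"
proof (cases y)
  case (real r)
  have "{t. 0 < t \<and> ennreal t < y} = {0<..<r}" using real by (auto simp: ennreal_less_iff)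
  then show ?thesis using nn_integral_powr_less[of a r] assms real
    by (simp add: epowr_ennreal flip: ennreal_mult)
next
  case top
  let ?I = "\<integral>\<^sup>+ t\<in>{t. 0 < t \<and> ennreal t < y}. ennreal (t powr (a - 1)) \<partial>lborel"
  have "ennreal (real n) \<le> ?I" for n :: nat
  proof -
    \<comment> \<open>The upper limit for which the integral is exactly \<open>n\<close>; for n = 0
      it is 0.\<close>
    define R where "R = (real n * a) powr (1 / a)"
    have "ennreal (real n) = ennreal (R powr a / a)"
      using assms by (cases "n = 0") (auto simp: R_def powr_powr)
    also have "\<dots> = (\<integral>\<^sup>+ t\<in>{0<..<R}. ennreal (t powr (a - 1)) \<partial>lborel)"
      using assms by (intro nn_integral_powr_less[symmetric]) (auto simp: R_def)
    also have "\<dots> \<le> ?I" using top by (intro nn_integral_mono) (auto simp: indicator_def ennreal_less_top)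
    finally show ?thesis .
  qed
  then have "(SUP n::nat. of_nat n :: ennreal) \<le> ?I"
    by (intro SUP_least) (simp add: ennreal_of_nat_eq_real_of_nat)
  then have "?I = top" unfolding ennreal_SUP_of_nat_eq_top top_unique .
  then show ?thesis using assms top by (simp add: ennreal_top_mult)
qed

subsection \<open>Vitali coverings\<close>

text \<open>Greedy selection: a ball of largest radius, once tripled, contains every ball that it
  meets, and the induction continues with the balls disjoint from it.\<close>

lemma finite_vitali:
  fixes X :: "'n::finite heis set"
  assumes "finite X"
  shows "\<exists>J\<subseteq>X. disjoint_family_on (\<lambda>x. heis_ball x (r x)) J \<and>
    (\<Union>x\<in>X. heis_ball x (r x)) \<subseteq> (\<Union>x\<in>J. heis_ball x (3 * r x))"
  using assms
proof (induction "card X" arbitrary: X rule: less_induct)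
  case less
  show ?case
  proof (cases "X = {}")
    case False
    then obtain x where x: "x \<in> X" "\<And>y. y \<in> X \<Longrightarrow> r y \<le> r x"
      using obtains_MAX[OF less.prems] by (metis Max_ge finite_imageI imageI less.prems)
    show ?thesis
    proof (cases "r x > 0")
      case rx: True
    define Y where "Y = {y\<in>X. heis_ball y (r y) \<inter> heis_ball x (r x) = {}}"
    have "x \<in> heis_ball x (r x)" using rx by (simp add: mem_heis_ball)
    then have xY: "x \<notin> Y" by (auto simp: Y_def)
    then have "Y \<subset> X" using x by (auto simp: Y_def)
    then have "card Y < card X" "finite Y" using less.prems psubset_card_mono finite_subset by blast+
    from less.hyps[OF this] obtain J where J: "J \<subseteq> Y" "disjoint_family_on (\<lambda>x. heis_ball x (r x)) J"
      "(\<Union>x\<in>Y. heis_ball x (r x)) \<subseteq> (\<Union>x\<in>J. heis_ball x (3 * r x))" by blast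
    have "heis_ball y (r y) \<subseteq> heis_ball x (3 * r x)" if "y \<in> X" "y \<notin> Y" for y
    proof -
      obtain z where z: "z \<in> heis_ball y (r y)" "z \<in> heis_ball x (r x)" using \<open>y \<in> X\<close> \<open>y \<notin> Y\<close> unfolding Y_def by blast
      have "heis_dist x y < r x + r y"
        using heis_dist_triangle[of x y z] z by (simp add: mem_heis_ball heis_dist_commute)
      then show ?thesis using x(2)[OF \<open>y \<in> X\<close>] by (intro heis_ball_subset) simp
    qed
    then have "(\<Union>x\<in>X. heis_ball x (r x)) \<subseteq> (\<Union>x\<in>insert x J. heis_ball x (3 * r x))"
      using J(3) by blast
    moreover have "disjoint_family_on (\<lambda>x. heis_ball x (r x)) (insert x J)"
      using J(1,2) xY unfolding disjoint_family_on_def Y_def by blast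
    moreover have "insert x J \<subseteq> X" using J(1) x(1) by (auto simp: Y_def)
    ultimately show ?thesis by blast
    next
      case False
      \<comment> \<open>If the largest radius is not positive, all balls are empty and the empty
        subfamily will do.\<close>
      have "heis_ball y (r y) = {}" if "y \<in> X" for y
      proof -
        have "r y \<le> 0" using x(2)[OF that] False by simp
        then show ?thesis by (auto simp: heis_ball_eq not_less intro: order_trans[OF _ heis_dist_nonneg])
      qed
      then show ?thesis by (intro exI[of _ "{}"]) (auto simp: disjoint_family_on_def)
    qed
  qed (auto simp: disjoint_family_on_def)
qed

text \<open>The covering principle behind both the maximal theorem and the John-Nirenberg
  inequality. Lindelof's theorem gives a countable subcover and continuity from below reduces it to
  finite subfamilies, in which a largest radius exists.\<close>

lemma vitali_bound:
  fixes X :: "'n::finite heis set"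
  assumes E [measurable]: "E \<in> sets borel" and sub: "E \<subseteq> (\<Union>x\<in>X. heis_ball x (r x))"
    and J: "\<And>J. finite J \<Longrightarrow> J \<subseteq> X \<Longrightarrow> disjoint_family_on (\<lambda>x. heis_ball x (r x)) J \<Longrightarrow>
      emeasure lborel (E \<inter> (\<Union>x\<in>J. heis_ball x (3 * r x))) \<le> A"
  shows "emeasure lborel E \<le> A"
proof (cases "E = {}")
  case False
  obtain F where F: "F \<subseteq> (\<lambda>x. heis_ball x (r x)) ` X" "countable F" "\<Union>F = (\<Union>x\<in>X. heis_ball x (r x))"
    using Lindelof[of "(\<lambda>x. heis_ball x (r x)) ` X"] open_heis_ball by (metis (no_types, lifting) imageE)
  obtain Y where Y: "countable Y" "Y \<subseteq> X" "F = (\<lambda>x. heis_ball x (r x)) ` Y"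
    using countable_subset_image[of F "\<lambda>x. heis_ball x (r x)" X] F(1,2) by blast
  have "Y \<noteq> {}" using False F Y sub by auto
  define e where "e = from_nat_into Y"
  have e: "range e = Y" using \<open>Y \<noteq> {}\<close> Y by (simp add: e_def range_from_nat_into)
  define En where "En n = E \<inter> (\<Union>i<n. heis_ball (e i) (r (e i)))" for n :: nat
  have "E = (\<Union>n. En n)"
  proof -
    have "\<exists>n. x \<in> En n" if "x \<in> E" for x
    proof -
      have "x \<in> \<Union>F" using sub that F by auto
      then obtain i where "x \<in> heis_ball (e i) (r (e i))" using Y e by auto
      then show ?thesis using that by (auto simp: En_def intro!: exI[of _ "Suc i"])
    qed
    then show ?thesis by (auto simp: En_def)
  qed
  moreover have "incseq En" unfolding En_def by (intro incseq_SucI Int_mono UN_mono) auto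
  moreover have "range En \<subseteq> sets lborel" by (auto simp: En_def)
  ultimately have "emeasure lborel E = (SUP n. emeasure lborel (En n))"
    by (simp add: SUP_emeasure_incseq)
  also have "\<dots> \<le> A"
  proof (rule SUP_least)
    fix n
    obtain J' where J': "J' \<subseteq> e ` {..<n}" "disjoint_family_on (\<lambda>x. heis_ball x (r x)) J'"
      "(\<Union>x\<in>e ` {..<n}. heis_ball x (r x)) \<subseteq> (\<Union>x\<in>J'. heis_ball x (3 * r x))"
      using finite_vitali[of "e ` {..<n}" r] by auto
    have fin: "finite J'" using J' finite_subset by blast
    have "En n \<subseteq> E \<inter> (\<Union>x\<in>J'. heis_ball x (3 * r x))" using J'(3) by (auto simp: En_def)
    then have "emeasure lborel (En n) \<le> emeasure lborel (E \<inter> (\<Union>x\<in>J'. heis_ball x (3 * r x)))"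
      using fin by (intro emeasure_mono) (auto intro!: sets.Int sets.finite_UN)
    also have "\<dots> \<le> A"
    proof (rule J[OF fin])
      show "J' \<subseteq> X" using J'(1) e Y(2) by blast
    qed fact
    finally show "emeasure lborel (En n) \<le> A" .
  qed
  finally show ?thesis .
qed simp

subsection \<open>The maximal function\<close>

definition hvol :: "'n::finite itself \<Rightarrow> real \<Rightarrow> real" where
  "hvol _ r = heis_vol TYPE('n) * r powr heis_dim TYPE('n)"

lemma hvol_pos [simp]: "r > 0 \<Longrightarrow> hvol TYPE('n::finite) r > 0"
  by (simp add: hvol_def heis_vol_pos)

lemma hvol_mult: "0 \<le> c \<Longrightarrow> 0 \<le> r \<Longrightarrow> hvol TYPE('n::finite) (c * r) = c powr heis_dim TYPE('n) * hvol TYPE('n) r"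
  by (simp add: hvol_def powr_mult)

lemma hvol_mono: "0 \<le> r \<Longrightarrow> r \<le> s \<Longrightarrow> hvol TYPE('n::finite) r \<le> hvol TYPE('n) s"
  unfolding hvol_def using heis_vol_pos[where 'n='n] heis_dim_pos[where 'n='n]
  by (intro mult_left_mono powr_mono2) auto

lemma emeasure_heis_ball_hvol: "r > 0 \<Longrightarrow> emeasure lborel (heis_ball (g::'n::finite heis) r) = ennreal (hvol TYPE('n) r)"
  by (simp add: emeasure_heis_ball hvol_def)

definition havg :: "('n::finite heis \<Rightarrow> ennreal) \<Rightarrow> 'n heis \<Rightarrow> real \<Rightarrow> ennreal" where
  "havg u x r = ennreal (1 / hvol TYPE('n) r) * (\<integral>\<^sup>+ h\<in>heis_ball x r. u h \<partial>lborel)"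

definition HLmax :: "('n::finite heis \<Rightarrow> ennreal) \<Rightarrow> 'n heis \<Rightarrow> ennreal" where
  "HLmax u x = (SUP r\<in>{0<..}. havg u x r)"

lemma havg_le_HLmax: "r > 0 \<Longrightarrow> havg u x r \<le> HLmax u x"
  unfolding HLmax_def by (rule SUP_upper) simp

lemma pred_heis_ball [measurable]:
  fixes f g :: "'b \<Rightarrow> 'n::finite heis"
  assumes [measurable]: "f \<in> borel_measurable M" "g \<in> borel_measurable M" "r \<in> borel_measurable M"
  shows "Measurable.pred M (\<lambda>x. g x \<in> heis_ball (f x) (r x))"
  unfolding mem_heis_ball by measurable

lemma borel_measurable_nn_integral_heis_ball:
  fixes k :: "'n::finite heis \<Rightarrow> 'n heis \<Rightarrow> ennreal"
  assumes k [measurable]: "(\<lambda>z. k (fst z) (snd z)) \<in> borel_measurable (borel \<Otimes>\<^sub>M borel)"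
  shows "(\<lambda>x. \<integral>\<^sup>+ h\<in>heis_ball x r. k x h \<partial>lborel) \<in> borel_measurable borel"
proof -
  have "(\<lambda>z. k (fst z) (snd z) * indicator (heis_ball (fst z) r) (snd z)) \<in> borel_measurable (borel \<Otimes>\<^sub>M borel)"
    by measurable
  then have "(\<lambda>(x, h). k x h * indicator (heis_ball x r) h) \<in> borel_measurable (borel \<Otimes>\<^sub>M lborel)"
    by (simp add: case_prod_beta cong: measurable_cong_sets)
  from lborel.borel_measurable_nn_integral[OF this] show ?thesis by simp
qed

text \<open>Rational radii suffice: the balls are open, so the integral is left continuous in the
  radius, and \<open>c\<close> is decreasing, so moving to a rational slightly below
  \<open>r\<close> cannot lower the first factor.\<close>

lemma borel_measurable_SUP_heis_ball:
  fixes k :: "'n::finite heis \<Rightarrow> 'n heis \<Rightarrow> ennreal" and c :: "real \<Rightarrow> ennreal"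
  assumes k [measurable]: "(\<lambda>z. k (fst z) (snd z)) \<in> borel_measurable (borel \<Otimes>\<^sub>M borel)"
    and c: "\<And>r s. 0 < r \<Longrightarrow> r \<le> s \<Longrightarrow> c s \<le> c r"
  shows "(\<lambda>x. SUP r\<in>{0<..}. c r * (\<integral>\<^sup>+ h\<in>heis_ball x r. k x h \<partial>lborel)) \<in> borel_measurable borel"
proof -
  define F where "F x r = (\<integral>\<^sup>+ h\<in>heis_ball x r. k x h \<partial>lborel)" for x r
  have F_mono: "F x r \<le> F x s" if "r \<le> s" for x r s
    unfolding F_def by (intro nn_set_integral_set_mono heis_ball_mono that)
  have "(SUP r\<in>{0<..}. c r * F x r) = (SUP q\<in>{q::rat. 0 < q}. c (of_rat q) * F x (of_rat q))" for x
  proof (rule antisym)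
    show "(SUP q\<in>{q::rat. 0 < q}. c (of_rat q) * F x (of_rat q)) \<le> (SUP r\<in>{0<..}. c r * F x r)"
      by (intro SUP_least SUP_upper) simp
    show "(SUP r\<in>{0<..}. c r * F x r) \<le> (SUP q\<in>{q::rat. 0 < q}. c (of_rat q) * F x (of_rat q))"
    proof (rule SUP_least)
      fix r :: real assume "r \<in> {0<..}"
      then have r: "r > 0" by simp
      \<comment> \<open>Radii increasing to \<open>r\<close> strictly from below; the offset 2 keeps
        \<open>s 0\<close> positive.\<close>
      define s where "s n = r * (1 - 1 / real (n + 2))" for n
      have s: "0 < s n" "s n < r" for n using r by (auto simp: s_def field_simps intro: add_pos_nonneg)
      have sl: "s \<longlonglongrightarrow> r * (1 - 0)"
        unfolding s_def by (intro tendsto_intros LIMSEQ_ignore_initial_segment[OF lim_1_over_n])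
      have "incseq s"
        unfolding s_def incseq_def using r by (auto intro!: mult_left_mono simp: frac_le)
      have U: "indicator (heis_ball x r) h = (SUP n. indicator (heis_ball x (s n)) h :: ennreal)" for h
      proof (cases "h \<in> heis_ball x r")
        case True
        then have "eventually (\<lambda>n. heis_dist x h < s n) sequentially"
          using sl by (intro order_tendstoD) (auto simp: mem_heis_ball)
        then obtain n where "heis_dist x h < s n" by (metis eventually_sequentially order_refl)
        then have n: "h \<in> heis_ball x (s n)" by (simp add: mem_heis_ball)
        then have "(1::ennreal) \<le> (SUP n. indicator (heis_ball x (s n)) h)"
          using n by (intro SUP_upper2[of n]) auto
        moreover have "(SUP n. indicator (heis_ball x (s n)) h) \<le> (1::ennreal)"
          by (intro SUP_least) (auto simp: indicator_def)
        ultimately have "(SUP n. indicator (heis_ball x (s n)) h) = (1::ennreal)" by (rule antisym[rotated])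
        then show ?thesis using True by simp
      next
        case False
        then have "h \<notin> heis_ball x (s n)" for n using s[of n] by (auto simp: mem_heis_ball)
        then show ?thesis using False by simp
      qed
      have km: "(\<lambda>h. k x h) \<in> borel_measurable lborel"
        using measurable_compose[OF measurable_Pair1' k, of x] by simp
      have "F x r = (\<integral>\<^sup>+ h. (SUP n. k x h * indicator (heis_ball x (s n)) h) \<partial>lborel)"
        unfolding F_def U by (simp add: SUP_mult_left_ennreal)
      also have "\<dots> = (SUP n. F x (s n))"
        unfolding F_def
      proof (rule nn_integral_monotone_convergence_SUP)
        show "incseq (\<lambda>n h. k x h * indicator (heis_ball x (s n)) h)"
          using \<open>incseq s\<close> by (auto simp: incseq_def le_fun_def indicator_def mem_heis_ball intro: order.strict_trans2)
        show "(\<lambda>h. k x h * indicator (heis_ball x (s n)) h) \<in> borel_measurable lborel" for n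
          using km by measurable
      qed
      finally have "c r * F x r = (SUP n. c r * F x (s n))" by (simp add: SUP_mult_left_ennreal)
      also have "\<dots> \<le> (SUP q\<in>{q::rat. 0 < q}. c (of_rat q) * F x (of_rat q))"
      proof (rule SUP_least)
        fix n
        obtain q where q: "s n < of_rat q" "of_rat q < r" using of_rat_dense[OF s(2)] by blast
        then have q0: "0 < (of_rat q :: real)" using s(1)[of n] by linarith
        have "c r * F x (s n) \<le> c (of_rat q) * F x (of_rat q)"
          using q q0 by (intro mult_mono c F_mono) auto
        also have "\<dots> \<le> (SUP q\<in>{q::rat. 0 < q}. c (of_rat q) * F x (of_rat q))"
          using q0 by (intro SUP_upper) simp
        finally show "c r * F x (s n) \<le> (SUP q\<in>{q::rat. 0 < q}. c (of_rat q) * F x (of_rat q))" .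
      qed
      finally show "c r * F x r \<le> (SUP q\<in>{q::rat. 0 < q}. c (of_rat q) * F x (of_rat q))" .
    qed
  qed
  moreover have "(\<lambda>x. SUP q\<in>{q::rat. 0 < q}. c (of_rat q) * F x (of_rat q)) \<in> borel_measurable borel"
  proof (rule borel_measurable_SUP)
    fix q :: rat
    have [measurable]: "(\<lambda>x. F x (of_rat q)) \<in> borel_measurable borel"
      unfolding F_def by (rule borel_measurable_nn_integral_heis_ball) measurable
    show "(\<lambda>x. c (of_rat q) * F x (of_rat q)) \<in> borel_measurable borel" by measurable
  qed simp
  ultimately show ?thesis unfolding F_def by simp
qed

lemma borel_measurable_HLmax [measurable]:
  fixes u :: "'n::finite heis \<Rightarrow> ennreal"
  assumes [measurable]: "u \<in> borel_measurable borel"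
  shows "HLmax u \<in> borel_measurable borel"
proof -
  have "(\<lambda>x. SUP r\<in>{0<..}. ennreal (1 / hvol TYPE('n) r) * (\<integral>\<^sup>+ h\<in>heis_ball x r. u h \<partial>lborel)) \<in> borel_measurable borel"
    by (rule borel_measurable_SUP_heis_ball) (auto intro!: ennreal_leI divide_left_mono hvol_mono)
  then show ?thesis unfolding HLmax_def[abs_def] havg_def .
qed

lemma havg_add:
  assumes [measurable]: "u \<in> borel_measurable borel" "v \<in> borel_measurable borel"
  shows "havg (\<lambda>x. u x + v x) x r = havg u x r + havg v x r"
  unfolding havg_def by (simp add: distrib_left distrib_right nn_integral_add)

lemma havg_mono: "(\<And>h. u h \<le> v h) \<Longrightarrow> havg u x r \<le> havg v x r"
  unfolding havg_def by (intro mult_left_mono nn_integral_mono mult_right_mono) auto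

lemma havg_const: "r > 0 \<Longrightarrow> havg (\<lambda>_. c) (x::'n::finite heis) r = c"
proof -
  assume r: "r > 0"
  have "havg (\<lambda>_. c) x r = c * (ennreal (1 / hvol TYPE('n) r) * ennreal (hvol TYPE('n) r))"
    using r by (simp add: havg_def nn_integral_cmult_indicator emeasure_heis_ball_hvol mult_ac)
  also have "\<dots> = c" using hvol_pos[OF r, where 'n='n] by (simp flip: ennreal_mult)
  finally show ?thesis .
qed

lemma nn_integral_heis_ball_eq_havg:
  "r > 0 \<Longrightarrow> (\<integral>\<^sup>+ h\<in>heis_ball (x::'n::finite heis) r. u h \<partial>lborel) = ennreal (hvol TYPE('n) r) * havg u x r"
proof -
  assume r: "r > 0"
  have "ennreal (hvol TYPE('n) r) * ennreal (1 / hvol TYPE('n) r) = 1"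
    using hvol_pos[OF r, where 'n='n] by (simp flip: ennreal_mult)
  then show ?thesis by (simp add: havg_def flip: mult.assoc)
qed

section \<open>Weak and strong type of the maximal function\<close>

lemma sum_nn_integral_disjoint_le:
  fixes u :: "'a \<Rightarrow> ennreal"
  assumes [measurable]: "u \<in> borel_measurable M" "\<And>j. j \<in> J \<Longrightarrow> A j \<in> sets M" "B \<in> sets M"
    and J: "finite J" "disjoint_family_on A J" "\<And>j. j \<in> J \<Longrightarrow> A j \<subseteq> B"
  shows "(\<Sum>j\<in>J. \<integral>\<^sup>+ x\<in>A j. u x \<partial>M) \<le> (\<integral>\<^sup>+ x\<in>B. u x \<partial>M)"
proof -
  have "(\<Sum>j\<in>J. \<integral>\<^sup>+ x\<in>A j. u x \<partial>M) = (\<integral>\<^sup>+ x. u x * (\<Sum>j\<in>J. indicator (A j) x) \<partial>M)"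
    by (simp add: sum_distrib_left nn_integral_sum)
  also have "\<dots> \<le> (\<integral>\<^sup>+ x\<in>B. u x \<partial>M)"
  proof (intro nn_integral_mono mult_left_mono)
    fix x
    have "(\<Sum>j\<in>J. indicator (A j) x) = (indicator (\<Union>j\<in>J. A j) x :: ennreal)"
      using J by (simp add: indicator_UN_disjoint)
    also have "\<dots> \<le> indicator B x" using J(3) by (auto simp: indicator_def)
    finally show "(\<Sum>j\<in>J. indicator (A j) x) \<le> (indicator B x :: ennreal)" .
  qed simp
  finally show ?thesis .
qed

text \<open>Every point of the level set is the centre of a ball B for which t |B| is at most the
  integral of u over B. For disjoint balls these integrals add up to at most the whole integral; 3^Q
  is the price of tripling.\<close>

lemma HLmax_weak:
  fixes u :: "'n::finite heis \<Rightarrow> ennreal"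
  assumes [measurable]: "u \<in> borel_measurable borel" and t: "t > 0"
  shows "emeasure lborel {x. ennreal t < HLmax u x} \<le> ennreal (3 powr heis_dim TYPE('n) / t) * (\<integral>\<^sup>+ h. u h \<partial>lborel)"
proof -
  let ?E = "{x. ennreal t < HLmax u x}"
  have "\<exists>r>0. ennreal t < havg u x r" if "x \<in> ?E" for x
    using that by (auto simp: HLmax_def less_SUP_iff)
  then obtain r where r: "\<And>x. x \<in> ?E \<Longrightarrow> r x > 0 \<and> ennreal t < havg u x (r x)" by metis
  show ?thesis
  proof (rule vitali_bound[where X = ?E and r = r])
    show "?E \<in> sets borel" by measurable
    show "?E \<subseteq> (\<Union>x\<in>?E. heis_ball x (r x))"
    proof
      fix x assume "x \<in> ?E"
      moreover from this have "x \<in> heis_ball x (r x)" using r by (simp add: mem_heis_ball)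
      ultimately show "x \<in> (\<Union>x\<in>?E. heis_ball x (r x))" by blast
    qed
    fix J assume J: "finite J" "J \<subseteq> ?E" "disjoint_family_on (\<lambda>x. heis_ball x (r x)) J"
    have "emeasure lborel (?E \<inter> (\<Union>x\<in>J. heis_ball x (3 * r x))) \<le> emeasure lborel (\<Union>x\<in>J. heis_ball x (3 * r x))"
      using J by (intro emeasure_mono) auto
    also have "\<dots> \<le> (\<Sum>x\<in>J. emeasure lborel (heis_ball x (3 * r x)))"
      using J by (intro emeasure_subadditive_finite) auto
    also have "\<dots> \<le> (\<Sum>x\<in>J. ennreal (3 powr heis_dim TYPE('n) / t) * (\<integral>\<^sup>+ h\<in>heis_ball x (r x). u h \<partial>lborel))"
    proof (rule sum_mono)
      fix x assume "x \<in> J"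
      then have rx: "r x > 0" "ennreal t < havg u x (r x)" using J(2) r[of x] by blast+
      let ?V = "hvol TYPE('n) (r x)"
      have "emeasure lborel (heis_ball x (3 * r x)) = ennreal (3 powr heis_dim TYPE('n) / t) * (ennreal ?V * ennreal t)"
        using rx t by (simp add: emeasure_heis_ball_hvol hvol_mult less_imp_le flip: ennreal_mult)
      also have "\<dots> \<le> ennreal (3 powr heis_dim TYPE('n) / t) * (ennreal ?V * havg u x (r x))"
        using rx by (intro mult_left_mono) auto
      finally show "emeasure lborel (heis_ball x (3 * r x)) \<le> ennreal (3 powr heis_dim TYPE('n) / t) * (\<integral>\<^sup>+ h\<in>heis_ball x (r x). u h \<partial>lborel)"
        using rx by (simp add: nn_integral_heis_ball_eq_havg)
    qed
    also have "\<dots> \<le> ennreal (3 powr heis_dim TYPE('n) / t) * (\<integral>\<^sup>+ h\<in>UNIV. u h \<partial>lborel)"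
      unfolding sum_distrib_left[symmetric]
      by (intro mult_left_mono sum_nn_integral_disjoint_le) (use J in auto)
    also have "(\<integral>\<^sup>+ h\<in>UNIV. u h \<partial>lborel) = (\<integral>\<^sup>+ h. u h \<partial>lborel)" by simp
    finally show "emeasure lborel (?E \<inter> (\<Union>x\<in>J. heis_ball x (3 * r x))) \<le> ennreal (3 powr heis_dim TYPE('n) / t) * (\<integral>\<^sup>+ h. u h \<partial>lborel)" .
  qed
qed

lemma ennreal_half_less_iff: "ennreal (t / 2) < y \<longleftrightarrow> ennreal t < 2 * y" if "t \<ge> 0"
proof (cases y)
  case (real r)
  have "2 * ennreal r = ennreal (2 * r)" using real by (simp add: ennreal_mult)
  then show ?thesis using real that by (auto simp: ennreal_less_iff)
qed (auto simp: ennreal_mult_top)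

text \<open>Values of \<open>u\<close> up to t/2 contribute at most t/2 to any average, so only the
  part above t/2 can lift the maximal function beyond t. The weak bound for that part at level t/2
  gives the factor 2.\<close>

lemma HLmax_weak_truncated:
  fixes u :: "'n::finite heis \<Rightarrow> ennreal"
  assumes [measurable]: "u \<in> borel_measurable borel" and t: "t > 0"
  shows "emeasure lborel {x. ennreal t < HLmax u x} \<le>
    ennreal (2 * 3 powr heis_dim TYPE('n) / t) * (\<integral>\<^sup>+ h\<in>{h. ennreal t < 2 * u h}. u h \<partial>lborel)"
proof -
  define v where "v h = u h * indicator {h. ennreal t < 2 * u h} h" for h
  have [measurable]: "v \<in> borel_measurable borel" unfolding v_def by measurable
  have "HLmax u x \<le> HLmax v x + ennreal (t / 2)" for x
    unfolding HLmax_def[of u]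
  proof (rule SUP_least)
    fix r :: real assume "r \<in> {0<..}"
    then have r: "r > 0" by simp
    have "havg u x r \<le> havg (\<lambda>h. v h + ennreal (t / 2)) x r"
    proof (rule havg_mono)
      fix h
      show "u h \<le> v h + ennreal (t / 2)"
      proof (cases "ennreal t < 2 * u h")
        case False
        then have "u h \<le> ennreal (t / 2)" using ennreal_half_less_iff[of t "u h"] t by (metis less_imp_le not_le)
        then show ?thesis by (simp add: add_increasing)
      qed (simp add: v_def)
    qed
    also have "\<dots> = havg v x r + ennreal (t / 2)" using r by (simp add: havg_add havg_const)
    also have "\<dots> \<le> HLmax v x + ennreal (t / 2)" using r by (intro add_right_mono havg_le_HLmax)
    finally show "havg u x r \<le> HLmax v x + ennreal (t / 2)" .
  qed
  moreover have "ennreal t = ennreal (t / 2) + ennreal (t / 2)" using t by (simp flip: ennreal_plus)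
  ultimately have "{x. ennreal t < HLmax u x} \<subseteq> {x. ennreal (t / 2) < HLmax v x}"
  proof (intro subsetI CollectI)
    fix x assume "x \<in> {x. ennreal t < HLmax u x}"
    then have "ennreal (t / 2) + ennreal (t / 2) < HLmax v x + ennreal (t / 2)"
      using \<open>HLmax u x \<le> HLmax v x + ennreal (t / 2)\<close> \<open>ennreal t = ennreal (t / 2) + ennreal (t / 2)\<close>
      by (metis mem_Collect_eq order_less_le_trans)
    then show "ennreal (t / 2) < HLmax v x"
      by (meson add_right_mono not_less)
  qed
  then have "emeasure lborel {x. ennreal t < HLmax u x} \<le> emeasure lborel {x. ennreal (t / 2) < HLmax v x}"
    by (intro emeasure_mono) auto
  also have "\<dots> \<le> ennreal (3 powr heis_dim TYPE('n) / (t / 2)) * (\<integral>\<^sup>+ h. v h \<partial>lborel)"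
    using t by (intro HLmax_weak) auto
  finally show ?thesis by (simp add: v_def mult.commute)
qed

text \<open>Layer cake for the maximal function, the truncated weak bound, then Fubini: for fixed x
  the integral of t^(p-2) over 0 < t < 2u is (2u)^(p-1)/(p-1). Without the truncation the integral
  in t would diverge.\<close>

lemma HLmax_strong:
  assumes p: "p > 1"
  shows "\<exists>C>0. \<forall>u\<in>borel_measurable borel.
    (\<integral>\<^sup>+ x. epowr (HLmax u (x::'n::finite heis)) p \<partial>lborel) \<le> ennreal C * (\<integral>\<^sup>+ x. epowr (u x) p \<partial>lborel)"
proof (intro exI conjI ballI)
  define D where "D = 2 * 3 powr heis_dim TYPE('n)"
  define C where "C = p * D * (2 powr (p - 1) * (1 / (p - 1)))"
  have D: "D > 0" by (simp add: D_def)
  show "C > 0" using p D by (simp add: C_def)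
  fix u :: "'n heis \<Rightarrow> ennreal" assume u [measurable]: "u \<in> borel_measurable borel"
  let ?G = "\<lambda>x t. ennreal (t powr (p - 1)) * indicator {t. 0 < t \<and> ennreal t < HLmax u x} t"
  let ?H = "\<lambda>x t. ennreal (t powr (p - 2)) * (u x * indicator {t. 0 < t \<and> ennreal t < 2 * u x} t)"
  have lc: "epowr y p = ennreal p * (\<integral>\<^sup>+ t. ennreal (t powr (p - 1)) * indicator {t. 0 < t \<and> ennreal t < y} t \<partial>lborel)" for y
    using nn_integral_powr_less_ennreal[of p y] p
    by (simp add: mult.left_commute[of "ennreal p"] flip: ennreal_mult)
  have m1: "(\<lambda>(x, t). ?G x t) \<in> borel_measurable (lborel \<Otimes>\<^sub>M lborel)"
  proof -
    have "(\<lambda>(x, t). ?G x t) =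
      (\<lambda>z. if 0 < snd z \<and> ennreal (snd z) < HLmax u (fst z) then ennreal (snd z powr (p - 1)) else 0)"
      by (auto simp: indicator_def fun_eq_iff)
    also have "\<dots> \<in> borel_measurable (lborel \<Otimes>\<^sub>M lborel)" by measurable
    finally show ?thesis .
  qed
  have m2: "(\<lambda>(x, t). ?H x t) \<in> borel_measurable (lborel \<Otimes>\<^sub>M lborel)"
  proof -
    have "(\<lambda>(x, t). ?H x t) =
      (\<lambda>z. if 0 < snd z \<and> ennreal (snd z) < 2 * u (fst z) then ennreal (snd z powr (p - 2)) * u (fst z) else 0)"
      by (auto simp: indicator_def fun_eq_iff)
    also have "\<dots> \<in> borel_measurable (lborel \<Otimes>\<^sub>M lborel)" by measurable
    finally show ?thesis .
  qed
  have "(\<integral>\<^sup>+ x. epowr (HLmax u x) p \<partial>lborel) =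
    (\<integral>\<^sup>+ x. ennreal p * (\<integral>\<^sup>+ t. ?G x t \<partial>lborel) \<partial>lborel)"
    by (simp only: lc)
  also have "\<dots> = ennreal p * (\<integral>\<^sup>+ x. (\<integral>\<^sup>+ t. ?G x t \<partial>lborel) \<partial>lborel)"
    using lborel.borel_measurable_nn_integral[OF m1] by (intro nn_integral_cmult) simp
  also have "\<dots> = ennreal p * (\<integral>\<^sup>+ t. (\<integral>\<^sup>+ x. ?G x t \<partial>lborel) \<partial>lborel)"
    by (subst lborel_pair.Fubini'[OF m1]) simp
  also have "\<dots> \<le> ennreal p * (\<integral>\<^sup>+ t. ennreal D * (\<integral>\<^sup>+ x. ?H x t \<partial>lborel) \<partial>lborel)"
  proof (intro mult_left_mono nn_integral_mono)
    fix t :: real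
    show "(\<integral>\<^sup>+ x. ?G x t \<partial>lborel) \<le>
      ennreal D * (\<integral>\<^sup>+ x. ?H x t \<partial>lborel)"
    proof (cases "t > 0")
      case True
      have "(\<integral>\<^sup>+ x. ?G x t \<partial>lborel) =
        (\<integral>\<^sup>+ x. ennreal (t powr (p - 1)) * indicator {x. ennreal t < HLmax u x} x \<partial>lborel)"
        using True by (intro nn_integral_cong) (auto simp: indicator_def)
      also have "\<dots> = ennreal (t powr (p - 1)) * emeasure lborel {x. ennreal t < HLmax u x}"
        by (simp add: nn_integral_cmult_indicator)
      also have "\<dots> \<le> ennreal (t powr (p - 1)) * (ennreal (D / t) * (\<integral>\<^sup>+ h\<in>{h. ennreal t < 2 * u h}. u h \<partial>lborel))"
        unfolding D_def using HLmax_weak_truncated[OF u True] by (intro mult_left_mono) auto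
      also have "\<dots> = ennreal (t powr (p - 1) * (D / t)) * (\<integral>\<^sup>+ h\<in>{h. ennreal t < 2 * u h}. u h \<partial>lborel)"
        using True D by (subst ennreal_mult) (auto simp: mult.assoc)
      also have "t powr (p - 1) * (D / t) = D * t powr (p - 2)"
        using True powr_diff[of t "p - 1" 1] by (simp add: field_simps)
      also have "ennreal (D * t powr (p - 2)) * (\<integral>\<^sup>+ h\<in>{h. ennreal t < 2 * u h}. u h \<partial>lborel) =
          ennreal D * (\<integral>\<^sup>+ x. ennreal (t powr (p - 2)) * (u x * indicator {h. ennreal t < 2 * u h} x) \<partial>lborel)"
        using D by (subst ennreal_mult) (auto simp: nn_integral_cmult mult.assoc)
      also have "\<dots> = ennreal D * (\<integral>\<^sup>+ x. ?H x t \<partial>lborel)"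
        using True by (intro arg_cong2[where f = "(*)"] nn_integral_cong) (auto simp: indicator_def)
      finally show ?thesis .
    qed simp
  qed simp
  also have "\<dots> = ennreal p * (ennreal D * (\<integral>\<^sup>+ t. (\<integral>\<^sup>+ x. ?H x t \<partial>lborel) \<partial>lborel))"
  proof -
    have "(\<lambda>t. \<integral>\<^sup>+ x. ?H x t \<partial>lborel) \<in> borel_measurable lborel"
      using measurable_pair_swap[OF m2] by (intro lborel.borel_measurable_nn_integral) simp
    then show ?thesis by (subst nn_integral_cmult) simp_all
  qed
  also have "\<dots> = ennreal p * (ennreal D * (\<integral>\<^sup>+ x. (\<integral>\<^sup>+ t. ?H x t \<partial>lborel) \<partial>lborel))"
    by (subst lborel_pair.Fubini'[OF m2]) simp
  also have "\<dots> = ennreal p * (ennreal D * (\<integral>\<^sup>+ x. ennreal (2 powr (p - 1) * (1 / (p - 1))) * epowr (u x) p \<partial>lborel))"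
  proof (intro arg_cong2[where f = "(*)"] nn_integral_cong refl)
    fix x
    have "(\<integral>\<^sup>+ t. ?H x t \<partial>lborel) =
      (\<integral>\<^sup>+ t. u x * (ennreal (t powr (p - 1 - 1)) * indicator {t. 0 < t \<and> ennreal t < 2 * u x} t) \<partial>lborel)"
      by (simp add: algebra_simps)
    also have "\<dots> = u x * (epowr (2 * u x) (p - 1) * ennreal (1 / (p - 1)))"
      using nn_integral_powr_less_ennreal[of "p - 1" "2 * u x"] p by (subst nn_integral_cmult) auto
    also have "\<dots> = epowr 2 (p - 1) * ennreal (1 / (p - 1)) * (epowr (u x) (p - 1) * u x)"
      by (simp add: epowr_mult mult_ac)
    also have "epowr (u x) (p - 1) * u x = epowr (u x) p"
      using epowr_add[of "u x" "p - 1" 1] by simp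
    also have "epowr 2 (p - 1) * ennreal (1 / (p - 1)) = ennreal (2 powr (p - 1) * (1 / (p - 1)))"
      using p epowr_ennreal[of 2 "p - 1"] by (subst ennreal_mult) auto
    finally show "(\<integral>\<^sup>+ t. ?H x t \<partial>lborel) =
      ennreal (2 powr (p - 1) * (1 / (p - 1))) * epowr (u x) p" .
  qed
  also have "\<dots> = ennreal C * (\<integral>\<^sup>+ x. epowr (u x) p \<partial>lborel)"
  proof -
    have "ennreal p * (ennreal D * ennreal (2 powr (p - 1) * (1 / (p - 1)))) = ennreal C"
      unfolding C_def using p D by (simp add: mult.assoc flip: ennreal_mult)
    then show ?thesis by (simp add: nn_integral_cmult flip: mult.assoc)
  qed
  finally show "(\<integral>\<^sup>+ x. epowr (HLmax u x) p \<partial>lborel) \<le> ennreal C * (\<integral>\<^sup>+ x. epowr (u x) p \<partial>lborel)" .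
qed

subsection \<open>Differentiation of integrals\<close>

lemma borel_measurable_havg:
  fixes k :: "'n::finite heis \<Rightarrow> 'n heis \<Rightarrow> ennreal"
  assumes k [measurable]: "(\<lambda>z. k (fst z) (snd z)) \<in> borel_measurable (borel \<Otimes>\<^sub>M borel)"
  shows "(\<lambda>x. havg (k x) x r) \<in> borel_measurable borel"
  unfolding havg_def using borel_measurable_nn_integral_heis_ball[OF k, of r] by measurable

lemma borel_measurable_havg_const [measurable]:
  assumes [measurable]: "u \<in> borel_measurable borel"
  shows "(\<lambda>x. havg u x r) \<in> borel_measurable borel"
  by (rule borel_measurable_havg) measurable

text \<open>Averaging over balls of a fixed radius is self-adjoint, because the relation h in B(x,
  r) is symmetric and all balls of radius r have the same volume.\<close>

lemma nn_integral_mult_havg_swap: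
  fixes u v :: "'n::finite heis \<Rightarrow> ennreal"
  assumes [measurable]: "u \<in> borel_measurable borel" "v \<in> borel_measurable borel"
  shows "(\<integral>\<^sup>+ x. v x * havg u x r \<partial>lborel) = (\<integral>\<^sup>+ x. u x * havg v x r \<partial>lborel)"
proof -
  let ?c = "ennreal (1 / hvol TYPE('n) r)"
  have m: "(\<lambda>(x, h). (?c * v x) * (u h * indicator (heis_ball x r) h)) \<in> borel_measurable (lborel \<Otimes>\<^sub>M lborel)"
    unfolding case_prod_beta by measurable
  have "(\<integral>\<^sup>+ x. v x * havg u x r \<partial>lborel) = (\<integral>\<^sup>+ x. \<integral>\<^sup>+ h. (?c * v x) * (u h * indicator (heis_ball x r) h) \<partial>lborel \<partial>lborel)"
    unfolding havg_def by (intro nn_integral_cong, subst nn_integral_cmult) (auto simp: mult_ac)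
  also have "\<dots> = (\<integral>\<^sup>+ h. \<integral>\<^sup>+ x. (?c * v x) * (u h * indicator (heis_ball x r) h) \<partial>lborel \<partial>lborel)"
    by (rule lborel_pair.Fubini'[OF m, symmetric])
  also have "\<dots> = (\<integral>\<^sup>+ h. \<integral>\<^sup>+ x. (?c * u h) * (v x * indicator (heis_ball h r) x) \<partial>lborel \<partial>lborel)"
    by (intro nn_integral_cong) (simp add: indicator_def mem_heis_ball heis_dist_commute mult_ac)
  also have "\<dots> = (\<integral>\<^sup>+ h. u h * havg v h r \<partial>lborel)"
    unfolding havg_def by (intro nn_integral_cong, subst nn_integral_cmult) (auto simp: mult_ac)
  finally show ?thesis .
qed

lemma nn_integral_havg:
  fixes u :: "'n::finite heis \<Rightarrow> ennreal"
  assumes "u \<in> borel_measurable borel" "r > 0"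
  shows "(\<integral>\<^sup>+ x. havg u x r \<partial>lborel) = (\<integral>\<^sup>+ x. u x \<partial>lborel)"
  using nn_integral_mult_havg_swap[OF assms(1), of "\<lambda>_. 1" r] assms(2) by (simp add: havg_const)

text \<open>Differentiation of integrals is proved only in this mean sense, not by pointwise
  convergence of the averages. The quantity is subadditive and at most twice the L_1 norm, so
  density arguments work without a maximal function.\<close>

definition L1_osc :: "('n::finite heis \<Rightarrow> real) \<Rightarrow> real \<Rightarrow> ennreal" where
  "L1_osc f r = (\<integral>\<^sup>+ x. havg (\<lambda>h. ennreal \<bar>f h - f x\<bar>) x r \<partial>lborel)"

lemma borel_measurable_havg_diff [measurable]:
  fixes f :: "'n::finite heis \<Rightarrow> real"
  assumes [measurable]: "f \<in> borel_measurable borel"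
  shows "(\<lambda>x. havg (\<lambda>h. ennreal \<bar>f h - f x\<bar>) x r) \<in> borel_measurable borel"
  by (rule borel_measurable_havg) measurable

lemma havg_cmult: "u \<in> borel_measurable borel \<Longrightarrow> havg (\<lambda>h. c * u h) x r = c * havg u x r"
  unfolding havg_def by (simp add: mult.assoc nn_integral_cmult mult.left_commute)

lemma L1_osc_add:
  fixes f g :: "'n::finite heis \<Rightarrow> real"
  assumes [measurable]: "f \<in> borel_measurable borel" "g \<in> borel_measurable borel"
  shows "L1_osc (\<lambda>x. f x + g x) r \<le> L1_osc f r + L1_osc g r"
proof -
  have "L1_osc (\<lambda>x. f x + g x) r \<le> (\<integral>\<^sup>+ x. havg (\<lambda>h. ennreal \<bar>f h - f x\<bar> + ennreal \<bar>g h - g x\<bar>) x r \<partial>lborel)"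
    unfolding L1_osc_def
    by (intro nn_integral_mono havg_mono) (auto simp flip: ennreal_plus intro!: ennreal_leI)
  also have "\<dots> = L1_osc f r + L1_osc g r"
    unfolding L1_osc_def by (subst nn_integral_add[symmetric]) (auto simp: havg_add)
  finally show ?thesis .
qed

lemma L1_osc_le:
  fixes f :: "'n::finite heis \<Rightarrow> real"
  assumes [measurable]: "f \<in> borel_measurable borel" and r: "r > 0"
  shows "L1_osc f r \<le> 2 * (\<integral>\<^sup>+ x. ennreal \<bar>f x\<bar> \<partial>lborel)"
proof -
  have "L1_osc f r \<le> (\<integral>\<^sup>+ x. havg (\<lambda>h. ennreal \<bar>f h\<bar> + ennreal \<bar>f x\<bar>) x r \<partial>lborel)"
    unfolding L1_osc_def
    by (intro nn_integral_mono havg_mono) (auto simp flip: ennreal_plus intro!: ennreal_leI)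
  also have "\<dots> = (\<integral>\<^sup>+ x. havg (\<lambda>h. ennreal \<bar>f h\<bar>) x r + ennreal \<bar>f x\<bar> \<partial>lborel)"
    using r by (simp add: havg_add havg_const)
  also have "\<dots> = 2 * (\<integral>\<^sup>+ x. ennreal \<bar>f x\<bar> \<partial>lborel)"
    using r by (simp add: nn_integral_add nn_integral_havg flip: mult_2)
  finally show ?thesis .
qed

lemma L1_osc_scale: "L1_osc (\<lambda>x. f x * c) r = ennreal \<bar>c\<bar> * L1_osc f r"
  if [measurable]: "f \<in> borel_measurable borel" for f :: "'n::finite heis \<Rightarrow> real"
proof -
  have "ennreal \<bar>f h * c - f x * c\<bar> = ennreal \<bar>c\<bar> * ennreal \<bar>f h - f x\<bar>" for h x
  proof -
    have "f h * c - f x * c = c * (f h - f x)" by (simp add: algebra_simps)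
    then show ?thesis by (simp add: abs_mult ennreal_mult)
  qed
  then show ?thesis
    unfolding L1_osc_def by (simp add: havg_cmult nn_integral_cmult)
qed

text \<open>Self-adjointness makes the oscillation seen from outside \<open>U\<close> equal to the
  one seen from inside. Inside, small balls around a point stay in the open set, and the indicator
  of \<open>U\<close> dominates.\<close>

lemma L1_osc_open:
  fixes U :: "'n::finite heis set"
  assumes U: "open U" "emeasure lborel U < \<infinity>" and e: "\<And>n. e n > 0" "e \<longlonglongrightarrow> 0"
  shows "(\<lambda>n. L1_osc (indicator U) (e n)) \<longlonglongrightarrow> 0"
proof -
  have [measurable]: "U \<in> sets borel" using U by simp
  have "L1_osc (indicator U) r = 2 * (\<integral>\<^sup>+ x. indicator U x * havg (indicator (- U)) x r \<partial>lborel)" for r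
  proof -
    have "havg (\<lambda>h. ennreal \<bar>indicator U h - indicator U x\<bar>) x r =
        indicator U x * havg (indicator (- U)) x r + indicator (- U) x * havg (indicator U) x r" for x
    proof (cases "x \<in> U")
      case True
      then have "(\<lambda>h. ennreal \<bar>indicator U h - indicator U x\<bar>) = indicator (- U)"
        by (intro ext) (simp add: indicator_def)
      then show ?thesis using True by simp
    next
      case False
      then have "(\<lambda>h. ennreal \<bar>indicator U h - indicator U x\<bar>) = indicator U"
        by (intro ext) (simp add: indicator_def)
      then show ?thesis using False by simp
    qed
    then have "L1_osc (indicator U) r = (\<integral>\<^sup>+ x. indicator U x * havg (indicator (- U)) x r \<partial>lborel)
        + (\<integral>\<^sup>+ x. indicator (- U) x * havg (indicator U) x r \<partial>lborel)"
      by (simp add: L1_osc_def nn_integral_add)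
    also have "(\<integral>\<^sup>+ x. indicator (- U) x * havg (indicator U) x r \<partial>lborel) = (\<integral>\<^sup>+ x. indicator U x * havg (indicator (- U)) x r \<partial>lborel)"
      by (rule nn_integral_mult_havg_swap) measurable
    finally show ?thesis by (simp flip: mult_2)
  qed
  moreover have "(\<lambda>n. \<integral>\<^sup>+ x. indicator U x * havg (indicator (- U)) x (e n) \<partial>lborel) \<longlonglongrightarrow> integral\<^sup>N (lborel :: 'n heis measure) (\<lambda>x. 0)"
  proof (rule nn_integral_dominated_convergence[where w = "indicator U"])
    show "(\<lambda>x. indicator U x * havg (indicator (- U)) x (e n)) \<in> borel_measurable lborel" for n
      by measurable
    show "AE x in lborel. indicator U x * havg (indicator (- U)) x (e n) \<le> indicator U x" for n
    proof (rule AE_I2)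
      fix x
      have "havg (indicator (- U)) x (e n) \<le> havg (\<lambda>_. 1) x (e n)" by (rule havg_mono) (simp add: indicator_def)
      then show "indicator U x * havg (indicator (- U)) x (e n) \<le> indicator U x"
        using e by (simp add: havg_const indicator_def)
    qed
    show "AE x in lborel. (\<lambda>n. indicator U x * havg (indicator (- U)) x (e n)) \<longlonglongrightarrow> 0"
    proof (rule AE_I2)
      fix x
      show "(\<lambda>n. indicator U x * havg (indicator (- U)) x (e n)) \<longlonglongrightarrow> 0"
      proof (cases "x \<in> U")
        case True
        obtain r where r: "r > 0" "heis_ball x r \<subseteq> U" using open_contains_heis_ball[OF U(1) True] .
        have "eventually (\<lambda>n. e n < r) sequentially" using e r by (intro order_tendstoD) auto
        then have "eventually (\<lambda>n. indicator U x * havg (indicator (- U)) x (e n) = 0) sequentially"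
        proof eventually_elim
          case (elim n)
          then have "heis_ball x (e n) \<subseteq> U" using r heis_ball_mono[of "e n" r x] by auto
          then have "(\<integral>\<^sup>+ h\<in>heis_ball x (e n). indicator (- U) h \<partial>lborel) = integral\<^sup>N lborel (\<lambda>h::'n heis. 0)"
            by (intro nn_integral_cong) (auto simp: indicator_def)
          then show ?case by (simp add: havg_def)
        qed
        then show ?thesis by (rule tendsto_eventually)
      qed simp
    qed
  qed (use U in auto)
  ultimately show ?thesis using ennreal_tendsto_cmult[of 2 _ 0 sequentially] by simp
qed

text \<open>Vanishing oscillation passes to L_1 limits, since it changes by at most twice the L_1
  error.\<close>

lemma L1_osc_approx:
  fixes f :: "'n::finite heis \<Rightarrow> real"
  assumes [measurable]: "f \<in> borel_measurable borel" and e: "\<And>n. e n > 0"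
    and g: "\<And>\<eta>. \<eta> > 0 \<Longrightarrow> \<exists>g\<in>borel_measurable borel. (\<lambda>n. L1_osc g (e n)) \<longlonglongrightarrow> 0 \<and>
      (\<integral>\<^sup>+ x. ennreal \<bar>f x - g x\<bar> \<partial>lborel) < ennreal \<eta>"
  shows "(\<lambda>n. L1_osc f (e n)) \<longlonglongrightarrow> 0"
proof (rule order_tendstoI)
  fix a :: ennreal assume "0 < a"
  \<comment> \<open>Room for \<eta> from the approximating function and 2 \<eta> from the L_1
    error.\<close>
  then obtain \<eta> where \<eta>: "\<eta> > 0" "ennreal (3 * \<eta>) < a"
  proof (cases a)
    case (real r)
    then show ?thesis using \<open>0 < a\<close> by (intro that[of "r / 4"]) (auto simp: ennreal_less_iff)
  next
    case top
    then show ?thesis by (intro that[of 1]) auto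
  qed
  obtain g where [measurable]: "g \<in> borel_measurable borel" and g: "(\<lambda>n. L1_osc g (e n)) \<longlonglongrightarrow> 0"
    "(\<integral>\<^sup>+ x. ennreal \<bar>f x - g x\<bar> \<partial>lborel) < ennreal \<eta>" using g[OF \<eta>(1)] by blast
  have "eventually (\<lambda>n. L1_osc g (e n) < ennreal \<eta>) sequentially"
    using g(1) \<eta> by (intro order_tendstoD(2)) auto
  then show "eventually (\<lambda>n. L1_osc f (e n) < a) sequentially"
  proof eventually_elim
    case (elim n)
    have "L1_osc f (e n) = L1_osc (\<lambda>x. g x + (f x - g x)) (e n)" by simp
    also have "\<dots> \<le> L1_osc g (e n) + L1_osc (\<lambda>x. f x - g x) (e n)" by (intro L1_osc_add) measurable
    also have "\<dots> \<le> L1_osc g (e n) + 2 * (\<integral>\<^sup>+ x. ennreal \<bar>f x - g x\<bar> \<partial>lborel)"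
      using e by (intro add_left_mono L1_osc_le) auto
    also have "\<dots> \<le> ennreal \<eta> + 2 * ennreal \<eta>"
      using elim g(2) by (intro add_mono mult_left_mono) auto
    also have "\<dots> = ennreal (3 * \<eta>)"
    proof -
      have "2 * ennreal \<eta> = ennreal (2 * \<eta>)" using \<eta> by (simp add: ennreal_mult)
      then show ?thesis using \<eta> by (simp flip: ennreal_plus)
    qed
    finally show ?case using \<eta>(2) by simp
  qed
qed simp

text \<open>Integrable functions are reached from indicators by sums and dominated limits, and an
  indicator is reached from open sets by outer regularity.\<close>

lemma L1_osc_tendsto_0:
  fixes f :: "'n::finite heis \<Rightarrow> real"
  assumes f: "integrable lborel f" and e: "\<And>n. e n > 0" "e \<longlonglongrightarrow> 0"
  shows "(\<lambda>n. L1_osc f (e n)) \<longlonglongrightarrow> 0"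
  using f
proof (induction rule: integrable_induct)
  case (base A c)
  then have [measurable]: "A \<in> sets borel" by simp
  have "(\<lambda>n. L1_osc (indicator A) (e n)) \<longlonglongrightarrow> 0"
  proof (rule L1_osc_approx)
    fix \<eta> :: real assume "\<eta> > 0"
    then obtain U where U: "open U" "A \<subseteq> U" "emeasure lborel (U - A) < ennreal \<eta>"
      using outer_regular_lborel[of A \<eta>] by auto
    have [measurable]: "U \<in> sets borel" using U by simp
    have "emeasure lborel U = emeasure lborel A + emeasure lborel (U - A)"
      using U by (subst plus_emeasure) (auto intro!: arg_cong[where f = "emeasure lborel"])
    also have "\<dots> < \<infinity>" using base U(3) by (auto simp: less_top intro: order.strict_trans)
    finally have Uf: "emeasure lborel U < \<infinity>" .
    have "(\<integral>\<^sup>+ x. ennreal \<bar>indicator A x - indicator U x\<bar> \<partial>lborel) = (\<integral>\<^sup>+ x. indicator (U - A) x \<partial>lborel)"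
      using U(2) by (intro nn_integral_cong) (auto simp: indicator_def)
    also have "\<dots> < ennreal \<eta>" using U(3) by simp
    finally show "\<exists>g\<in>borel_measurable borel. (\<lambda>n. L1_osc g (e n)) \<longlonglongrightarrow> 0 \<and>
      (\<integral>\<^sup>+ x. ennreal \<bar>indicator A x - g x\<bar> \<partial>lborel) < ennreal \<eta>"
      using L1_osc_open[OF U(1) Uf e] by (intro bexI[of _ "indicator U"]) auto
  qed (use e in auto)
  then have "(\<lambda>n. ennreal \<bar>c\<bar> * L1_osc (indicator A) (e n)) \<longlonglongrightarrow> ennreal \<bar>c\<bar> * 0"
    by (intro ennreal_tendsto_cmult) auto
  then show ?case by (simp add: L1_osc_scale)
next
  case (add f g)
  then have "(\<lambda>n. L1_osc f (e n) + L1_osc g (e n)) \<longlonglongrightarrow> 0 + 0" by (intro tendsto_intros)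
  moreover have "L1_osc (\<lambda>x. f x + g x) (e n) \<le> L1_osc f (e n) + L1_osc g (e n)" for n
    using add by (intro L1_osc_add) auto
  ultimately show ?case
    by - (rule tendsto_sandwich[of "\<lambda>_. 0" _ _ "\<lambda>n. L1_osc f (e n) + L1_osc g (e n)"], auto)
next
  case (lim f s)
  have fm [measurable]: "f \<in> borel_measurable borel" and sm [measurable]: "\<And>i. s i \<in> borel_measurable borel"
    using lim by auto
  show ?case
  proof (rule L1_osc_approx)
    fix \<eta> :: real assume \<eta>: "\<eta> > 0"
    have "(\<lambda>i. \<integral>\<^sup>+ x. norm (f x - s i x) \<partial>lborel) \<longlonglongrightarrow> 0"
    proof (rule nn_integral_dominated_convergence_norm[where w = "\<lambda>x. 2 * norm (f x)"])
      have "integrable lborel (\<lambda>x. 2 * norm (f x))" using lim by auto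
      then show "(\<integral>\<^sup>+ x. ennreal (2 * norm (f x)) \<partial>lborel) < \<infinity>"
        unfolding integrable_iff_bounded by (simp add: abs_mult)
    qed (use lim in auto)
    then have "eventually (\<lambda>i. (\<integral>\<^sup>+ x. norm (f x - s i x) \<partial>lborel) < ennreal \<eta>) sequentially"
      using \<eta> by (intro order_tendstoD(2)) auto
    then obtain i where "(\<integral>\<^sup>+ x. ennreal (norm (f x - s i x)) \<partial>lborel) < ennreal \<eta>"
      using eventually_happens'[OF sequentially_bot] by blast
    then show "\<exists>g\<in>borel_measurable borel. (\<lambda>n. L1_osc g (e n)) \<longlonglongrightarrow> 0 \<and>
      (\<integral>\<^sup>+ x. ennreal \<bar>f x - g x\<bar> \<partial>lborel) < ennreal \<eta>"
      using lim by (intro bexI[of _ "s i"]) auto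
  qed (use e in auto)
qed

text \<open>Fatou's lemma turns convergence in mean into a vanishing lower limit at almost every
  point. One good radius per point is all that the stopping argument for BMO asks for.\<close>

lemma AE_liminf_havg_diff:
  fixes f :: "'n::finite heis \<Rightarrow> real"
  assumes f: "integrable lborel f" and e: "\<And>n. e n > 0" "e \<longlonglongrightarrow> 0"
  shows "AE x in lborel. \<forall>\<delta>>0. \<exists>n. havg (\<lambda>h. ennreal \<bar>f h - f x\<bar>) x (e n) < ennreal \<delta>"
proof -
  have [measurable]: "f \<in> borel_measurable borel" using f by auto
  let ?w = "\<lambda>n x. havg (\<lambda>h. ennreal \<bar>f h - f x\<bar>) x (e n)"
  have "(\<integral>\<^sup>+ x. liminf (\<lambda>n. ?w n x) \<partial>lborel) \<le> liminf (\<lambda>n. L1_osc f (e n))"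
    unfolding L1_osc_def by (intro nn_integral_liminf) measurable
  also have "\<dots> = 0" using L1_osc_tendsto_0[OF f e] by (intro lim_imp_Liminf) auto
  finally have "AE x in lborel. liminf (\<lambda>n. ?w n x) = 0"
    by (subst (asm) le_zero_eq, subst (asm) nn_integral_0_iff_AE) auto
  then show ?thesis
  proof eventually_elim
    case (elim x)
    show ?case
    proof (rule allI, rule impI, rule ccontr)
      fix \<delta> :: real assume \<delta>: "\<delta> > 0" and "\<nexists>n. ?w n x < ennreal \<delta>"
      then have "ennreal \<delta> \<le> liminf (\<lambda>n. ?w n x)"
        by (intro Liminf_bounded) (auto simp: not_less)
      then show False using \<delta> elim by simp
    qed
  qed
qed

subsection \<open>The John-Nirenberg inequality\<close>

definition ravg :: "('n::finite heis \<Rightarrow> real) \<Rightarrow> 'n heis \<Rightarrow> real \<Rightarrow> real" where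
  "ravg b g r = (LINT h:heis_ball g r|lborel. b h) / hvol TYPE('n) r"

text \<open>BMO as it is used below: a Borel function and nonnegative integrals over
  \<open>lborel\<close>. The bound is strictly positive, so that the constants formed from it are
  positive even when \<open>b\<close> is constant.\<close>

definition bmo_bound :: "('n::finite heis \<Rightarrow> real) \<Rightarrow> real \<Rightarrow> bool" where
  "bmo_bound b N \<longleftrightarrow> b \<in> borel_measurable borel \<and> N > 0 \<and>
    (\<forall>g r. set_integrable lborel (heis_ball g r) b) \<and>
    (\<forall>g. \<forall>r>0. havg (\<lambda>h. ennreal \<bar>b h - ravg b g r\<bar>) g r \<le> ennreal N)"

lemma bmo_boundD:
  assumes "bmo_bound b N"
  shows "b \<in> borel_measurable borel" "N > 0" "set_integrable lborel (heis_ball g r) b"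
    "r > 0 \<Longrightarrow> havg (\<lambda>h. ennreal \<bar>b h - ravg b g r\<bar>) g r \<le> ennreal N"
  using assms unfolding bmo_bound_def by blast+

lemma set_integrable_const_heis_ball: "set_integrable lborel (heis_ball g r) (\<lambda>_. c::real)"
  using emeasure_heis_ball_finite[of g r] by (simp add: set_integrable_def)

lemma abs_ravg_diff_le:
  fixes b :: "'n::finite heis \<Rightarrow> real"
  assumes b: "set_integrable lborel (heis_ball g r) b" and r: "r > 0"
  shows "ennreal \<bar>ravg b g r - c\<bar> \<le> havg (\<lambda>h. ennreal \<bar>b h - c\<bar>) g r"
proof -
  let ?B = "heis_ball g r" and ?V = "hvol TYPE('n) r"
  have V: "?V > 0" using r by simp
  have "measure lborel ?B = ?V" using r V by (simp add: measure_def emeasure_heis_ball_hvol)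
  then have c: "(LINT h:?B|lborel. c) = c * ?V"
    using emeasure_heis_ball_finite[of g r] by (simp add: set_lebesgue_integral_def)
  have int: "set_integrable lborel ?B (\<lambda>h. b h - c)"
    using b set_integrable_const_heis_ball by (rule set_integral_diff)
  have "ravg b g r - c = (LINT h:?B|lborel. b h - c) / ?V"
    using V by (simp add: set_integral_diff(2)[OF b set_integrable_const_heis_ball] c ravg_def field_simps)
  then have "\<bar>ravg b g r - c\<bar> = 1 / ?V * \<bar>LINT h:?B|lborel. b h - c\<bar>" using V by simp
  also have "\<dots> \<le> 1 / ?V * (LINT h:?B|lborel. \<bar>b h - c\<bar>)"
    using V set_integral_norm_bound[OF int] by (intro mult_left_mono) auto
  finally have "ennreal \<bar>ravg b g r - c\<bar> \<le> ennreal (1 / ?V * (LINT h:?B|lborel. \<bar>b h - c\<bar>))"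
    by (rule ennreal_leI)
  also have "\<dots> = ennreal (1 / ?V) * ennreal (LINT h:?B|lborel. \<bar>b h - c\<bar>)"
    using V by (intro ennreal_mult) (auto simp: set_lebesgue_integral_def)
  also have "ennreal (LINT h:?B|lborel. \<bar>b h - c\<bar>) = (\<integral>\<^sup>+ h\<in>?B. ennreal \<bar>b h - c\<bar> \<partial>lborel)"
  proof -
    have "integrable lborel (\<lambda>h. indicator ?B h * \<bar>b h - c\<bar>)"
      using set_integrable_abs[OF int] by (simp add: set_integrable_def)
    then have "(\<integral>\<^sup>+ h. ennreal (indicator ?B h * \<bar>b h - c\<bar>) \<partial>lborel) = ennreal (LINT h:?B|lborel. \<bar>b h - c\<bar>)"
      by (simp add: nn_integral_eq_integral set_lebesgue_integral_def)
    moreover have "ennreal (indicator ?B h * \<bar>b h - c\<bar>) = ennreal \<bar>b h - c\<bar> * indicator ?B h" for h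
      by (simp add: indicator_def)
    ultimately show ?thesis by simp
  qed
  finally show ?thesis unfolding havg_def .
qed

lemma havg_subset_le:
  fixes u :: "'n::finite heis \<Rightarrow> ennreal"
  assumes "heis_ball g' r' \<subseteq> heis_ball g r" "r' > 0" "r > 0"
  shows "havg u g' r' \<le> ennreal (hvol TYPE('n) r / hvol TYPE('n) r') * havg u g r"
proof -
  have "havg u g' r' \<le> ennreal (1 / hvol TYPE('n) r') * (\<integral>\<^sup>+ h\<in>heis_ball g r. u h \<partial>lborel)"
    unfolding havg_def using assms(1) by (intro mult_left_mono nn_set_integral_set_mono) auto
  also have "\<dots> = ennreal (hvol TYPE('n) r / hvol TYPE('n) r') * havg u g r"
    using assms hvol_pos[where 'n='n, of r] hvol_pos[where 'n='n, of r']
    by (simp add: nn_integral_heis_ball_eq_havg less_imp_le flip: mult.assoc ennreal_mult)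
  finally show ?thesis .
qed

text \<open>The mean deviation over the smaller ball exceeds the one over the larger ball by at most
  the ratio of the volumes.\<close>

lemma abs_ravg_diff_subset:
  fixes b :: "'n::finite heis \<Rightarrow> real"
  assumes b: "bmo_bound b N" and sub: "heis_ball g' r' \<subseteq> heis_ball g r" and r: "r' > 0" "r > 0"
  shows "\<bar>ravg b g' r' - ravg b g r\<bar> \<le> hvol TYPE('n) r / hvol TYPE('n) r' * N"
proof -
  have N: "N > 0" by (rule bmo_boundD[OF b])
  have "ennreal \<bar>ravg b g' r' - ravg b g r\<bar> \<le> havg (\<lambda>h. ennreal \<bar>b h - ravg b g r\<bar>) g' r'"
    using r by (intro abs_ravg_diff_le bmo_boundD(3)[OF b])
  also have "\<dots> \<le> ennreal (hvol TYPE('n) r / hvol TYPE('n) r') * havg (\<lambda>h. ennreal \<bar>b h - ravg b g r\<bar>) g r"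
    by (rule havg_subset_le[OF sub r])
  also have "\<dots> \<le> ennreal (hvol TYPE('n) r / hvol TYPE('n) r') * ennreal N"
    using r by (intro mult_left_mono bmo_boundD(4)[OF b]) auto
  also have "\<dots> = ennreal (hvol TYPE('n) r / hvol TYPE('n) r' * N)"
    using r N by (intro ennreal_mult[symmetric]) (auto simp: less_imp_le)
  finally show ?thesis using r N by (subst (asm) ennreal_le_iff) (auto simp: less_imp_le)
qed

lemma abs_ravg_diff_subset_mult:
  fixes b :: "'n::finite heis \<Rightarrow> real"
  assumes b: "bmo_bound b N" and sub: "heis_ball g' r' \<subseteq> heis_ball g r" and r: "r' > 0" "r = m * r'" "m > 0"
  shows "\<bar>ravg b g' r' - ravg b g r\<bar> \<le> m powr heis_dim TYPE('n) * N"
  using abs_ravg_diff_subset[OF b sub r(1)] r hvol_pos[OF r(1), where 'n='n] by (simp add: hvol_mult)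

text \<open>By \<open>AE_liminf_havg_diff\<close> some dyadic average around x differs from b(x) by
  less than |b(x) - c| - K. Cutting \<open>b\<close> off outside B(g, 2R) makes it integrable and
  leaves the averages over radii up to R about points of B(g, R) unchanged.\<close>

lemma AE_ravg_gt:
  fixes b :: "'n::finite heis \<Rightarrow> real"
  assumes b: "bmo_bound b N" and R: "R > 0"
  shows "AE x in lborel. x \<in> heis_ball g R \<longrightarrow> K < \<bar>b x - c\<bar> \<longrightarrow> (\<exists>k. K < \<bar>ravg b x (R / 2 ^ k) - c\<bar>)"
proof -
  let ?f = "\<lambda>x. indicator (heis_ball g (2 * R)) x * b x"
  have "integrable lborel ?f"
    using bmo_boundD(3)[OF b, of g "2 * R"] by (simp add: set_integrable_def)
  then have "AE x in lborel. \<forall>\<delta>>0. \<exists>k. havg (\<lambda>h. ennreal \<bar>?f h - ?f x\<bar>) x (R / 2 ^ k) < ennreal \<delta>"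
    using R by (intro AE_liminf_havg_diff) (auto intro!: LIMSEQ_divide_realpow_zero)
  then show ?thesis
  proof eventually_elim
    case (elim x)
    show ?case
    proof (intro impI)
      assume x: "x \<in> heis_ball g R" and K: "K < \<bar>b x - c\<bar>"
      obtain k where k: "havg (\<lambda>h. ennreal \<bar>?f h - ?f x\<bar>) x (R / 2 ^ k) < ennreal (\<bar>b x - c\<bar> - K)"
        using elim[rule_format, of "\<bar>b x - c\<bar> - K"] K by (auto simp del: ennreal_less_iff)
      have r: "R / 2 ^ k > 0" "R / 2 ^ k \<le> R" using R by (auto simp: field_simps)
      have sub: "heis_ball x (R / 2 ^ k) \<subseteq> heis_ball g (2 * R)"
        using x r by (intro heis_ball_subset) (simp add: mem_heis_ball)
      have x2: "x \<in> heis_ball g (2 * R)" using x R by (simp add: mem_heis_ball)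
      have "havg (\<lambda>h. ennreal \<bar>?f h - ?f x\<bar>) x (R / 2 ^ k) = havg (\<lambda>h. ennreal \<bar>b h - b x\<bar>) x (R / 2 ^ k)"
        unfolding havg_def
      proof (rule arg_cong2[where f = "(*)", OF refl nn_integral_cong])
        fix h
        show "ennreal \<bar>?f h - ?f x\<bar> * indicator (heis_ball x (R / 2 ^ k)) h = ennreal \<bar>b h - b x\<bar> * indicator (heis_ball x (R / 2 ^ k)) h"
          using subsetD[OF sub, of h] x2 by (cases "h \<in> heis_ball x (R / 2 ^ k)") simp_all
      qed
      moreover have "ennreal \<bar>ravg b x (R / 2 ^ k) - b x\<bar> \<le> havg (\<lambda>h. ennreal \<bar>b h - b x\<bar>) x (R / 2 ^ k)"
        using r by (intro abs_ravg_diff_le bmo_boundD(3)[OF b])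
      ultimately have "ennreal \<bar>ravg b x (R / 2 ^ k) - b x\<bar> < ennreal (\<bar>b x - c\<bar> - K)"
        using le_less_trans[OF _ k] by simp
      then have "\<bar>ravg b x (R / 2 ^ k) - b x\<bar> < \<bar>b x - c\<bar> - K"
        by (simp add: ennreal_less_iff)
      then show "\<exists>k. K < \<bar>ravg b x (R / 2 ^ k) - c\<bar>" by (intro exI[of _ k]) linarith
    qed
  qed
qed

text \<open>
  Induction on \<open>m\<close> by stopping at the first dyadic scale on which the average of \<open>b\<close> moves away from
  its average over the initial ball: the stopped balls fill a small portion of it, and there the
  average has not moved by more than \<open>L\<close>.
\<close>

lemma john_nirenberg:
  fixes b :: "'n::finite heis \<Rightarrow> real"
  assumes b: "bmo_bound b N"
  shows "\<exists>L>0. \<forall>m::nat. \<forall>g. \<forall>R>0.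
    emeasure lborel {x\<in>heis_ball g R. real m * L \<le> \<bar>b x - ravg b g R\<bar>} \<le> ennreal ((1 / 2) ^ m * hvol TYPE('n) R)"
proof -
  define Q where "Q = heis_dim TYPE('n)"
  have Q: "Q > 0" unfolding Q_def by (rule heis_dim_pos)
  have bm [measurable]: "b \<in> borel_measurable borel" and N: "N > 0" using bmo_boundD[OF b] by auto
  \<comment> \<open>\<open>A\<close> bounds the integral of |b - c| over B(g, 2R) divided by the
    volume of B(g, R). The choice of \<open>K\<close> lets the tripled stopped balls fill at most
    half of that volume. \<open>L\<close> adds to \<open>K\<close> a bound for the drift of the
    average from the radius \<open>2 * r x\<close>, the last one before the stop, to
    \<open>3 * r x\<close>.\<close>
  define A where "A = (2 powr Q + 4 powr Q) * N"
  define K where "K = 2 * 3 powr Q * A"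
  define L where "L = K + 3 powr Q * N"
  have A: "A > 0" using N by (simp add: A_def add_pos_pos)
  have K: "K > 0" using A by (simp add: K_def)
  have L: "L > 0" "K < L" using K N by (simp_all add: L_def add_pos_pos)
  have three: "3 powr Q \<ge> 1" using Q by (simp add: ge_one_powr_ge_zero)
  \<comment> \<open>This keeps the initial scale from stopping: the averages over B(x, R) and B(g,
    R) both differ by at most 2^Q N from the one over B(g, 2R).\<close>
  have K2: "2 * (2 powr Q * N) \<le> K"
  proof -
    have "2 powr Q * N \<le> A" using N by (simp add: A_def)
    also have "A \<le> 3 powr Q * A" using three A by simp
    finally show ?thesis by (simp add: K_def)
  qed
  have "emeasure lborel {x\<in>heis_ball g R. real m * L \<le> \<bar>b x - ravg b g R\<bar>} \<le> ennreal ((1 / 2) ^ m * hvol TYPE('n) R)"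
    if R: "R > 0" for m g R
    using R
  proof (induction m arbitrary: g R)
    case 0
    then show ?case by (simp add: emeasure_heis_ball_hvol)
  next
    case (Suc m)
    note R = \<open>R > 0\<close>
    define c where "c = ravg b g R"
    define c2 where "c2 = ravg b g (2 * R)"
    let ?E = "{x\<in>heis_ball g R. real (Suc m) * L \<le> \<bar>b x - c\<bar>}"
    have mL: "L \<le> real (Suc m) * L" using L by (simp add: algebra_simps)
    \<comment> \<open>The exceptional null set is removed at once, so that every remaining point has
      a stopping scale.\<close>
    obtain Z
      where Z: "\<And>x. x \<in> space lborel - Z \<Longrightarrow> x \<in> heis_ball g R \<longrightarrow> K < \<bar>b x - c\<bar> \<longrightarrow>
        (\<exists>k. K < \<bar>ravg b x (R / 2 ^ k) - c\<bar>)" "Z \<in> null_sets lborel"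
      using AE_E3[OF AE_ravg_gt[OF b R, of g K c]] by blast
    let ?E' = "?E - Z"
    have [measurable]: "Z \<in> sets borel" using Z by auto
    have cc2: "\<bar>c - c2\<bar> \<le> 2 powr Q * N"
      unfolding c_def c2_def Q_def using R
      by (intro abs_ravg_diff_subset_mult[OF b] heis_ball_mono) auto
    define k where "k x = (LEAST k. K < \<bar>ravg b x (R / 2 ^ k) - c\<bar>)" for x
    define r where "r x = R / 2 ^ k x" for x
    have r0: "r x > 0" for x using R by (simp add: r_def)
    have stop: "K < \<bar>ravg b x (r x) - c\<bar>" "\<bar>ravg b x (3 * r x) - c\<bar> \<le> L" "heis_ball x (r x) \<subseteq> heis_ball g (2 * R)"
      if "x \<in> ?E'" for x
    proof -
      have xR: "x \<in> heis_ball g R" using that by simp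
      have "real (Suc m) * L \<le> \<bar>b x - c\<bar>" using that by blast
      then have "K < \<bar>b x - c\<bar>" using L mL by linarith
      then have "\<exists>k. K < \<bar>ravg b x (R / 2 ^ k) - c\<bar>"
        using Z(1)[of x] xR that by simp
      then show st: "K < \<bar>ravg b x (r x) - c\<bar>" unfolding r_def k_def by (rule LeastI_ex)
      have "heis_ball x R \<subseteq> heis_ball g (2 * R)"
        using xR by (intro heis_ball_subset) (simp add: mem_heis_ball)
      then have "\<bar>ravg b x R - c2\<bar> \<le> 2 powr Q * N"
        unfolding c2_def Q_def using R by (intro abs_ravg_diff_subset_mult[OF b]) auto
      then have "\<bar>ravg b x R - c\<bar> \<le> K" using cc2 K2 by linarith
      then have "k x \<noteq> 0" using st unfolding r_def by (metis div_by_1 not_less power_0)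
      then obtain l where l: "k x = Suc l" by (metis not0_implies_Suc)
      then have "\<not> K < \<bar>ravg b x (R / 2 ^ l) - c\<bar>"
        unfolding k_def by (metis lessI not_less_Least)
      moreover have rl: "R / 2 ^ l = 2 * r x" by (simp add: r_def l)
      ultimately have "\<bar>ravg b x (2 * r x) - c\<bar> \<le> K" by simp
      moreover have "\<bar>ravg b x (2 * r x) - ravg b x (3 * r x)\<bar> \<le> (3 / 2) powr Q * N"
        unfolding Q_def using r0[of x]
        by (intro abs_ravg_diff_subset_mult[OF b]) (auto intro!: heis_ball_mono)
      moreover have "(3 / 2) powr Q * N \<le> 3 powr Q * N"
        using N Q by (intro mult_right_mono powr_mono2) auto
      ultimately show "\<bar>ravg b x (3 * r x) - c\<bar> \<le> L" unfolding L_def by linarith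
      have "r x \<le> R" using R by (simp add: r_def field_simps)
      then show "heis_ball x (r x) \<subseteq> heis_ball g (2 * R)"
        using xR by (intro heis_ball_subset) (simp add: mem_heis_ball)
    qed
    have "emeasure lborel ?E = emeasure lborel ?E'"
      using Z by (intro emeasure_Diff_null_set[symmetric]) auto
    also have "\<dots> \<le> ennreal ((1 / 2) ^ Suc m * hvol TYPE('n) R)"
    proof (rule vitali_bound[where X = ?E' and r = r])
      show "?E' \<in> sets borel" by measurable
      show "?E' \<subseteq> (\<Union>x\<in>?E'. heis_ball x (r x))"
      proof
        fix x assume "x \<in> ?E'"
        moreover have "x \<in> heis_ball x (r x)" using r0 by (simp add: mem_heis_ball)
        ultimately show "x \<in> (\<Union>x\<in>?E'. heis_ball x (r x))" by blast
      qed
      fix J assume J: "finite J" "J \<subseteq> ?E'" "disjoint_family_on (\<lambda>x. heis_ball x (r x)) J"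
      let ?F = "\<lambda>x. {y\<in>heis_ball x (3 * r x). real m * L \<le> \<bar>b y - ravg b x (3 * r x)\<bar>}"
      \<comment> \<open>Where |b - c| is at least (m + 1) L and the average over the tripled ball is
        within L of c, the deviation from that average is at least m L, so that the induction
        hypothesis applies in the tripled ball.\<close>
      have "?E' \<inter> (\<Union>x\<in>J. heis_ball x (3 * r x)) \<subseteq> (\<Union>x\<in>J. ?F x)"
      proof
        fix y assume "y \<in> ?E' \<inter> (\<Union>x\<in>J. heis_ball x (3 * r x))"
        then obtain x where x: "x \<in> J" "y \<in> heis_ball x (3 * r x)" "real (Suc m) * L \<le> \<bar>b y - c\<bar>" by blast
        moreover have "\<bar>ravg b x (3 * r x) - c\<bar> \<le> L" using stop(2) x J(2) by blast
        ultimately have "real m * L \<le> \<bar>b y - ravg b x (3 * r x)\<bar>" by (simp add: algebra_simps)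
        then show "y \<in> (\<Union>x\<in>J. ?F x)" using x by blast
      qed
      then have "emeasure lborel (?E' \<inter> (\<Union>x\<in>J. heis_ball x (3 * r x))) \<le> emeasure lborel (\<Union>x\<in>J. ?F x)"
        using J by (intro emeasure_mono) auto
      also have "\<dots> \<le> (\<Sum>x\<in>J. emeasure lborel (?F x))"
        using J by (intro emeasure_subadditive_finite) auto
      also have "\<dots> \<le> (\<Sum>x\<in>J. ennreal ((1 / 2) ^ m * hvol TYPE('n) (3 * r x)))"
        using Suc.IH r0 by (intro sum_mono) auto
      also have "\<dots> = ennreal ((1 / 2) ^ m * 3 powr Q * (\<Sum>x\<in>J. hvol TYPE('n) (r x)))"
        using r0 by (subst sum_ennreal) (auto simp: hvol_mult less_imp_le Q_def sum_distrib_left mult.assoc)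
      also have "\<dots> \<le> ennreal ((1 / 2) ^ Suc m * hvol TYPE('n) R)"
      proof (rule ennreal_leI)
        \<comment> \<open>Each stopped ball carries a mean deviation above \<open>K\<close>, and the
          balls are disjoint inside B(g, 2R); this bounds their total volume.\<close>
        have "ennreal (K * (\<Sum>x\<in>J. hvol TYPE('n) (r x))) = (\<Sum>x\<in>J. ennreal (hvol TYPE('n) (r x)) * ennreal K)"
          using r0 K by (simp add: sum_distrib_left sum_ennreal less_imp_le mult.commute flip: ennreal_mult)
        also have "\<dots> \<le> (\<Sum>x\<in>J. \<integral>\<^sup>+ h\<in>heis_ball x (r x). ennreal \<bar>b h - c\<bar> \<partial>lborel)"
        proof (rule sum_mono)
          fix x assume "x \<in> J"
          then have "K < \<bar>ravg b x (r x) - c\<bar>" using stop(1) J(2) by blast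
          then have "ennreal K \<le> ennreal \<bar>ravg b x (r x) - c\<bar>" by (intro ennreal_leI) simp
          also have "\<dots> \<le> havg (\<lambda>h. ennreal \<bar>b h - c\<bar>) x (r x)"
            using r0 by (intro abs_ravg_diff_le bmo_boundD(3)[OF b])
          finally show "ennreal (hvol TYPE('n) (r x)) * ennreal K \<le> (\<integral>\<^sup>+ h\<in>heis_ball x (r x). ennreal \<bar>b h - c\<bar> \<partial>lborel)"
            using r0 by (simp add: nn_integral_heis_ball_eq_havg mult_left_mono)
        qed
        also have "\<dots> \<le> (\<integral>\<^sup>+ h\<in>heis_ball g (2 * R). ennreal \<bar>b h - c\<bar> \<partial>lborel)"
        proof (rule sum_nn_integral_disjoint_le)
          show "heis_ball x (r x) \<subseteq> heis_ball g (2 * R)" if "x \<in> J" for x using stop(3) that J(2) by blast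
        qed (use J in auto)
        also have "\<dots> = ennreal (hvol TYPE('n) (2 * R)) * havg (\<lambda>h. ennreal \<bar>b h - c\<bar>) g (2 * R)"
          using R by (simp add: nn_integral_heis_ball_eq_havg)
        also have "\<dots> \<le> ennreal (hvol TYPE('n) (2 * R)) * havg (\<lambda>h. ennreal \<bar>b h - c2\<bar> + ennreal \<bar>c - c2\<bar>) g (2 * R)"
          by (intro mult_left_mono havg_mono) (auto simp flip: ennreal_plus intro!: ennreal_leI)
        also have "\<dots> = ennreal (hvol TYPE('n) (2 * R)) * (havg (\<lambda>h. ennreal \<bar>b h - c2\<bar>) g (2 * R) + ennreal \<bar>c - c2\<bar>)"
          using R by (simp add: havg_add havg_const)
        also have "\<dots> \<le> ennreal (hvol TYPE('n) (2 * R)) * (ennreal N + ennreal (2 powr Q * N))"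
          using bmo_boundD(4)[OF b, of "2 * R" g] cc2 R unfolding c2_def by (intro mult_left_mono add_mono ennreal_leI) auto
        also have "\<dots> = ennreal (hvol TYPE('n) (2 * R) * (N + 2 powr Q * N))"
          using N R by (simp add: less_imp_le flip: ennreal_plus ennreal_mult)
        also have "hvol TYPE('n) (2 * R) * (N + 2 powr Q * N) = A * hvol TYPE('n) R"
        proof -
          have "hvol TYPE('n) (2 * R) = 2 powr Q * hvol TYPE('n) R"
            unfolding Q_def using R by (intro hvol_mult) auto
          moreover have "4 powr Q = 2 powr Q * 2 powr Q" using powr_mult[of 2 2 Q] by simp
          ultimately show ?thesis by (simp add: A_def algebra_simps)
        qed
        finally have "K * (\<Sum>x\<in>J. hvol TYPE('n) (r x)) \<le> A * hvol TYPE('n) R"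
          using A R by (subst (asm) ennreal_le_iff) (auto simp: less_imp_le)
        then have "3 powr Q * (\<Sum>x\<in>J. hvol TYPE('n) (r x)) \<le> hvol TYPE('n) R / 2"
          using A by (simp add: K_def field_simps)
        then have "(1 / 2) ^ m * (3 powr Q * (\<Sum>x\<in>J. hvol TYPE('n) (r x))) \<le> (1 / 2) ^ m * (hvol TYPE('n) R / 2)"
          by (rule mult_left_mono) simp
        then show "(1 / 2) ^ m * 3 powr Q * (\<Sum>x\<in>J. hvol TYPE('n) (r x)) \<le> (1 / 2) ^ Suc m * hvol TYPE('n) R"
          by (simp add: mult.assoc)
      qed
      finally show "emeasure lborel (?E' \<inter> (\<Union>x\<in>J. heis_ball x (3 * r x))) \<le> ennreal ((1 / 2) ^ Suc m * hvol TYPE('n) R)" .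
    qed
    finally show ?case unfolding c_def .
  qed
  then show ?thesis using L by blast
qed

section \<open>Moments and averages of BMO functions\<close>

lemma ennreal_le_suminf: "f j \<le> suminf f" for f :: "nat \<Rightarrow> ennreal"
  using sum_le_suminf[of f "{j}"] by (simp add: summableI)

text \<open>The layer j L \<le> |b - b_B| \<le> (j + 1) L has relative measure at most 2^(-j), while
  (1 + (j + 1) L)^s grows only polynomially in j, so the sum over the layers converges.\<close>

lemma bmo_moments:
  fixes b :: "'n::finite heis \<Rightarrow> real"
  assumes b: "bmo_bound b N" and s: "s > 0"
  shows "\<exists>C>0. \<forall>g. \<forall>R>0. havg (\<lambda>h. ennreal ((1 + \<bar>b h - ravg b g R\<bar>) powr s)) g R \<le> ennreal C"
proof -
  have bm [measurable]: "b \<in> borel_measurable borel" by (rule bmo_boundD[OF b])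
  obtain L where L: "L > 0" and JN: "\<And>m g R. R > 0 \<Longrightarrow>
    emeasure lborel {x\<in>heis_ball g R. real m * L \<le> \<bar>b x - ravg b g R\<bar>} \<le> ennreal ((1 / 2) ^ m * hvol TYPE('n) R)"
    using john_nirenberg[OF b] by blast
  define a where "a j = (1 + (real j + 1) * L) powr s * (1 / 2) ^ j" for j :: nat
  \<comment> \<open>Any ratio strictly between 1/2 and 1 absorbs the polynomial factor.\<close>
  have "a \<in> O(\<lambda>j. (3 / 4) ^ j)"
    unfolding a_def using L s by real_asymp
  then have sa: "summable a"
    by (rule summable_comparison_test_bigo[rotated]) (simp add: summable_geometric)
  define C where "C = suminf a"
  have a0: "a j > 0" for j 
  proof -
    have "0 < 1 + (real j + 1) * L" using L by (intro add_pos_nonneg) auto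
    then show ?thesis by (simp add: a_def)
  qed
  have C: "C > 0" unfolding C_def using a0 sa by (intro suminf_pos) auto
  show ?thesis
  proof (intro exI[of _ C] conjI allI impI C)
    fix g :: "'n heis" and R :: real assume R: "R > 0"
    define w where "w h = \<bar>b h - ravg b g R\<bar>" for h
    have [measurable]: "w \<in> borel_measurable borel" unfolding w_def by measurable
    have V: "hvol TYPE('n) R > 0" using R by simp
    have "(\<integral>\<^sup>+ h\<in>heis_ball g R. ennreal ((1 + w h) powr s) \<partial>lborel)
      \<le> (\<integral>\<^sup>+ h. (\<Sum>j. ennreal ((1 + (real j + 1) * L) powr s) * indicator {x\<in>heis_ball g R. real j * L \<le> w x} h) \<partial>lborel)"
    proof (rule nn_integral_mono)
      fix h
      let ?t = "\<lambda>j. ennreal ((1 + (real j + 1) * L) powr s) * indicator {x\<in>heis_ball g R. real j * L \<le> w x} h"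
      show "ennreal ((1 + w h) powr s) * indicator (heis_ball g R) h \<le> suminf ?t"
      proof (cases "h \<in> heis_ball g R")
        case True
        \<comment> \<open>The index of the layer that contains the value; this single term of the
          series already dominates.\<close>
        define j where "j = nat \<lfloor>w h / L\<rfloor>"
        have "w h / L \<ge> 0" using L by (simp add: w_def)
        then have "real j \<le> w h / L" "w h / L \<le> real j + 1" unfolding j_def by linarith+
        then have j: "real j * L \<le> w h" "w h \<le> (real j + 1) * L" using L by (simp_all add: field_simps)
        have "ennreal ((1 + w h) powr s) \<le> ?t j"
          using j s True by (auto intro!: ennreal_leI powr_mono2 simp: w_def)
        also have "\<dots> \<le> suminf ?t"
          by (rule ennreal_le_suminf)
        finally show ?thesis using True by simp
      qed simp
    qed
    also have "\<dots> = (\<Sum>j. \<integral>\<^sup>+ h. ennreal ((1 + (real j + 1) * L) powr s) * indicator {x\<in>heis_ball g R. real j * L \<le> w x} h \<partial>lborel)"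
      by (rule nn_integral_suminf) measurable
    also have "\<dots> = (\<Sum>j. ennreal ((1 + (real j + 1) * L) powr s) * emeasure lborel {x\<in>heis_ball g R. real j * L \<le> w x})"
      by (intro suminf_cong nn_integral_cmult_indicator) measurable
    also have "\<dots> \<le> (\<Sum>j. ennreal (a j * hvol TYPE('n) R))"
    proof (rule suminf_le)
      fix j
      have "ennreal ((1 + (real j + 1) * L) powr s) * emeasure lborel {x\<in>heis_ball g R. real j * L \<le> w x}
        \<le> ennreal ((1 + (real j + 1) * L) powr s) * ennreal ((1 / 2) ^ j * hvol TYPE('n) R)"
        unfolding w_def using JN[OF R] by (intro mult_left_mono) auto
      also have "\<dots> = ennreal (a j * hvol TYPE('n) R)"
        using V by (simp add: a_def mult.assoc less_imp_le flip: ennreal_mult)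
      finally show "ennreal ((1 + (real j + 1) * L) powr s) * emeasure lborel {x\<in>heis_ball g R. real j * L \<le> w x}
        \<le> ennreal (a j * hvol TYPE('n) R)" .
    qed (auto intro: summableI)
    also have "\<dots> = ennreal (C * hvol TYPE('n) R)"
      using sa a0 V by (subst suminf_ennreal2) (auto simp: C_def suminf_mult2 less_imp_le intro!: summable_mult2)
    finally have "(\<integral>\<^sup>+ h\<in>heis_ball g R. ennreal ((1 + w h) powr s) \<partial>lborel) \<le> ennreal (C * hvol TYPE('n) R)" .
    then have "havg (\<lambda>h. ennreal ((1 + w h) powr s)) g R \<le> ennreal (1 / hvol TYPE('n) R) * ennreal (C * hvol TYPE('n) R)"
      unfolding havg_def by (intro mult_left_mono) auto
    also have "\<dots> = ennreal C" using V C by (simp flip: ennreal_mult)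
    finally show "havg (\<lambda>h. ennreal ((1 + \<bar>b h - ravg b g R\<bar>) powr s)) g R \<le> ennreal C"
      unfolding w_def .
  qed
qed

text \<open>Each doubling of the radius moves the average by at most 2^Q N, and one more such step
  covers the rest from 2^n r to \<tau>. The factor 2 passes from the binary to the natural
  logarithm, since 2 ln 2 \<ge> 1.\<close>

lemma bmo_ravg_log:
  fixes b :: "'n::finite heis \<Rightarrow> real"
  assumes b: "bmo_bound b N" and r: "0 < r" "r \<le> \<tau>"
  shows "\<bar>ravg b g \<tau> - ravg b g r\<bar> \<le> 2 * 2 powr heis_dim TYPE('n) * N * (1 + ln (\<tau> / r))"
proof -
  have N: "N > 0" by (rule bmo_boundD[OF b])
  let ?D = "2 powr heis_dim TYPE('n) * N"
  have step: "\<bar>ravg b g (2 ^ n * r) - ravg b g r\<bar> \<le> real n * ?D" for n :: nat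
  proof (induction n)
    case (Suc n)
    have "\<bar>ravg b g (2 ^ n * r) - ravg b g (2 ^ Suc n * r)\<bar> \<le> ?D"
      using r by (intro abs_ravg_diff_subset_mult[OF b]) (auto intro!: heis_ball_mono)
    then show ?case using Suc by (simp add: algebra_simps)
  qed simp
  define n where "n = nat \<lfloor>log 2 (\<tau> / r)\<rfloor>"
  have lg: "log 2 (\<tau> / r) \<ge> 0" using r by (simp add: zero_le_log_cancel_iff)
  then have n: "real n \<le> log 2 (\<tau> / r)" "log 2 (\<tau> / r) < real n + 1" unfolding n_def by linarith+
  have "2 powr real n \<le> \<tau> / r" "\<tau> / r < 2 powr (real n + 1)"
    using n r by (simp_all add: le_log_iff log_less_iff)
  then have "2 ^ n \<le> \<tau> / r" "\<tau> / r \<le> 2 * 2 ^ n"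
    by (simp_all add: powr_add powr_realpow)
  then have \<tau>: "2 ^ n * r \<le> \<tau>" "\<tau> \<le> 2 * (2 ^ n * r)" using r by (simp_all add: field_simps)
  have p: "2 ^ n * r > 0" using r by simp
  have "\<bar>ravg b g (2 ^ n * r) - ravg b g \<tau>\<bar> \<le> hvol TYPE('n) \<tau> / hvol TYPE('n) (2 ^ n * r) * N"
    using \<tau> p r by (intro abs_ravg_diff_subset[OF b] heis_ball_mono) auto
  also have "\<dots> \<le> hvol TYPE('n) (2 * (2 ^ n * r)) / hvol TYPE('n) (2 ^ n * r) * N"
    using \<tau> p r N by (intro mult_right_mono divide_right_mono hvol_mono) (auto simp: less_imp_le)
  also have "\<dots> = ?D"
    using hvol_mult[of 2 "2 ^ n * r", where 'n='n] hvol_pos[OF p, where 'n='n] p by (metis less_imp_le less_irrefl nonzero_mult_div_cancel_right zero_le_numeral)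
  finally have "\<bar>ravg b g \<tau> - ravg b g r\<bar> \<le> (1 + real n) * ?D" using step[of n] by (simp add: algebra_simps)
  also have "\<dots> \<le> (2 * (1 + ln (\<tau> / r))) * ?D"
  proof (rule mult_right_mono)
    have "ln (\<tau> / r) \<ge> 0" using r by simp
    then have "ln (\<tau> / r) * 1 \<le> ln (\<tau> / r) * (2 * ln 2)"
      using ln2_ge_two_thirds by (intro mult_left_mono) auto
    then have "log 2 (\<tau> / r) \<le> 2 * ln (\<tau> / r)"
      by (simp add: log_def field_simps)
    then show "1 + real n \<le> 2 * (1 + ln (\<tau> / r))" using n by simp
  qed (use N in simp)
  finally show ?thesis by (simp add: algebra_simps)
qed

subsection \<open>The positive commutator on Lebesgue spaces\<close>

text \<open>With values in [0, infinity] this is at once the absolute integral of the Riesz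
  commutator kernel and, up to a constant, a majorant of the maximal commutator. At h = g the kernel
  is 0, since \<open>0 powr a = 0\<close>.\<close>

definition pos_comm :: "('n::finite heis \<Rightarrow> real) \<Rightarrow> real \<Rightarrow> ('n heis \<Rightarrow> ennreal) \<Rightarrow> 'n heis \<Rightarrow> ennreal" where
  "pos_comm b \<alpha> u g =
    (\<integral>\<^sup>+ h. ennreal \<bar>b g - b h\<bar> * u h * ennreal (heis_dist g h powr (\<alpha> - heis_dim TYPE('n))) \<partial>lborel)"

lemma borel_measurable_pos_comm [measurable]:
  fixes b :: "'n::finite heis \<Rightarrow> real"
  assumes [measurable]: "b \<in> borel_measurable borel" "u \<in> borel_measurable borel"
  shows "pos_comm b \<alpha> u \<in> borel_measurable borel"
proof -
  have "(\<lambda>(g, h). ennreal \<bar>b g - b h\<bar> * u h * ennreal (heis_dist g h powr (\<alpha> - heis_dim TYPE('n))))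
      \<in> borel_measurable (borel \<Otimes>\<^sub>M lborel)"
    unfolding case_prod_beta by measurable
  from lborel.borel_measurable_nn_integral[OF this] show ?thesis
    unfolding pos_comm_def[abs_def] by simp
qed

text \<open>The summand 1 turns a bound by a sum into a bound by a product, which separates the
  variables in double integrals.\<close>

lemma abs_diff_le_mult:
  fixes x y c :: real
  shows "ennreal \<bar>x - y\<bar> \<le> ennreal (1 + \<bar>x - c\<bar>) * ennreal (1 + \<bar>y - c\<bar>)"
proof -
  have "\<bar>x - y\<bar> \<le> \<bar>x - c\<bar> + \<bar>y - c\<bar>" by linarith
  also have "\<dots> \<le> (1 + \<bar>x - c\<bar>) * (1 + \<bar>y - c\<bar>)" by (simp add: algebra_simps)
  finally show ?thesis by (simp add: ennreal_leI flip: ennreal_mult del: ennreal_plus)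
qed

lemma havg_holder:
  fixes u v :: "'n::finite heis \<Rightarrow> ennreal"
  assumes [measurable]: "u \<in> borel_measurable borel" "v \<in> borel_measurable borel"
    and pq: "p > 1" "1 / p + 1 / q = 1" and r: "r > 0"
  shows "havg (\<lambda>x. u x * v x) g r \<le> epowr (havg (\<lambda>x. epowr (u x) p) g r) (1 / p) * epowr (havg (\<lambda>x. epowr (v x) q) g r) (1 / q)"
proof -
  let ?B = "heis_ball g r" and ?c = "ennreal (1 / hvol TYPE('n) r)"
  have ind: "epowr (w * indicator ?B x) t = epowr w t * indicator ?B x" for w t x
    by (simp add: indicator_def)
  have "(\<integral>\<^sup>+ x\<in>?B. u x * v x \<partial>lborel) = (\<integral>\<^sup>+ x. (u x * indicator ?B x) * (v x * indicator ?B x) \<partial>lborel)"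
    by (intro nn_integral_cong) (simp add: indicator_def)
  also have "\<dots> \<le> epowr (\<integral>\<^sup>+ x\<in>?B. epowr (u x) p \<partial>lborel) (1 / p) * epowr (\<integral>\<^sup>+ x\<in>?B. epowr (v x) q \<partial>lborel) (1 / q)"
    using holder_inequality[of "\<lambda>x. u x * indicator ?B x" lborel "\<lambda>x. v x * indicator ?B x", OF _ _ pq]
    unfolding ind by simp
  \<comment> \<open>The normalising factor is split as c = c^(1/p) c^(1/q), which turns both
    integrals into averages.\<close>
  finally have "havg (\<lambda>x. u x * v x) g r \<le> epowr ?c (1 / p + 1 / q) *
     (epowr (\<integral>\<^sup>+ x\<in>?B. epowr (u x) p \<partial>lborel) (1 / p) * epowr (\<integral>\<^sup>+ x\<in>?B. epowr (v x) q \<partial>lborel) (1 / q))"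
    unfolding havg_def pq(2) epowr_1 by (rule mult_left_mono) simp
  then show ?thesis unfolding havg_def epowr_add epowr_mult by (simp add: mult_ac)
qed

text \<open>Power means increase with the exponent, by Hoelder's inequality against the constant 1.
  In \<open>pos_comm_pairing\<close> it transfers the L_p decay of averages to the exponent s <
  p.\<close>

lemma havg_epowr_mono:
  fixes u :: "'n::finite heis \<Rightarrow> ennreal"
  assumes [measurable]: "u \<in> borel_measurable borel" and s: "0 < s" "s < p" and r: "r > 0"
  shows "epowr (havg (\<lambda>x. epowr (u x) s) g r) (1 / s) \<le> epowr (havg (\<lambda>x. epowr (u x) p) g r) (1 / p)"
proof -
  let ?t = "p / s"
  have t: "?t > 1" "1 / ?t + 1 / (p / (p - s)) = 1" using s by (auto simp: field_simps)
  have "havg (\<lambda>x. epowr (u x) s * 1) g r \<le> epowr (havg (\<lambda>x. epowr (epowr (u x) s) ?t) g r) (1 / ?t)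
      * epowr (havg (\<lambda>x. epowr 1 (p / (p - s))) g r) (1 / (p / (p - s)))"
    using r t by (intro havg_holder) auto
  also have "epowr 1 t = 1" for t using epowr_ennreal[of 1 t] by simp
  finally have "havg (\<lambda>x. epowr (u x) s) g r \<le> epowr (havg (\<lambda>x. epowr (u x) p) g r) (s / p)"
    using s r \<open>\<And>t. epowr 1 t = 1\<close> by (simp add: epowr_epowr havg_const)
  from epowr_mono[OF this, of "1 / s"] s show ?thesis by (simp add: epowr_epowr)
qed

text \<open>Hedberg's trick at one point: \<open>A\<close> stands for the maximal function and
  controls small radii, the decay D r^(-\<beta>) controls large ones. The splitting radius makes the
  two bounds equal, and each part gives D^(\<alpha>/\<beta>) A^(1 - \<alpha>/\<beta>) up to the
  factor 1/\<alpha> or 1/(\<beta> - \<alpha>).\<close>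

lemma hedberg:
  assumes \<alpha>: "0 < \<alpha>" "\<alpha> < \<beta>" and D: "D > 0"
    and W: "\<And>r. r > 0 \<Longrightarrow> W r \<le> A" "\<And>r. r > 0 \<Longrightarrow> W r \<le> ennreal (D * r powr (- \<beta>))"
  shows "(\<integral>\<^sup>+ r\<in>{0<..}. ennreal (r powr (\<alpha> - 1)) * W r \<partial>lborel)
    \<le> ennreal ((1 / \<alpha> + 1 / (\<beta> - \<alpha>)) * D powr (\<alpha> / \<beta>)) * epowr A (1 - \<alpha> / \<beta>)"
proof -
  have \<theta>: "1 - \<alpha> / \<beta> > 0" using \<alpha> by simp
  consider "A = top" | "A = 0" | a where "A = ennreal a" "a > 0"
    by (cases A) (auto simp: less_le)
  then show ?thesis
  proof cases
    case 1
    have "(1 / \<alpha> + 1 / (\<beta> - \<alpha>)) * D powr (\<alpha> / \<beta>) > 0" using \<alpha> D by (intro mult_pos_pos add_pos_pos) auto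
    then have "ennreal ((1 / \<alpha> + 1 / (\<beta> - \<alpha>)) * D powr (\<alpha> / \<beta>)) \<noteq> 0"
      by (simp only: ennreal_eq_0_iff not_le)
    then have "ennreal ((1 / \<alpha> + 1 / (\<beta> - \<alpha>)) * D powr (\<alpha> / \<beta>)) * top = top"
      by (simp only: ennreal_mult_top if_False)
    then show ?thesis unfolding 1 epowr_top by (simp only: top_greatest)
  next
    case 2
    then have "(\<integral>\<^sup>+ r\<in>{0<..}. ennreal (r powr (\<alpha> - 1)) * W r \<partial>lborel) = integral\<^sup>N lborel (\<lambda>r::real. 0)"
      using W(1) by (intro nn_integral_cong) (auto simp: indicator_def)
    then show ?thesis by simp
  next
    case 3
    define R where "R = (D / a) powr (1 / \<beta>)"
    have R: "R > 0" using D 3 by (simp add: R_def)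
    have AE: "AE r in lborel. r \<noteq> R" by (rule AE_lborel_singleton)
    have "(\<integral>\<^sup>+ r\<in>{0<..}. ennreal (r powr (\<alpha> - 1)) * W r \<partial>lborel) \<le>
      (\<integral>\<^sup>+ r. ennreal a * (ennreal (r powr (\<alpha> - 1)) * indicator {0<..<R} r)
        + ennreal D * (ennreal (r powr (- (\<beta> - \<alpha>) - 1)) * indicator {R<..} r) \<partial>lborel)"
    proof (rule nn_integral_mono_AE, use AE in eventually_elim)
      fix r assume "r \<noteq> R"
      then consider "r \<le> 0" | "0 < r" "r < R" | "r > R" by linarith
      then show "ennreal (r powr (\<alpha> - 1)) * W r * indicator {0<..} r \<le>
          ennreal a * (ennreal (r powr (\<alpha> - 1)) * indicator {0<..<R} r)
        + ennreal D * (ennreal (r powr (- (\<beta> - \<alpha>) - 1)) * indicator {R<..} r)"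
      proof cases
        case 2
        then have "ennreal (r powr (\<alpha> - 1)) * W r \<le> ennreal (r powr (\<alpha> - 1)) * ennreal a"
          using W(1) 3 by (intro mult_left_mono) auto
        then show ?thesis using 2 by (simp add: mult.commute)
      next
        case r: 3
        then have r0: "r > 0" using R by simp
        have "ennreal (r powr (\<alpha> - 1)) * W r \<le> ennreal (r powr (\<alpha> - 1)) * ennreal (D * r powr (- \<beta>))"
          using W(2)[OF r0] by (intro mult_left_mono) auto
        also have "\<dots> = ennreal (D * (r powr (\<alpha> - 1) * r powr (- \<beta>)))"
          using D by (simp add: mult_ac flip: ennreal_mult)
        also have "r powr (\<alpha> - 1) * r powr (- \<beta>) = r powr (- (\<beta> - \<alpha>) - 1)"
          by (simp add: algebra_simps flip: powr_add)
        finally show ?thesis using r r0 D by (simp add: ennreal_mult)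
      qed simp
    qed
    also have "\<dots> = ennreal a * ennreal (R powr \<alpha> / \<alpha>) + ennreal D * ennreal (R powr (- (\<beta> - \<alpha>)) / (\<beta> - \<alpha>))"
      using \<alpha> R nn_integral_powr_less[of \<alpha> R] nn_integral_powr_greater[of "\<beta> - \<alpha>" R]
      by (simp add: nn_integral_add nn_integral_cmult)
    also have "\<dots> = ennreal (a * (R powr \<alpha> / \<alpha>) + D * (R powr (- (\<beta> - \<alpha>)) / (\<beta> - \<alpha>)))"
      using \<alpha> R 3 D by (simp flip: ennreal_mult ennreal_plus)
    also have "a * (R powr \<alpha> / \<alpha>) + D * (R powr (- (\<beta> - \<alpha>)) / (\<beta> - \<alpha>))
       = (1 / \<alpha> + 1 / (\<beta> - \<alpha>)) * D powr (\<alpha> / \<beta>) * a powr (1 - \<alpha> / \<beta>)"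
    proof -
      have "R powr \<alpha> = D powr (\<alpha> / \<beta>) * a powr (- (\<alpha> / \<beta>))"
        using D 3 by (simp add: R_def powr_powr powr_divide powr_minus_divide)
      then have 1: "a * R powr \<alpha> = D powr (\<alpha> / \<beta>) * a powr (1 - \<alpha> / \<beta>)"
        using 3 powr_add[of a 1 "- (\<alpha> / \<beta>)"] by simp
      have "R powr (- (\<beta> - \<alpha>)) = R powr \<alpha> * R powr (- \<beta>)"
        by (simp add: algebra_simps flip: powr_add)
      moreover have "R powr (- \<beta>) = a / D"
        using D 3 \<alpha> by (simp add: R_def powr_powr powr_minus field_simps)
      ultimately have 2: "D * R powr (- (\<beta> - \<alpha>)) = D powr (\<alpha> / \<beta>) * a powr (1 - \<alpha> / \<beta>)"
        using 1 D by (simp add: mult.commute)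
      have "a * (R powr \<alpha> / \<alpha>) + D * (R powr (- (\<beta> - \<alpha>)) / (\<beta> - \<alpha>)) =
          a * R powr \<alpha> / \<alpha> + D * R powr (- (\<beta> - \<alpha>)) / (\<beta> - \<alpha>)" by simp
      also have "\<dots> = (1 / \<alpha> + 1 / (\<beta> - \<alpha>)) * (D powr (\<alpha> / \<beta>) * a powr (1 - \<alpha> / \<beta>))"
        unfolding 1 2 by (simp add: algebra_simps)
      finally show ?thesis by (simp add: mult.assoc)
    qed
    also have "ennreal \<dots> = ennreal ((1 / \<alpha> + 1 / (\<beta> - \<alpha>)) * D powr (\<alpha> / \<beta>)) * epowr A (1 - \<alpha> / \<beta>)"
      using 3 \<alpha> D by (simp add: epowr_ennreal ennreal_mult)
    finally show ?thesis .
  qed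
qed

text \<open>Let d be the distance of \<open>g\<close> and \<open>h\<close>. Balls with centre in
  B(g, d) and radius between 2d and 3d contain both points; these pairs (centre, radius) have
  measure |B(g, d)| d, of order d^(Q + 1), and on them the density is least at radius 3d. The part
  r^(-2Q) of the density will normalise the integrals over \<open>g\<close> and \<open>h\<close> to
  averages. For g = h the left side is 0, again by \<open>0 powr a = 0\<close>.\<close>

lemma kernel_le_ball_integral:
  fixes g h :: "'n::finite heis"
  assumes \<alpha>: "\<alpha> < heis_dim TYPE('n)"
  defines "Q \<equiv> heis_dim TYPE('n)"
  defines "c \<equiv> 1 / (3 powr (\<alpha> - 1 - 2 * Q) * heis_vol TYPE('n))"
  shows "ennreal (heis_dist g h powr (\<alpha> - Q)) \<le> ennreal c *
    (\<integral>\<^sup>+ w. ennreal (snd w powr (\<alpha> - 1 - 2 * Q)) * indicator {0<..} (snd w)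
      * (indicator (heis_ball (fst w) (snd w)) g * indicator (heis_ball (fst w) (snd w)) h) \<partial>(lborel :: ('n heis \<times> real) measure))"
proof (cases "g = h")
  case False
  define d where "d = heis_dist g h"
  have d: "d > 0" using False by (simp add: d_def heis_dist_eq_0_iff less_le)
  have Q: "Q > 0" unfolding Q_def by (rule heis_dim_pos)
  have V: "heis_vol TYPE('n) > 0" by (rule heis_vol_pos)
  let ?e = "\<alpha> - 1 - 2 * Q"
  let ?S = "heis_ball g d \<times> {2 * d<..<3 * d}"
  have "ennreal ((3 * d) powr ?e) * emeasure lborel ?S = (\<integral>\<^sup>+ w. ennreal ((3 * d) powr ?e) * indicator ?S w \<partial>lborel)"
    by (intro nn_integral_cmult_indicator[symmetric]) (simp add: open_Times)
  also have "\<dots> \<le> (\<integral>\<^sup>+ w. ennreal (snd w powr ?e) * indicator {0<..} (snd w)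
      * (indicator (heis_ball (fst w) (snd w)) g * indicator (heis_ball (fst w) (snd w)) h) \<partial>(lborel :: ('n heis \<times> real) measure))"
    (is "_ \<le> ?I")
  proof (rule nn_integral_mono)
    fix w :: "'n heis \<times> real"
    obtain x r where w: "w = (x, r)" by (cases w)
    show "ennreal ((3 * d) powr ?e) * indicator ?S w \<le> ennreal (snd w powr ?e) * indicator {0<..} (snd w)
      * (indicator (heis_ball (fst w) (snd w)) g * indicator (heis_ball (fst w) (snd w)) h)"
    proof (cases "w \<in> ?S")
      case True
      then have r: "2 * d < r" "r < 3 * d" and x: "heis_dist g x < d" by (auto simp: w mem_heis_ball)
      have "heis_dist x h < 2 * d" using heis_dist_triangle[of x h g] x
        by (simp add: heis_dist_commute d_def)
      then have "g \<in> heis_ball x r" "h \<in> heis_ball x r"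
        using x r d by (simp_all add: mem_heis_ball heis_dist_commute)
      moreover have "(3 * d) powr ?e \<le> r powr ?e"
        using r d \<alpha> Q by (intro powr_mono2') (auto simp: Q_def)
      ultimately show ?thesis using True r d by (simp add: w ennreal_leI)
    qed simp
  qed
  finally have "ennreal ((3 * d) powr ?e) * emeasure lborel ?S \<le> ?I" .
  moreover have "emeasure lborel ?S = ennreal (heis_vol TYPE('n) * d powr Q * d)"
  proof -
    have "emeasure lborel ?S = emeasure (lborel \<Otimes>\<^sub>M lborel) ?S" by (simp add: lborel_prod)
    also have "\<dots> = emeasure lborel (heis_ball g d) * emeasure lborel {2 * d<..<3 * d}"
      by (intro lborel.emeasure_pair_measure_Times) auto
    also have "\<dots> = ennreal (heis_vol TYPE('n) * d powr Q) * ennreal d"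
      using d by (simp add: emeasure_heis_ball Q_def)
    finally show ?thesis using d V by (simp add: ennreal_mult less_imp_le)
  qed
  ultimately have "ennreal c * (ennreal ((3 * d) powr ?e) * ennreal (heis_vol TYPE('n) * d powr Q * d)) \<le> ennreal c * ?I"
    by (intro mult_left_mono) auto
  also have "ennreal c * (ennreal ((3 * d) powr ?e) * ennreal (heis_vol TYPE('n) * d powr Q * d)) =
      ennreal (c * ((3 * d) powr ?e * (heis_vol TYPE('n) * d powr Q * d)))"
    using V d by (simp add: c_def less_imp_le flip: ennreal_mult)
  also have "c * ((3 * d) powr ?e * (heis_vol TYPE('n) * d powr Q * d)) = d powr ?e * (d powr Q * d)"
    using V d by (simp add: c_def powr_mult field_simps)
  also have "\<dots> = d powr (\<alpha> - Q)"
    using d powr_add[of d ?e "Q + 1"] powr_add[of d Q 1] by simp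
  finally show ?thesis by (simp add: d_def)
qed simp

section \<open>Duality and the L_p-L_q bound\<close>

lemma nn_integral_fubini3:
  fixes X :: "'a::euclidean_space \<Rightarrow> 'b::euclidean_space \<Rightarrow> 'c::euclidean_space \<Rightarrow> ennreal"
  assumes [measurable]: "(\<lambda>z. X (fst z) (fst (snd z)) (snd (snd z))) \<in> borel_measurable (borel \<Otimes>\<^sub>M (borel \<Otimes>\<^sub>M borel))"
  shows "(\<integral>\<^sup>+ g. \<integral>\<^sup>+ h. \<integral>\<^sup>+ w. X g h w \<partial>lborel \<partial>lborel \<partial>lborel) = (\<integral>\<^sup>+ w. \<integral>\<^sup>+ g. \<integral>\<^sup>+ h. X g h w \<partial>lborel \<partial>lborel \<partial>lborel)"
proof -
  have 1: "(\<lambda>(h, w). X g h w) \<in> borel_measurable (lborel \<Otimes>\<^sub>M lborel)" for g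
  proof -
    have "(\<lambda>z. (g, fst z, snd z)) \<in> (borel \<Otimes>\<^sub>M borel) \<rightarrow>\<^sub>M (borel \<Otimes>\<^sub>M (borel \<Otimes>\<^sub>M borel))" by measurable
    from measurable_compose[OF this assms] show ?thesis by (simp add: case_prod_beta cong: measurable_cong_sets)
  qed
  have 2: "(\<lambda>(g, w). \<integral>\<^sup>+ h. X g h w \<partial>lborel) \<in> borel_measurable (lborel \<Otimes>\<^sub>M lborel)"
  proof -
    have "(\<lambda>z. (fst (fst z), snd z, snd (fst z))) \<in> ((borel \<Otimes>\<^sub>M borel) \<Otimes>\<^sub>M borel) \<rightarrow>\<^sub>M (borel \<Otimes>\<^sub>M (borel \<Otimes>\<^sub>M borel))" by measurable
    from measurable_compose[OF this assms]
    have "(\<lambda>(y, h). X (fst y) h (snd y)) \<in> borel_measurable ((borel \<Otimes>\<^sub>M borel) \<Otimes>\<^sub>M lborel)"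
      by (simp add: case_prod_beta cong: measurable_cong_sets)
    from lborel.borel_measurable_nn_integral[OF this] show ?thesis
      by (simp add: case_prod_beta cong: measurable_cong_sets)
  qed
  have "(\<integral>\<^sup>+ g. \<integral>\<^sup>+ h. \<integral>\<^sup>+ w. X g h w \<partial>lborel \<partial>lborel \<partial>lborel) = (\<integral>\<^sup>+ g. \<integral>\<^sup>+ w. \<integral>\<^sup>+ h. X g h w \<partial>lborel \<partial>lborel \<partial>lborel)"
    by (intro nn_integral_cong lborel_pair.Fubini'[OF 1, symmetric])
  also have "\<dots> = (\<integral>\<^sup>+ w. \<integral>\<^sup>+ g. \<integral>\<^sup>+ h. X g h w \<partial>lborel \<partial>lborel \<partial>lborel)"
    by (rule lborel_pair.Fubini'[OF 2, symmetric])
  finally show ?thesis .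
qed

lemma borel_measurable_havg_radius:
  fixes u :: "'n::finite heis \<Rightarrow> ennreal"
  assumes [measurable]: "u \<in> borel_measurable borel"
  shows "(\<lambda>w. havg u (fst w) (snd w)) \<in> borel_measurable (borel \<Otimes>\<^sub>M borel)"
proof -
  have "(\<lambda>(w, h). u h * indicator (heis_ball (fst w) (snd w)) h) \<in> borel_measurable ((borel \<Otimes>\<^sub>M borel) \<Otimes>\<^sub>M lborel)"
    unfolding case_prod_beta by measurable
  from lborel.borel_measurable_nn_integral[OF this]
  have [measurable]: "(\<lambda>w. \<integral>\<^sup>+ h\<in>heis_ball (fst w) (snd w). u h \<partial>lborel) \<in> borel_measurable (borel \<Otimes>\<^sub>M borel)" .
  show ?thesis unfolding havg_def hvol_def by measurable
qed

text \<open>For a fixed ball the weight is centred at its own average, the integrals over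
  \<open>g\<close> and \<open>h\<close> factor, and Hoelder's inequality moves the weights into
  moments of orders t' and s', bounded uniformly in the ball. The two volumes that turn integrals
  into averages reduce r^(\<alpha> - 1 - 2Q) to r^(\<alpha> - 1).\<close>

lemma pos_comm_pairing_le:
  fixes b :: "'n::finite heis \<Rightarrow> real"
  assumes b: "bmo_bound b N" and \<alpha>: "\<alpha> < heis_dim TYPE('n)" and s: "s > 1" "t > 1"
  shows "\<exists>C>0. \<forall>u\<in>borel_measurable borel. \<forall>F\<in>borel_measurable borel.
    (\<integral>\<^sup>+ g. F g * pos_comm b \<alpha> u g \<partial>lborel) \<le> ennreal C *
    (\<integral>\<^sup>+ x. (\<integral>\<^sup>+ r\<in>{0<..}. ennreal (r powr (\<alpha> - 1)) *
       (epowr (havg (\<lambda>h. epowr (F h) t) x r) (1 / t) * epowr (havg (\<lambda>h. epowr (u h) s) x r) (1 / s)) \<partial>lborel) \<partial>lborel)"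
proof -
  define Q where "Q = heis_dim TYPE('n)"
  define c where "c = 1 / (3 powr (\<alpha> - 1 - 2 * Q) * heis_vol TYPE('n))"
  have bm [measurable]: "b \<in> borel_measurable borel" by (rule bmo_boundD[OF b])
  define s' t' where "s' = s / (s - 1)" and "t' = t / (t - 1)"
  have s': "1 / s + 1 / s' = 1" "s' > 0" and t': "1 / t + 1 / t' = 1" "t' > 0"
    using s by (auto simp: s'_def t'_def field_simps)
  obtain C1 where C1: "C1 > 0" "\<And>g R. R > 0 \<Longrightarrow> havg (\<lambda>h. ennreal ((1 + \<bar>b h - ravg b g R\<bar>) powr s')) g R \<le> ennreal C1"
    using bmo_moments[OF b s'(2)] by blast
  obtain C2 where C2: "C2 > 0" "\<And>g R. R > 0 \<Longrightarrow> havg (\<lambda>h. ennreal ((1 + \<bar>b h - ravg b g R\<bar>) powr t')) g R \<le> ennreal C2"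
    using bmo_moments[OF b t'(2)] by blast
  define K where "K = C1 powr (1 / s') * C2 powr (1 / t')"
  have K: "K > 0" using C1 C2 by (simp add: K_def)
  have V: "heis_vol TYPE('n) > 0" by (rule heis_vol_pos)
  have c: "c > 0" using V by (simp add: c_def)
  \<comment> \<open>\<open>c\<close> comes from the kernel, the square of the unit volume from the
    two averages, \<open>K\<close> from the moments of the weight.\<close>
  define C where "C = c * ((heis_vol TYPE('n))\<^sup>2 * K)"
  show ?thesis
  proof (intro exI[of _ C] conjI ballI)
    show "C > 0" using c V K by (simp add: C_def)
    fix u F :: "'n heis \<Rightarrow> ennreal"
    assume [measurable]: "u \<in> borel_measurable borel" "F \<in> borel_measurable borel"
    let ?ind = "\<lambda>w g. indicator (heis_ball (fst w) (snd w)) g :: ennreal"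
    let ?\<rho> = "\<lambda>w::'n heis \<times> real. ennreal (snd w powr (\<alpha> - 1 - 2 * Q)) * indicator {0<..} (snd w)"
    define X where "X g h w = ?\<rho> w * ((F g * ennreal \<bar>b g - b h\<bar> * u h) * (?ind w g * ?ind w h))" for g h w
    let ?av = "\<lambda>x r. epowr (havg (\<lambda>h. epowr (F h) t) x r) (1 / t) * epowr (havg (\<lambda>h. epowr (u h) s) x r) (1 / s)"
    let ?Y = "\<lambda>w. ennreal (snd w powr (\<alpha> - 1)) * indicator {0<..} (snd w) * ?av (fst w) (snd w)"
    have [measurable]: "(\<lambda>w. havg (\<lambda>h. epowr (F h) t) (fst w) (snd w)) \<in> borel_measurable (borel \<Otimes>\<^sub>M borel)"
      "(\<lambda>w. havg (\<lambda>h. epowr (u h) s) (fst w) (snd w)) \<in> borel_measurable (borel \<Otimes>\<^sub>M borel)"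
      by (intro borel_measurable_havg_radius; measurable)+
    have Ym: "?Y \<in> borel_measurable (borel \<Otimes>\<^sub>M borel)"
      by measurable
    have "(\<integral>\<^sup>+ g. F g * pos_comm b \<alpha> u g \<partial>lborel) \<le> (\<integral>\<^sup>+ g. \<integral>\<^sup>+ h. \<integral>\<^sup>+ w. ennreal c * X g h w \<partial>lborel \<partial>lborel \<partial>lborel)"
    proof (rule nn_integral_mono)
      fix g :: "'n heis"
      have "F g * pos_comm b \<alpha> u g = (\<integral>\<^sup>+ h. F g * (ennreal \<bar>b g - b h\<bar> * u h * ennreal (heis_dist g h powr (\<alpha> - Q))) \<partial>lborel)"
        unfolding pos_comm_def Q_def by (rule nn_integral_cmult[symmetric]) measurable
      also have "\<dots> \<le> (\<integral>\<^sup>+ h. \<integral>\<^sup>+ w. ennreal c * X g h w \<partial>lborel \<partial>lborel)"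
      proof (rule nn_integral_mono)
        fix h :: "'n heis"
        let ?A = "F g * ennreal \<bar>b g - b h\<bar> * u h"
        have m: "(\<lambda>w::'n heis \<times> real. ?\<rho> w * (?ind w g * ?ind w h)) \<in> borel_measurable lborel"
        proof -
          have "(\<lambda>w. ?\<rho> w * (?ind w g * ?ind w h)) \<in> borel_measurable (borel \<Otimes>\<^sub>M borel)"
            by measurable
          then show ?thesis by (simp add: borel_prod)
        qed
        have "?A * ennreal (heis_dist g h powr (\<alpha> - Q)) \<le> ?A * (ennreal c * (\<integral>\<^sup>+ w. ?\<rho> w * (?ind w g * ?ind w h) \<partial>lborel))"
          unfolding Q_def c_def by (intro mult_left_mono kernel_le_ball_integral \<alpha>) simp
        also have "\<dots> = (\<integral>\<^sup>+ w. (?A * ennreal c) * (?\<rho> w * (?ind w g * ?ind w h)) \<partial>lborel)"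
          by (subst nn_integral_cmult[OF m]) (simp add: mult.assoc)
        also have "\<dots> = (\<integral>\<^sup>+ w. ennreal c * X g h w \<partial>lborel)"
          by (intro nn_integral_cong) (simp add: X_def mult_ac)
        finally show "F g * (ennreal \<bar>b g - b h\<bar> * u h * ennreal (heis_dist g h powr (\<alpha> - Q))) \<le> (\<integral>\<^sup>+ w. ennreal c * X g h w \<partial>lborel)"
          by (simp add: mult.assoc)
      qed
      finally show "F g * pos_comm b \<alpha> u g \<le> (\<integral>\<^sup>+ h. \<integral>\<^sup>+ w. ennreal c * X g h w \<partial>lborel \<partial>lborel)" .
    qed
    \<comment> \<open>The ball becomes the outermost variable, so that its average can serve as the
      centre of the weight.\<close>
    also have "\<dots> = (\<integral>\<^sup>+ w. \<integral>\<^sup>+ g. \<integral>\<^sup>+ h. ennreal c * X g h w \<partial>lborel \<partial>lborel \<partial>lborel)"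
    proof (rule nn_integral_fubini3)
      show "(\<lambda>z. ennreal c * X (fst z) (fst (snd z)) (snd (snd z))) \<in> borel_measurable (borel \<Otimes>\<^sub>M (borel \<Otimes>\<^sub>M borel))"
        unfolding X_def borel_prod[symmetric, where 'a = "'n heis" and 'b = real] by measurable
    qed
    also have "\<dots> \<le> (\<integral>\<^sup>+ w. ennreal C * (?Y w) \<partial>lborel)"
    proof (rule nn_integral_mono)
      fix w :: "'n heis \<times> real"
      obtain x r where w: "w = (x, r)" by (cases w)
      show "(\<integral>\<^sup>+ g. \<integral>\<^sup>+ h. ennreal c * X g h w \<partial>lborel \<partial>lborel) \<le>
        ennreal C * (?Y w)"
      proof (cases "r > 0")
        case True
        define m where "m h = ennreal (1 + \<bar>b h - ravg b x r\<bar>)" for h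
        have [measurable]: "m \<in> borel_measurable borel" unfolding m_def by measurable
        have me: "epowr (m h) e = ennreal ((1 + \<bar>b h - ravg b x r\<bar>) powr e)" for h e
          unfolding m_def by (rule epowr_ennreal) simp
        have bm_le: "ennreal \<bar>b g - b h\<bar> \<le> m g * m h" for g h
          unfolding m_def by (rule abs_diff_le_mult)
        let ?B = "heis_ball x r" and ?k = "ennreal (c * r powr (\<alpha> - 1 - 2 * Q))" and ?V = "hvol TYPE('n) r"
        have VV: "?V > 0" using True by simp
        have "(\<integral>\<^sup>+ g. \<integral>\<^sup>+ h. ennreal c * X g h w \<partial>lborel \<partial>lborel) \<le>
          (\<integral>\<^sup>+ g. \<integral>\<^sup>+ h. (?k * (F g * m g * indicator ?B g)) * (u h * m h * indicator ?B h) \<partial>lborel \<partial>lborel)"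
        proof (intro nn_integral_mono)
          fix g h
          have "ennreal c * X g h w = ?k * ((F g * ennreal \<bar>b g - b h\<bar> * u h) * (indicator ?B g * indicator ?B h))"
            using True c by (simp add: X_def w ennreal_mult mult.assoc)
          also have "\<dots> \<le> ?k * ((F g * (m g * m h) * u h) * (indicator ?B g * indicator ?B h))"
            by (intro mult_left_mono mult_right_mono bm_le) auto
          finally show "ennreal c * X g h w \<le> (?k * (F g * m g * indicator ?B g)) * (u h * m h * indicator ?B h)"
            by (simp add: mult_ac)
        qed
        also have "\<dots> = ?k * ((\<integral>\<^sup>+ g\<in>?B. F g * m g \<partial>lborel) * (\<integral>\<^sup>+ h\<in>?B. u h * m h \<partial>lborel))"
        proof -
          let ?I = "\<integral>\<^sup>+ h\<in>?B. u h * m h \<partial>lborel"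
          have "(\<integral>\<^sup>+ g. \<integral>\<^sup>+ h. (?k * (F g * m g * indicator ?B g)) * (u h * m h * indicator ?B h) \<partial>lborel \<partial>lborel)
              = (\<integral>\<^sup>+ g. (?k * (F g * m g * indicator ?B g)) * ?I \<partial>lborel)"
            by (intro nn_integral_cong nn_integral_cmult) measurable
          also have "\<dots> = (\<integral>\<^sup>+ g. ?k * (F g * m g * indicator ?B g) \<partial>lborel) * ?I"
            by (rule nn_integral_multc) measurable
          also have "(\<integral>\<^sup>+ g. ?k * (F g * m g * indicator ?B g) \<partial>lborel) = ?k * (\<integral>\<^sup>+ g\<in>?B. F g * m g \<partial>lborel)"
            by (rule nn_integral_cmult) measurable
          finally show ?thesis by (simp only: mult.assoc)
        qed
        also have "\<dots> = ?k * ((ennreal ?V * havg (\<lambda>g. F g * m g) x r) * (ennreal ?V * havg (\<lambda>h. u h * m h) x r))"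
          using True by (simp add: nn_integral_heis_ball_eq_havg)
        also have "\<dots> \<le> ?k * ((ennreal ?V * (epowr (havg (\<lambda>h. epowr (F h) t) x r) (1 / t) * ennreal (C2 powr (1 / t'))))
            * (ennreal ?V * (epowr (havg (\<lambda>h. epowr (u h) s) x r) (1 / s) * ennreal (C1 powr (1 / s')))))"
        proof -
          have "havg (\<lambda>g. F g * m g) x r \<le> epowr (havg (\<lambda>h. epowr (F h) t) x r) (1 / t) * epowr (havg (\<lambda>h. epowr (m h) t') x r) (1 / t')"
            by (intro havg_holder True t' s) measurable
          also have "\<dots> \<le> epowr (havg (\<lambda>h. epowr (F h) t) x r) (1 / t) * epowr (ennreal C2) (1 / t')"
            using C2(2)[OF True, of x] t' by (intro mult_left_mono epowr_mono) (auto simp: me)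
          finally have 1: "havg (\<lambda>g. F g * m g) x r \<le> epowr (havg (\<lambda>h. epowr (F h) t) x r) (1 / t) * ennreal (C2 powr (1 / t'))"
            using C2 by (simp add: epowr_ennreal)
          have "havg (\<lambda>h. u h * m h) x r \<le> epowr (havg (\<lambda>h. epowr (u h) s) x r) (1 / s) * epowr (havg (\<lambda>h. epowr (m h) s') x r) (1 / s')"
            by (intro havg_holder True s' s) measurable
          also have "\<dots> \<le> epowr (havg (\<lambda>h. epowr (u h) s) x r) (1 / s) * epowr (ennreal C1) (1 / s')"
            using C1(2)[OF True, of x] s' by (intro mult_left_mono epowr_mono) (auto simp: me)
          finally have 2: "havg (\<lambda>h. u h * m h) x r \<le> epowr (havg (\<lambda>h. epowr (u h) s) x r) (1 / s) * ennreal (C1 powr (1 / s'))"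
            using C1 by (simp add: epowr_ennreal)
          show ?thesis by (intro mult_left_mono mult_mono 1 2) auto
        qed
        also have "\<dots> = (?k * (ennreal ?V * (ennreal ?V * (ennreal (C2 powr (1 / t')) * ennreal (C1 powr (1 / s')))))) * ?av x r"
          by (simp add: mult_ac)
        also have "?k * (ennreal ?V * (ennreal ?V * (ennreal (C2 powr (1 / t')) * ennreal (C1 powr (1 / s')))))
            = ennreal (c * r powr (\<alpha> - 1 - 2 * Q) * (?V * (?V * (C2 powr (1 / t') * C1 powr (1 / s')))))"
          using VV c by (simp add: less_imp_le flip: ennreal_mult)
        also have "c * r powr (\<alpha> - 1 - 2 * Q) * (?V * (?V * (C2 powr (1 / t') * C1 powr (1 / s')))) = C * r powr (\<alpha> - 1)"
        proof -
          have "r powr (\<alpha> - 1) = r powr (\<alpha> - 1 - 2 * Q) * (r powr Q * r powr Q)"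
            using True by (simp flip: powr_add)
          then show ?thesis by (simp add: C_def K_def hvol_def Q_def power2_eq_square)
        qed
        also have "ennreal (C * r powr (\<alpha> - 1)) * ?av x r = ennreal C * (ennreal (r powr (\<alpha> - 1)) * ?av x r)"
          using \<open>C > 0\<close> by (simp add: ennreal_mult mult.assoc)
        finally show ?thesis using True by (simp add: w)
      qed (simp add: X_def w)
    qed
    also have "\<dots> = ennreal C * (\<integral>\<^sup>+ w. ?Y w \<partial>lborel)"
    proof (rule nn_integral_cmult)
      from Ym show m: "?Y \<in> borel_measurable lborel"
        by (simp add: borel_prod)
    qed
    also have "(\<integral>\<^sup>+ w. ?Y w \<partial>lborel) =
        (\<integral>\<^sup>+ x. (\<integral>\<^sup>+ r\<in>{0<..}. ennreal (r powr (\<alpha> - 1)) * ?av x r \<partial>lborel) \<partial>lborel)"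
    proof -
      from Ym have "?Y \<in> borel_measurable (lborel \<Otimes>\<^sub>M lborel)"
        by (simp cong: measurable_cong_sets)
      from lborel.nn_integral_fst[OF this] show ?thesis
        by (simp add: lborel_prod mult_ac)
    qed
    finally show "(\<integral>\<^sup>+ g. F g * pos_comm b \<alpha> u g \<partial>lborel) \<le> ennreal C *
      (\<integral>\<^sup>+ x. (\<integral>\<^sup>+ r\<in>{0<..}. ennreal (r powr (\<alpha> - 1)) * ?av x r \<partial>lborel) \<partial>lborel)" .
  qed
qed

text \<open>Q/p is the rate at which averages of an L_p function decay, the \<beta> of
  \<open>hedberg\<close>; the last identity gives the exponent that \<open>hedberg\<close> leaves on
  the maximal function.\<close>

lemma conjugate_exponent_bounds:
  fixes p q \<alpha> Q :: real
  assumes "1 < p" "0 < \<alpha>" "\<alpha> < Q / p" "1 / q = 1 / p - \<alpha> / Q"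
  shows "Q > 0" "\<alpha> < Q" "p < q" "1 - \<alpha> / (Q / p) = p / q"
proof -
  have "0 < Q / p" using assms by linarith
  then show Q: "Q > 0" using assms by (simp add: zero_less_divide_iff)
  have "Q / p \<le> Q" using assms Q by (simp add: divide_le_eq)
  then show "\<alpha> < Q" using assms by linarith
  have "\<alpha> / Q < 1 / p" using assms Q by (simp add: field_simps)
  moreover have "0 < \<alpha> / Q" using assms Q by simp
  ultimately have "0 < 1 / q" "1 / q < 1 / p" using assms by linarith+
  then have "q > 0" by (simp add: zero_less_divide_iff)
  then have "1 / q * (p * q) < 1 / p * (p * q)"
    using \<open>1 / q < 1 / p\<close> assms(1) by (intro mult_strict_right_mono) auto
  then show "p < q" using \<open>q > 0\<close> assms(1) by simp
  have "1 - \<alpha> / (Q / p) = p * (1 / p - \<alpha> / Q)" using assms Q by (simp add: field_simps)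
  then show "1 - \<alpha> / (Q / p) = p / q" by (simp flip: assms(4))
qed

text \<open>The average of \<open>F\<close> is replaced by a maximal function and leaves the radial
  integral; \<open>hedberg\<close> for the averages of \<open>u\<close> yields T^(\<alpha>/\<beta>)
  times the power p/q of a maximal function of \<open>u\<close>. Hoelder's inequality with q' and q
  separates the two, and the maximal theorem bounds each.\<close>

lemma pos_comm_pairing:
  fixes b :: "'n::finite heis \<Rightarrow> real"
  assumes b: "bmo_bound b N" and p: "1 < p" and \<alpha>: "0 < \<alpha>" "\<alpha> < heis_dim TYPE('n) / p"
    and q: "1 / q = 1 / p - \<alpha> / heis_dim TYPE('n)"
  shows "\<exists>C>0. \<forall>u\<in>borel_measurable borel. \<forall>F\<in>borel_measurable borel. \<forall>T>0.
    (\<integral>\<^sup>+ x. epowr (u x) p \<partial>lborel) \<le> ennreal (T powr p) \<longrightarrow>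
    (\<integral>\<^sup>+ x. F x * pos_comm b \<alpha> u x \<partial>lborel) \<le>
      ennreal (C * T) * epowr (\<integral>\<^sup>+ x. epowr (F x) (q / (q - 1)) \<partial>lborel) (1 / (q / (q - 1)))"
proof -
  define Q where "Q = heis_dim TYPE('n)"
  define \<beta> where "\<beta> = Q / p"
  note cb = conjugate_exponent_bounds[OF p \<alpha> q, folded Q_def]
  have q1: "q > 1" using cb p by linarith
  define q' where "q' = q / (q - 1)"
  have q': "q' > 1" "1 / q' + 1 / q = 1" using q1 by (auto simp: q'_def field_simps)
  \<comment> \<open>Midpoints: the Hoelder steps need exponents above 1, the maximal theorem at p/s
    and q'/t needs them below p and q'.\<close>
  define s t where "s = (1 + p) / 2" and "t = (1 + q') / 2"
  have st: "s > 1" "t > 1" "s < p" "t < q'" using p q' by (auto simp: s_def t_def)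
  have V: "heis_vol TYPE('n) > 0" by (rule heis_vol_pos)
  obtain C0 where C0: "C0 > 0" "\<And>u F. u \<in> borel_measurable borel \<Longrightarrow> F \<in> borel_measurable borel \<Longrightarrow>
    (\<integral>\<^sup>+ g. F g * pos_comm b \<alpha> u g \<partial>lborel) \<le> ennreal C0 *
    (\<integral>\<^sup>+ x. (\<integral>\<^sup>+ r\<in>{0<..}. ennreal (r powr (\<alpha> - 1)) *
       (epowr (havg (\<lambda>h. epowr (F h) t) x r) (1 / t) * epowr (havg (\<lambda>h. epowr (u h) s) x r) (1 / s)) \<partial>lborel) \<partial>lborel)"
    using pos_comm_pairing_le[OF b cb(2)[unfolded Q_def] st(1,2)] by blast
  obtain Cs where Cs: "Cs > 0" "\<And>u. u \<in> borel_measurable borel \<Longrightarrow>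
    (\<integral>\<^sup>+ x. epowr (HLmax u (x::'n heis)) (p / s) \<partial>lborel) \<le> ennreal Cs * (\<integral>\<^sup>+ x. epowr (u x) (p / s) \<partial>lborel)"
    using HLmax_strong[of "p / s"] st by auto
  obtain Ct where Ct: "Ct > 0" "\<And>u. u \<in> borel_measurable borel \<Longrightarrow>
    (\<integral>\<^sup>+ x. epowr (HLmax u (x::'n heis)) (q' / t) \<partial>lborel) \<le> ennreal Ct * (\<integral>\<^sup>+ x. epowr (u x) (q' / t) \<partial>lborel)"
    using HLmax_strong[of "q' / t"] st by auto
  define k where "k = 1 / \<alpha> + 1 / (\<beta> - \<alpha>)"
  have \<beta>: "\<alpha> < \<beta>" "1 - \<alpha> / \<beta> = p / q" using \<alpha> cb by (auto simp: \<beta>_def Q_def)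
  have k: "k > 0" unfolding k_def using \<alpha> \<beta> by (intro add_pos_pos) auto
  define v where "v = heis_vol TYPE('n) powr (- (1 / p))"
  have v: "v > 0" using V by (simp add: v_def)
  \<comment> \<open>The powers of \<open>Ct\<close> and \<open>Cs\<close> are those that Hoelder's
    inequality puts on the two maximal bounds.\<close>
  define C where "C = C0 * (k * v powr (\<alpha> / \<beta>)) * (Ct powr (1 / q') * Cs powr (1 / q))"
  show ?thesis unfolding q'_def[symmetric]
  proof (intro exI[of _ C] conjI ballI allI impI)
    show "C > 0" using C0 k v Ct Cs by (simp add: C_def)
    fix u F :: "'n heis \<Rightarrow> ennreal" and T :: real
    assume [measurable]: "u \<in> borel_measurable borel" "F \<in> borel_measurable borel" and T: "T > 0"
      and uT: "(\<integral>\<^sup>+ x. epowr (u x) p \<partial>lborel) \<le> ennreal (T powr p)"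
    define Mu where "Mu x = epowr (HLmax (\<lambda>x. epowr (u x) s) x) (1 / s)" for x
    define MF where "MF x = epowr (HLmax (\<lambda>x. epowr (F x) t) x) (1 / t)" for x
    have [measurable]: "Mu \<in> borel_measurable borel" "MF \<in> borel_measurable borel"
      unfolding Mu_def MF_def by measurable
    define D where "D = v * T"
    have D: "D > 0" using v T by (simp add: D_def)
    have inner: "(\<integral>\<^sup>+ r\<in>{0<..}. ennreal (r powr (\<alpha> - 1)) *
       (epowr (havg (\<lambda>h. epowr (F h) t) x r) (1 / t) * epowr (havg (\<lambda>h. epowr (u h) s) x r) (1 / s)) \<partial>lborel)
      \<le> MF x * (ennreal (k * D powr (\<alpha> / \<beta>)) * epowr (Mu x) (p / q))" for x
    proof -
      let ?W = "\<lambda>r. epowr (havg (\<lambda>h. epowr (u h) s) x r) (1 / s)"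
      have [measurable]: "(\<lambda>r. havg (\<lambda>h. epowr (u h) s) x r) \<in> borel_measurable borel"
        using measurable_compose[OF measurable_Pair1' borel_measurable_havg_radius[of "\<lambda>h. epowr (u h) s"], of x] by simp
      have "(\<integral>\<^sup>+ r\<in>{0<..}. ennreal (r powr (\<alpha> - 1)) * (epowr (havg (\<lambda>h. epowr (F h) t) x r) (1 / t) * ?W r) \<partial>lborel)
        \<le> (\<integral>\<^sup>+ r. MF x * (ennreal (r powr (\<alpha> - 1)) * ?W r * indicator {0<..} r) \<partial>lborel)"
      proof (rule nn_integral_mono)
        fix r :: real
        show "ennreal (r powr (\<alpha> - 1)) * (epowr (havg (\<lambda>h. epowr (F h) t) x r) (1 / t) * ?W r) * indicator {0<..} r
          \<le> MF x * (ennreal (r powr (\<alpha> - 1)) * ?W r * indicator {0<..} r)"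
        proof (cases "r > 0")
          case True
          then have "epowr (havg (\<lambda>h. epowr (F h) t) x r) (1 / t) \<le> MF x"
            unfolding MF_def using st by (intro epowr_mono havg_le_HLmax) auto
          then have "epowr (havg (\<lambda>h. epowr (F h) t) x r) (1 / t) * (ennreal (r powr (\<alpha> - 1)) * ?W r) \<le> MF x * (ennreal (r powr (\<alpha> - 1)) * ?W r)"
            by (rule mult_right_mono) simp
          then show ?thesis using True by (simp add: mult_ac)
        qed simp
      qed
      also have "\<dots> = MF x * (\<integral>\<^sup>+ r\<in>{0<..}. ennreal (r powr (\<alpha> - 1)) * ?W r \<partial>lborel)"
        by (rule nn_integral_cmult) measurable
      also have "\<dots> \<le> MF x * (ennreal (k * D powr (\<alpha> / \<beta>)) * epowr (Mu x) (1 - \<alpha> / \<beta>))"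
        unfolding k_def
      proof (intro mult_left_mono hedberg \<alpha> \<beta> D)
        fix r :: real assume r: "r > 0"
        show "?W r \<le> Mu x" unfolding Mu_def using st r by (intro epowr_mono havg_le_HLmax) auto
        have Vr: "hvol TYPE('n) r > 0" using r by simp
        \<comment> \<open>The power mean of order p brings in the full norm of \<open>u\<close>, and
          with it the decay T |B(x, r)|^(-1/p) = v T r^(-Q/p).\<close>
        have "?W r \<le> epowr (havg (\<lambda>h. epowr (u h) p) x r) (1 / p)"
          using st r by (intro havg_epowr_mono) auto
        also have "\<dots> \<le> epowr (ennreal (1 / hvol TYPE('n) r) * ennreal (T powr p)) (1 / p)"
        proof -
          have "(\<integral>\<^sup>+ h\<in>heis_ball x r. epowr (u h) p \<partial>lborel) \<le> (\<integral>\<^sup>+ h. epowr (u h) p \<partial>lborel)"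
            by (intro nn_integral_mono) (auto simp: indicator_def)
          then show ?thesis unfolding havg_def using uT p
            by (intro epowr_mono mult_left_mono) (auto intro: order_trans)
        qed
        also have "\<dots> = ennreal ((1 / hvol TYPE('n) r * T powr p) powr (1 / p))"
          using Vr by (subst ennreal_mult[symmetric]) (auto intro!: epowr_ennreal)
        also have "(1 / hvol TYPE('n) r * T powr p) powr (1 / p) = D * r powr (- \<beta>)"
          using V r T p by (simp add: hvol_def D_def v_def \<beta>_def Q_def powr_mult powr_divide powr_powr powr_minus_divide)
        finally show "?W r \<le> ennreal (D * r powr (- \<beta>))" .
      qed simp
      finally show ?thesis unfolding \<beta>(2) .
    qed
    have "(\<integral>\<^sup>+ x. F x * pos_comm b \<alpha> u x \<partial>lborel) \<le> ennreal C0 * (\<integral>\<^sup>+ x. MF x * (ennreal (k * D powr (\<alpha> / \<beta>)) * epowr (Mu x) (p / q)) \<partial>lborel)"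
      by (rule order_trans[OF C0(2)]) (auto intro!: mult_left_mono nn_integral_mono inner)
    also have "\<dots> = ennreal C0 * (ennreal (k * D powr (\<alpha> / \<beta>)) * (\<integral>\<^sup>+ x. MF x * epowr (Mu x) (p / q) \<partial>lborel))"
    proof -
      have "(\<integral>\<^sup>+ x. MF x * (ennreal (k * D powr (\<alpha> / \<beta>)) * epowr (Mu x) (p / q)) \<partial>lborel)
          = (\<integral>\<^sup>+ x. ennreal (k * D powr (\<alpha> / \<beta>)) * (MF x * epowr (Mu x) (p / q)) \<partial>lborel)"
        by (simp only: mult.left_commute)
      also have "\<dots> = ennreal (k * D powr (\<alpha> / \<beta>)) * (\<integral>\<^sup>+ x. MF x * epowr (Mu x) (p / q) \<partial>lborel)"
        by (rule nn_integral_cmult) measurable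
      finally show ?thesis by simp
    qed
    also have "\<dots> \<le> ennreal C0 * (ennreal (k * D powr (\<alpha> / \<beta>)) *
       (epowr (\<integral>\<^sup>+ x. epowr (MF x) q' \<partial>lborel) (1 / q') * epowr (\<integral>\<^sup>+ x. epowr (epowr (Mu x) (p / q)) q \<partial>lborel) (1 / q)))"
      by (intro mult_left_mono holder_inequality q') auto
    also have "\<dots> \<le> ennreal C0 * (ennreal (k * D powr (\<alpha> / \<beta>)) *
       (epowr (ennreal Ct * (\<integral>\<^sup>+ x. epowr (F x) q' \<partial>lborel)) (1 / q') * epowr (ennreal Cs * ennreal (T powr p)) (1 / q)))"
    proof (intro mult_left_mono mult_mono epowr_mono)
      have "(\<integral>\<^sup>+ x. epowr (MF x) q' \<partial>lborel) = (\<integral>\<^sup>+ x. epowr (HLmax (\<lambda>x. epowr (F x) t) x) (q' / t) \<partial>lborel)"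
        by (simp add: MF_def epowr_epowr)
      also have "\<dots> \<le> ennreal Ct * (\<integral>\<^sup>+ x. epowr (epowr (F x) t) (q' / t) \<partial>lborel)" by (rule Ct) measurable
      finally show "(\<integral>\<^sup>+ x. epowr (MF x) q' \<partial>lborel) \<le> ennreal Ct * (\<integral>\<^sup>+ x. epowr (F x) q' \<partial>lborel)"
        using st by (simp add: epowr_epowr)
      have "(\<integral>\<^sup>+ x. epowr (epowr (Mu x) (p / q)) q \<partial>lborel) = (\<integral>\<^sup>+ x. epowr (HLmax (\<lambda>x. epowr (u x) s) x) (p / s) \<partial>lborel)"
        using q1 by (simp add: Mu_def epowr_epowr)
      also have "\<dots> \<le> ennreal Cs * (\<integral>\<^sup>+ x. epowr (epowr (u x) s) (p / s) \<partial>lborel)" by (rule Cs) measurable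
      also have "\<dots> \<le> ennreal Cs * ennreal (T powr p)"
        using st uT by (intro mult_left_mono) (auto simp: epowr_epowr)
      finally show "(\<integral>\<^sup>+ x. epowr (epowr (Mu x) (p / q)) q \<partial>lborel) \<le> ennreal Cs * ennreal (T powr p)" .
    qed (use q1 q' in auto)
    also have "\<dots> = (ennreal C0 * (ennreal (k * D powr (\<alpha> / \<beta>)) * (ennreal (Ct powr (1 / q')) * ennreal (Cs powr (1 / q) * T powr (p / q)))))
       * epowr (\<integral>\<^sup>+ x. epowr (F x) q' \<partial>lborel) (1 / q')"
      using Ct Cs T by (simp add: epowr_mult epowr_ennreal powr_powr ennreal_mult mult_ac)
    also have "ennreal C0 * (ennreal (k * D powr (\<alpha> / \<beta>)) * (ennreal (Ct powr (1 / q')) * ennreal (Cs powr (1 / q) * T powr (p / q)))) = ennreal (C * T)"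
    proof -
      \<comment> \<open>Because \<alpha>/\<beta> + p/q = 1, the powers of \<open>T\<close> combine
        to the first power.\<close>
      have "D powr (\<alpha> / \<beta>) = v powr (\<alpha> / \<beta>) * T powr (\<alpha> / \<beta>)" using v T by (simp add: D_def powr_mult)
      moreover have "T powr (\<alpha> / \<beta>) * T powr (p / q) = T"
        unfolding \<beta>(2)[symmetric] using T by (simp flip: powr_add)
      ultimately have "C0 * (k * D powr (\<alpha> / \<beta>) * (Ct powr (1 / q') * (Cs powr (1 / q) * T powr (p / q)))) = C * T"
        by (simp add: C_def)
      then show ?thesis using C0 k by (simp flip: ennreal_mult)
    qed
    finally show "(\<integral>\<^sup>+ x. F x * pos_comm b \<alpha> u x \<partial>lborel) \<le> ennreal (C * T) * epowr (\<integral>\<^sup>+ x. epowr (F x) q' \<partial>lborel) (1 / q')" .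
  qed
qed

text \<open>The dual test function is F = S^(q-1), for which F^q' = S^q. Truncating S at height n
  and restricting it to the ball of radius n makes the integral Y of F^q' finite, so that Y^(1/q')
  can be divided out of the pairing bound; the result does not depend on n.\<close>

lemma pos_comm_strong:
  fixes b :: "'n::finite heis \<Rightarrow> real"
  assumes b: "bmo_bound b N" and p: "1 < p" and \<alpha>: "0 < \<alpha>" "\<alpha> < heis_dim TYPE('n) / p"
    and q: "1 / q = 1 / p - \<alpha> / heis_dim TYPE('n)"
  shows "\<exists>C>0. \<forall>u\<in>borel_measurable borel. \<forall>T>0.
    (\<integral>\<^sup>+ x. epowr (u x) p \<partial>lborel) \<le> ennreal (T powr p) \<longrightarrow>
    (\<integral>\<^sup>+ x. epowr (pos_comm b \<alpha> u x) q \<partial>lborel) \<le> ennreal ((C * T) powr q)"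
proof -
  note cb = conjugate_exponent_bounds[OF p \<alpha> q]
  have q1: "q > 1" using cb p by linarith
  define q' where "q' = q / (q - 1)"
  have q': "q' > 1" "1 / q' = 1 - 1 / q" "(q - 1) * q' = q" using q1 by (auto simp: q'_def field_simps)
  have bm [measurable]: "b \<in> borel_measurable borel" by (rule bmo_boundD[OF b])
  obtain C where C: "C > 0" "\<And>u F T. u \<in> borel_measurable borel \<Longrightarrow> F \<in> borel_measurable borel \<Longrightarrow> T > 0 \<Longrightarrow>
    (\<integral>\<^sup>+ x. epowr (u x) p \<partial>lborel) \<le> ennreal (T powr p) \<Longrightarrow>
    (\<integral>\<^sup>+ x. F x * pos_comm b \<alpha> u x \<partial>lborel) \<le>
      ennreal (C * T) * epowr (\<integral>\<^sup>+ x. epowr (F x) q' \<partial>lborel) (1 / q')"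
    using pos_comm_pairing[OF b p \<alpha> q, folded q'_def] by blast
  show ?thesis
  proof (intro exI[of _ C] conjI ballI allI impI C(1))
    fix u :: "'n heis \<Rightarrow> ennreal" and T :: real
    assume u [measurable]: "u \<in> borel_measurable borel" and T: "T > 0"
      and uT: "(\<integral>\<^sup>+ x. epowr (u x) p \<partial>lborel) \<le> ennreal (T powr p)"
    let ?S = "pos_comm b \<alpha> u"
    let ?G = "\<lambda>n x. epowr (min (?S x) (of_nat n)) q * indicator (heis_ball 0 (real n)) x"
    have trunc: "(\<integral>\<^sup>+ x. ?G n x \<partial>lborel) \<le> ennreal ((C * T) powr q)" for n
    proof -
      define F where "F x = epowr (min (?S x) (of_nat n)) (q - 1) * indicator (heis_ball 0 (real n)) x" for x
      have [measurable]: "F \<in> borel_measurable borel" unfolding F_def by measurable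
      define Y where "Y = (\<integral>\<^sup>+ x. ?G n x \<partial>lborel)"
      have "epowr (F x) q' = ?G n x" for x
        unfolding F_def epowr_mult using q' by (simp add: epowr_epowr indicator_def epowr_ennreal[of 1, simplified])
      then have FY: "(\<integral>\<^sup>+ x. epowr (F x) q' \<partial>lborel) = Y" unfolding Y_def by simp
      have "Y \<le> (\<integral>\<^sup>+ x. F x * ?S x \<partial>lborel)" unfolding Y_def
      proof (rule nn_integral_mono)
        fix x
        have "epowr (min (?S x) (of_nat n)) q = epowr (min (?S x) (of_nat n)) (q - 1) * min (?S x) (of_nat n)"
          using epowr_add[of "min (?S x) (of_nat n)" "q - 1" 1] by simp
        also have "\<dots> \<le> epowr (min (?S x) (of_nat n)) (q - 1) * ?S x" by (intro mult_left_mono) auto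
        finally show "?G n x \<le> F x * ?S x" unfolding F_def by (simp add: indicator_def)
      qed
      also have "\<dots> \<le> ennreal (C * T) * epowr Y (1 / q')"
        unfolding FY[symmetric] by (rule C(2)[OF u _ T uT]) measurable
      finally have Y: "Y \<le> ennreal (C * T) * epowr Y (1 / q')" .
      have "Y \<le> (\<integral>\<^sup>+ x. epowr (of_nat n) q * indicator (heis_ball (0::'n heis) (real n)) x \<partial>lborel)"
        unfolding Y_def using q1 by (intro nn_integral_mono mult_right_mono epowr_mono) auto
      also have "\<dots> = epowr (of_nat n) q * emeasure lborel (heis_ball (0::'n heis) (real n))"
        by (rule nn_integral_cmult_indicator) simp
      also have "\<dots> < top"
      proof -
        have "epowr (of_nat n) q < top" by (simp add: less_top[symmetric] ennreal_of_nat_eq_real_of_nat)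
        then show ?thesis
          using emeasure_heis_ball_finite[of "0::'n heis" "real n"] by (simp add: ennreal_mult_less_top)
      qed
      finally have "Y < top" .
      then obtain y where y: "Y = ennreal y" "y \<ge> 0" by (cases Y) auto
      show "Y \<le> ennreal ((C * T) powr q)"
      proof (cases "y = 0")
        case False
        then have y0: "y > 0" using y by simp
        have "y \<le> C * T * y powr (1 / q')"
          using Y y C T by (simp add: epowr_ennreal flip: ennreal_mult)
        then have "y / y powr (1 / q') \<le> C * T" using y0 by (simp add: divide_le_eq)
        also have "y / y powr (1 / q') = y powr (1 / q)"
          using y0 powr_diff[of y 1 "1 / q'"] q' by simp
        finally have "(y powr (1 / q)) powr q \<le> (C * T) powr q" using q1 by (intro powr_mono2) auto
        then show ?thesis using y0 q1 y by (simp add: powr_powr ennreal_leI)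
      qed (use y in simp)
    qed
    have "epowr (?S x) q = (SUP n. ?G n x)" for x
    proof (rule antisym)
      show "(SUP n. ?G n x) \<le> epowr (?S x) q"
        using q1 by (intro SUP_least) (auto simp: indicator_def intro!: epowr_mono)
      obtain m :: nat where m: "heis_dist 0 x < real m" using reals_Archimedean2 by blast
      have "epowr (min (?S x) (of_nat n)) q \<le> (SUP n. ?G n x)" for n :: nat
      proof -
        \<comment> \<open>One index governs both height and radius, so it has to be at least
          \<open>n\<close> and at least the radius \<open>m\<close> of a ball that contains
          \<open>x\<close>.\<close>
        have "epowr (min (?S x) (of_nat n)) q \<le> ?G (max n m) x"
          using m q1 by (auto simp: indicator_def mem_heis_ball intro!: epowr_mono min.mono)
        also have "\<dots> \<le> (SUP n. ?G n x)" by (rule SUP_upper) simp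
        finally show ?thesis .
      qed
      then have "(SUP n. epowr (min (?S x) (of_nat n)) q) \<le> (SUP n. ?G n x)" by (rule SUP_least)
      then show "epowr (?S x) q \<le> (SUP n. ?G n x)" using SUP_epowr_min[of q "?S x"] q1 by simp
    qed
    then have "(\<integral>\<^sup>+ x. epowr (?S x) q \<partial>lborel) = (\<integral>\<^sup>+ x. (SUP n. ?G n x) \<partial>lborel)" by simp
    also have "\<dots> = (SUP n. \<integral>\<^sup>+ x. ?G n x \<partial>lborel)"
    proof (rule nn_integral_monotone_convergence_SUP)
      show "incseq ?G"
        unfolding incseq_def le_fun_def
      proof (intro allI impI mult_mono epowr_mono min.mono)
        fix m n :: nat and x :: "'n heis" assume "m \<le> n"
        then show "indicator (heis_ball 0 (real m)) x \<le> (indicator (heis_ball 0 (real n)) x :: ennreal)"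
          using heis_ball_mono[of "real m" "real n" "0::'n heis"] by (auto simp: indicator_def)
      qed (use q1 in auto)
    qed measurable
    also have "\<dots> \<le> ennreal ((C * T) powr q)" by (intro SUP_least trunc)
    finally show "(\<integral>\<^sup>+ x. epowr (?S x) q \<partial>lborel) \<le> ennreal ((C * T) powr q)" .
  qed
qed

subsection \<open>Local estimates\<close>

lemma epowr_add_le:
  assumes "q > 0" shows "epowr (x + y) q \<le> ennreal (2 powr q) * (epowr x q + epowr y q)"
proof -
  have "x + y \<le> 2 * max x y" unfolding mult_2 by (intro add_mono) auto
  then have "epowr (x + y) q \<le> epowr (2 * max x y) q" using assms by (intro epowr_mono) auto
  also have "\<dots> = ennreal (2 powr q) * epowr (max x y) q"
    using epowr_ennreal[of 2 q] by (simp add: epowr_mult)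
  also have "epowr (max x y) q \<le> epowr x q + epowr y q"
    by (simp add: max_def add_increasing add_increasing2)
  finally show ?thesis by (simp add: mult_left_mono)
qed

lemma pos_comm_add:
  fixes b :: "'n::finite heis \<Rightarrow> real"
  assumes [measurable]: "b \<in> borel_measurable borel" "u \<in> borel_measurable borel" "v \<in> borel_measurable borel"
  shows "pos_comm b \<alpha> (\<lambda>h. u h + v h) x = pos_comm b \<alpha> u x + pos_comm b \<alpha> v x"
  unfolding pos_comm_def by (subst nn_integral_add[symmetric]) (auto simp: distrib_left distrib_right)

definition Lp_ball :: "real \<Rightarrow> ('n::finite heis \<Rightarrow> ennreal) \<Rightarrow> 'n heis \<Rightarrow> real \<Rightarrow> ennreal" where
  "Lp_ball p u g \<tau> = epowr (\<integral>\<^sup>+ h\<in>heis_ball g \<tau>. epowr (u h) p \<partial>lborel) (1 / p)"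

lemma Lp_ball_mono: "p > 0 \<Longrightarrow> \<tau> \<le> \<sigma> \<Longrightarrow> Lp_ball p u g \<tau> \<le> Lp_ball p u g \<sigma>"
  unfolding Lp_ball_def by (intro epowr_mono nn_set_integral_set_mono heis_ball_mono) auto

lemma borel_measurable_Lp_ball [measurable]:
  assumes [measurable]: "u \<in> borel_measurable borel"
  shows "Lp_ball p u g \<in> borel_measurable borel"
proof -
  have "(\<lambda>(\<tau>, h). epowr (u h) p * indicator (heis_ball g \<tau>) h) \<in> borel_measurable (borel \<Otimes>\<^sub>M lborel)"
    unfolding case_prod_beta by measurable
  from lborel.borel_measurable_nn_integral[OF this]
  have [measurable]: "(\<lambda>\<tau>. \<integral>\<^sup>+ h\<in>heis_ball g \<tau>. epowr (u h) p \<partial>lborel) \<in> borel_measurable borel" by simp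
  show ?thesis unfolding Lp_ball_def[abs_def] by measurable
qed

text \<open>The integral on the right of the local estimate, without its factor r^(Q/q).\<close>

definition log_integral :: "real \<Rightarrow> real \<Rightarrow> ('n::finite heis \<Rightarrow> ennreal) \<Rightarrow> 'n heis \<Rightarrow> real \<Rightarrow> ennreal" where
  "log_integral p q u g r =
    (\<integral>\<^sup>+ \<tau>\<in>{r<..}. ennreal (1 + ln (\<tau> / r)) * Lp_ball p u g \<tau> * ennreal (\<tau> powr (- (heis_dim TYPE('n) / q) - 1)) \<partial>lborel)"

text \<open>Absorbs the logarithmic drift of the averages, an additive error, into a multiplicative
  factor.\<close>

lemma add_mult_le_mult:
  fixes x y z :: real
  assumes "1 \<le> x" "0 \<le> y" "1 \<le> z" shows "x + y * z \<le> x * ((1 + y) * z)"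
proof -
  have "x * 1 \<le> x * z" "1 * (y * z) \<le> x * (y * z)"
    using assms by (intro mult_left_mono mult_right_mono; simp)+
  then show ?thesis by (simp add: algebra_simps)
qed

text \<open>The weight is centred at the average over the small ball while the integral runs over
  the large one. Recentring costs the logarithm of \<open>bmo_ravg_log\<close>; Hoelder's inequality
  with the moment of order p' on the large ball then gives the power \<tau>^(Q/p').\<close>

lemma bmo_ball_pairing:
  fixes b :: "'n::finite heis \<Rightarrow> real"
  assumes b: "bmo_bound b N" and p: "1 < p"
  shows "\<exists>C>0. \<forall>u\<in>borel_measurable borel. \<forall>g::'n heis. \<forall>r \<tau>. 0 < r \<longrightarrow> r \<le> \<tau> \<longrightarrow>
    (\<integral>\<^sup>+ h\<in>heis_ball g \<tau>. ennreal (1 + \<bar>b h - ravg b g r\<bar>) * u h \<partial>lborel)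
      \<le> ennreal (C * (1 + ln (\<tau> / r)) * \<tau> powr (heis_dim TYPE('n) * (1 - 1 / p))) * Lp_ball p u g \<tau>"
proof -
  define Q where "Q = heis_dim TYPE('n)"
  have bm [measurable]: "b \<in> borel_measurable borel" and N: "N > 0" using bmo_boundD[OF b] by auto
  define p' where "p' = p / (p - 1)"
  have p': "p' > 1" "1 / p' = 1 - 1 / p" "1 / p' + 1 / p = 1" using p by (auto simp: p'_def field_simps)
  obtain C1 where C1: "C1 > 0" "\<And>g R. R > 0 \<Longrightarrow> havg (\<lambda>h. ennreal ((1 + \<bar>b h - ravg b g R\<bar>) powr p')) g R \<le> ennreal C1"
    using bmo_moments[OF b, of p'] p' by auto
  define C2 where "C2 = 2 * 2 powr Q * N"
  have C2: "C2 > 0" using N by (simp add: C2_def)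
  have V: "heis_vol TYPE('n) > 0" by (rule heis_vol_pos)
  define C where "C = (1 + C2) * (C1 * heis_vol TYPE('n)) powr (1 / p')"
  show ?thesis
  proof (intro exI[of _ C] conjI ballI allI impI)
    show "C > 0" using C2 C1 V by (simp add: C_def)
    fix u :: "'n heis \<Rightarrow> ennreal" and g :: "'n heis" and r \<tau> :: real
    assume [measurable]: "u \<in> borel_measurable borel" and r: "0 < r" "r \<le> \<tau>"
    have \<tau>: "\<tau> > 0" using r by simp
    let ?B = "heis_ball g \<tau>" and ?l = "1 + ln (\<tau> / r)"
    have l: "?l \<ge> 1" using r by simp
    define m where "m h = ennreal (1 + \<bar>b h - ravg b g \<tau>\<bar>)" for h
    have [measurable]: "m \<in> borel_measurable borel" unfolding m_def by measurable
    have me: "epowr (m h) e = ennreal ((1 + \<bar>b h - ravg b g \<tau>\<bar>) powr e)" for h e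
      unfolding m_def by (rule epowr_ennreal) simp
    have le: "ennreal (1 + \<bar>b h - ravg b g r\<bar>) \<le> ennreal ((1 + C2) * ?l) * m h" for h
    proof -
      have "\<bar>ravg b g \<tau> - ravg b g r\<bar> \<le> C2 * ?l"
        unfolding C2_def Q_def by (rule bmo_ravg_log[OF b r])
      then have "1 + \<bar>b h - ravg b g r\<bar> \<le> 1 + \<bar>b h - ravg b g \<tau>\<bar> + C2 * ?l" by linarith
      also have "\<dots> \<le> (1 + \<bar>b h - ravg b g \<tau>\<bar>) * ((1 + C2) * ?l)"
        using C2 l by (intro add_mult_le_mult) auto
      finally have "ennreal (1 + \<bar>b h - ravg b g r\<bar>) \<le> ennreal ((1 + C2) * ?l * (1 + \<bar>b h - ravg b g \<tau>\<bar>))"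
        by (intro ennreal_leI) (simp only: mult.commute)
      also have "\<dots> = ennreal ((1 + C2) * ?l) * m h"
        unfolding m_def using C2 l by (intro ennreal_mult) auto
      finally show ?thesis .
    qed
    have ind: "epowr (w * indicator ?B x) t = epowr w t * indicator ?B x" for w t x
      by (simp add: indicator_def)
    have "(\<integral>\<^sup>+ h\<in>?B. ennreal (1 + \<bar>b h - ravg b g r\<bar>) * u h \<partial>lborel)
      \<le> (\<integral>\<^sup>+ h. ennreal ((1 + C2) * ?l) * ((m h * indicator ?B h) * (u h * indicator ?B h)) \<partial>lborel)"
    proof (rule nn_integral_mono)
      fix h
      have "ennreal (1 + \<bar>b h - ravg b g r\<bar>) * u h \<le> ennreal ((1 + C2) * ?l) * m h * u h"
        by (intro mult_right_mono le) simp
      then show "ennreal (1 + \<bar>b h - ravg b g r\<bar>) * u h * indicator ?B h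
        \<le> ennreal ((1 + C2) * ?l) * ((m h * indicator ?B h) * (u h * indicator ?B h))"
        by (cases "h \<in> ?B") (simp_all add: mult.assoc)
    qed
    also have "\<dots> = ennreal ((1 + C2) * ?l) * (\<integral>\<^sup>+ h. (m h * indicator ?B h) * (u h * indicator ?B h) \<partial>lborel)"
      by (rule nn_integral_cmult) measurable
    also have "\<dots> \<le> ennreal ((1 + C2) * ?l) * (epowr (\<integral>\<^sup>+ h. epowr (m h * indicator ?B h) p' \<partial>lborel) (1 / p')
        * epowr (\<integral>\<^sup>+ h. epowr (u h * indicator ?B h) p \<partial>lborel) (1 / p))"
      by (intro mult_left_mono holder_inequality p') measurable
    also have "\<dots> = ennreal ((1 + C2) * ?l) * (epowr (\<integral>\<^sup>+ h\<in>?B. epowr (m h) p' \<partial>lborel) (1 / p') * Lp_ball p u g \<tau>)"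
      unfolding ind Lp_ball_def ..
    also have "\<dots> \<le> ennreal ((1 + C2) * ?l) * (ennreal ((C1 * heis_vol TYPE('n)) powr (1 / p') * \<tau> powr (Q * (1 - 1 / p))) * Lp_ball p u g \<tau>)"
    proof (intro mult_left_mono mult_right_mono)
      have "(\<integral>\<^sup>+ h\<in>?B. epowr (m h) p' \<partial>lborel) = ennreal (hvol TYPE('n) \<tau>) * havg (\<lambda>h. ennreal ((1 + \<bar>b h - ravg b g \<tau>\<bar>) powr p')) g \<tau>"
        unfolding me by (rule nn_integral_heis_ball_eq_havg[OF \<tau>])
      also have "\<dots> \<le> ennreal (hvol TYPE('n) \<tau>) * ennreal C1" by (intro mult_left_mono C1(2) \<tau>) simp
      also have "\<dots> = ennreal ((C1 * heis_vol TYPE('n)) * \<tau> powr Q)"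
        using C1 V by (simp add: hvol_def Q_def mult_ac flip: ennreal_mult)
      finally have "epowr (\<integral>\<^sup>+ h\<in>?B. epowr (m h) p' \<partial>lborel) (1 / p') \<le> epowr (ennreal ((C1 * heis_vol TYPE('n)) * \<tau> powr Q)) (1 / p')"
        using p' by (intro epowr_mono) auto
      also have "\<dots> = ennreal (((C1 * heis_vol TYPE('n)) * \<tau> powr Q) powr (1 / p'))"
        using C1 V by (intro epowr_ennreal) auto
      also have "((C1 * heis_vol TYPE('n)) * \<tau> powr Q) powr (1 / p') = (C1 * heis_vol TYPE('n)) powr (1 / p') * \<tau> powr (Q * (1 - 1 / p))"
      proof -
        have "((C1 * heis_vol TYPE('n)) * \<tau> powr Q) powr (1 / p') = (C1 * heis_vol TYPE('n)) powr (1 / p') * (\<tau> powr Q) powr (1 / p')"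
          by (rule powr_mult)
        then show ?thesis unfolding powr_powr by (simp only: p'(2))
      qed
      finally show "epowr (\<integral>\<^sup>+ h\<in>?B. epowr (m h) p' \<partial>lborel) (1 / p') \<le> ennreal ((C1 * heis_vol TYPE('n)) powr (1 / p') * \<tau> powr (Q * (1 - 1 / p)))" .
    qed simp_all
    also have "\<dots> = ennreal ((1 + C2) * ?l * ((C1 * heis_vol TYPE('n)) powr (1 / p') * \<tau> powr (Q * (1 - 1 / p)))) * Lp_ball p u g \<tau>"
      using C2 l by (subst ennreal_mult[of "(1 + C2) * ?l"]) (auto simp: mult.assoc)
    also have "(1 + C2) * ?l * ((C1 * heis_vol TYPE('n)) powr (1 / p') * \<tau> powr (Q * (1 - 1 / p))) = C * ?l * \<tau> powr (Q * (1 - 1 / p))"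
      by (simp add: C_def)
    finally show "(\<integral>\<^sup>+ h\<in>?B. ennreal (1 + \<bar>b h - ravg b g r\<bar>) * u h \<partial>lborel)
      \<le> ennreal (C * ?l * \<tau> powr (heis_dim TYPE('n) * (1 - 1 / p))) * Lp_ball p u g \<tau>"
      unfolding Q_def .
  qed
qed

text \<open>Outside B(g, 2r) the kernel at \<open>x\<close> is comparable with the one at the centre
  \<open>g\<close>, which is written as d^(\<alpha> - Q) = (Q - \<alpha>) int_d^oo \<tau>^(\<alpha>
  - Q - 1) d\<tau>. Fubini's theorem then leaves the integrals over B(g, \<tau>) that
  \<open>bmo_ball_pairing\<close> bounds.\<close>

lemma pos_comm_far:
  fixes b :: "'n::finite heis \<Rightarrow> real"
  assumes b: "bmo_bound b N" and p: "1 < p" and \<alpha>: "0 < \<alpha>" "\<alpha> < heis_dim TYPE('n) / p"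
    and q: "1 / q = 1 / p - \<alpha> / heis_dim TYPE('n)"
  shows "\<exists>C>0. \<forall>u\<in>borel_measurable borel. \<forall>g. \<forall>r>0. \<forall>x\<in>heis_ball g r.
    pos_comm b \<alpha> (\<lambda>h. u h * indicator (- heis_ball g (2 * r)) h) x \<le> ennreal (C * (1 + \<bar>b x - ravg b g r\<bar>)) *
      log_integral p q u g r"
proof -
  define Q where "Q = heis_dim TYPE('n)"
  note cb = conjugate_exponent_bounds[OF p \<alpha> q, folded Q_def]
  have bm [measurable]: "b \<in> borel_measurable borel" by (rule bmo_boundD[OF b])
  obtain C1 where C1: "C1 > 0" "\<And>u g r \<tau>. u \<in> borel_measurable borel \<Longrightarrow> 0 < r \<Longrightarrow> r \<le> \<tau> \<Longrightarrow>
    (\<integral>\<^sup>+ h\<in>heis_ball g \<tau>. ennreal (1 + \<bar>b h - ravg b g r\<bar>) * u h \<partial>lborel)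
      \<le> ennreal (C1 * (1 + ln (\<tau> / r)) * \<tau> powr (Q * (1 - 1 / p))) * Lp_ball p u g \<tau>"
    using bmo_ball_pairing[OF b p, folded Q_def] by blast
  define k where "k = 2 powr (Q - \<alpha>)"
  define C where "C = k * ((Q - \<alpha>) * C1)"
  have k: "k > 0" by (simp add: k_def)
  have Q\<alpha>: "Q - \<alpha> > 0" using cb by simp
  have exps: "\<alpha> - Q - 1 + Q * (1 - 1 / p) = - (Q / q) - 1"
  proof -
    have "Q / q = Q * (1 / q)" by simp
    also have "\<dots> = Q / p - \<alpha>" using cb(1) unfolding q Q_def[symmetric] by (simp add: field_simps)
    finally show ?thesis by (simp add: algebra_simps)
  qed
  show ?thesis unfolding Q_def[symmetric]
  proof (intro exI[of _ C] conjI ballI allI impI)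
    show "C > 0" using k Q\<alpha> C1 by (simp add: C_def)
    fix u :: "'n heis \<Rightarrow> ennreal" and g :: "'n heis" and r :: real and x
    assume u [measurable]: "u \<in> borel_measurable borel" and r: "r > 0" and x: "x \<in> heis_ball g r"
    let ?I = "log_integral p q u g r"
    let ?D = "- heis_ball g (2 * r)"
    define m where "m h = ennreal (1 + \<bar>b h - ravg b g r\<bar>)" for h
    have [measurable]: "m \<in> borel_measurable borel" unfolding m_def by measurable
    define v where "v h = m h * u h * indicator ?D h" for h
    have [measurable]: "v \<in> borel_measurable borel" unfolding v_def by measurable
    let ?F = "\<lambda>h \<tau>. v h * (ennreal (Q - \<alpha>) * (ennreal (\<tau> powr (\<alpha> - Q - 1)) * indicator {heis_dist g h<..} \<tau>))"
    have bm_le: "ennreal \<bar>b x - b h\<bar> \<le> m x * m h" for h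
      unfolding m_def by (rule abs_diff_le_mult)
    have dist: "ennreal (heis_dist x h powr (\<alpha> - Q)) \<le> ennreal k * ennreal (heis_dist g h powr (\<alpha> - Q))" if "h \<in> ?D" for h
    proof -
      have h: "2 * r \<le> heis_dist g h" using that by (simp add: mem_heis_ball not_less)
      \<comment> \<open>The distance of \<open>g\<close> and \<open>x\<close> is below r, which is
        at most half of the distance of \<open>g\<close> and \<open>h\<close>.\<close>
      have "heis_dist g h / 2 \<le> heis_dist x h"
        using heis_dist_triangle[of g h x] x h by (simp add: mem_heis_ball)
      then have "heis_dist x h powr (\<alpha> - Q) \<le> (heis_dist g h / 2) powr (\<alpha> - Q)"
        using h r Q\<alpha> by (intro powr_mono2') auto
      also have "\<dots> = k * heis_dist g h powr (\<alpha> - Q)"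
        using powr_minus[of 2 "Q - \<alpha>"] by (simp add: k_def powr_divide field_simps)
      finally show ?thesis using k by (simp add: ennreal_leI flip: ennreal_mult)
    qed
    have "pos_comm b \<alpha> (\<lambda>h. u h * indicator ?D h) x \<le>
      (\<integral>\<^sup>+ h. (m x * ennreal k) * (v h * ennreal (heis_dist g h powr (\<alpha> - Q))) \<partial>lborel)"
      unfolding pos_comm_def Q_def[symmetric]
    proof (rule nn_integral_mono)
      fix h
      show "ennreal \<bar>b x - b h\<bar> * (u h * indicator ?D h) * ennreal (heis_dist x h powr (\<alpha> - Q))
        \<le> (m x * ennreal k) * (v h * ennreal (heis_dist g h powr (\<alpha> - Q)))"
      proof (cases "h \<in> ?D")
        case True
        have "ennreal \<bar>b x - b h\<bar> * u h * ennreal (heis_dist x h powr (\<alpha> - Q))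
          \<le> (m x * m h) * u h * (ennreal k * ennreal (heis_dist g h powr (\<alpha> - Q)))"
          by (intro mult_mono bm_le dist True) auto
        then show ?thesis using True by (simp add: v_def mult_ac)
      qed simp
    qed
    also have "\<dots> = (m x * ennreal k) * (\<integral>\<^sup>+ h. v h * ennreal (heis_dist g h powr (\<alpha> - Q)) \<partial>lborel)"
      by (rule nn_integral_cmult) measurable
    also have "(\<integral>\<^sup>+ h. v h * ennreal (heis_dist g h powr (\<alpha> - Q)) \<partial>lborel) =
      (\<integral>\<^sup>+ h. \<integral>\<^sup>+ \<tau>. ?F h \<tau> \<partial>lborel \<partial>lborel)"
    proof (rule nn_integral_cong)
      fix h
      show "v h * ennreal (heis_dist g h powr (\<alpha> - Q)) =
        (\<integral>\<^sup>+ \<tau>. ?F h \<tau> \<partial>lborel)"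
      proof (cases "h \<in> ?D")
        case True
        then have h: "heis_dist g h > 0" using r by (auto simp: mem_heis_ball)
        have "(\<integral>\<^sup>+ \<tau>. ennreal (\<tau> powr (\<alpha> - Q - 1)) * indicator {heis_dist g h<..} \<tau> \<partial>lborel) = ennreal (heis_dist g h powr (\<alpha> - Q) / (Q - \<alpha>))"
          using nn_integral_powr_greater[OF Q\<alpha> h] by simp
        then show ?thesis using Q\<alpha> by (simp add: nn_integral_cmult flip: ennreal_mult)
      qed (simp add: v_def)
    qed
    also have "\<dots> = (\<integral>\<^sup>+ \<tau>. \<integral>\<^sup>+ h. ?F h \<tau> \<partial>lborel \<partial>lborel)"
    proof (rule lborel_pair.Fubini'[symmetric])
      show "(\<lambda>(h, \<tau>). ?F h \<tau>) \<in> borel_measurable (lborel \<Otimes>\<^sub>M lborel)"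
        unfolding case_prod_beta indicator_def greaterThan_iff by measurable
    qed
    also have "\<dots> \<le> (\<integral>\<^sup>+ \<tau>. ennreal ((Q - \<alpha>) * C1) * ((ennreal (1 + ln (\<tau> / r)) * Lp_ball p u g \<tau> * ennreal (\<tau> powr (- (Q / q) - 1))) * indicator {r<..} \<tau>) \<partial>lborel)"
    proof (rule nn_integral_mono)
      fix \<tau> :: real
      show "(\<integral>\<^sup>+ h. ?F h \<tau> \<partial>lborel)
        \<le> ennreal ((Q - \<alpha>) * C1) * ((ennreal (1 + ln (\<tau> / r)) * Lp_ball p u g \<tau> * ennreal (\<tau> powr (- (Q / q) - 1))) * indicator {r<..} \<tau>)"
      proof (cases "\<tau> > r")
        case False
        \<comment> \<open>The points \<open>h\<close> that count lie outside B(g, 2r), so a ball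
          B(g, \<tau>) with \<tau> \<le> r contains none of them.\<close>
        have z: "?F h \<tau> = 0" for h
          using False r by (auto simp: v_def indicator_def mem_heis_ball)
        show ?thesis unfolding z by simp
      next
        case True
        then have \<tau>: "\<tau> > 0" "ln (\<tau> / r) \<ge> 0" using r by simp_all
        have "(\<integral>\<^sup>+ h. ?F h \<tau> \<partial>lborel)
          \<le> (\<integral>\<^sup>+ h. ennreal ((Q - \<alpha>) * \<tau> powr (\<alpha> - Q - 1)) * (m h * u h * indicator (heis_ball g \<tau>) h) \<partial>lborel)"
        proof (rule nn_integral_mono)
          fix h
          show "?F h \<tau>
            \<le> ennreal ((Q - \<alpha>) * \<tau> powr (\<alpha> - Q - 1)) * (m h * u h * indicator (heis_ball g \<tau>) h)"
            using Q\<alpha> by (auto simp: v_def indicator_def mem_heis_ball ennreal_mult mult_ac)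
        qed
        also have "\<dots> = ennreal ((Q - \<alpha>) * \<tau> powr (\<alpha> - Q - 1)) * (\<integral>\<^sup>+ h\<in>heis_ball g \<tau>. m h * u h \<partial>lborel)"
          by (rule nn_integral_cmult) measurable
        also have "\<dots> \<le> ennreal ((Q - \<alpha>) * \<tau> powr (\<alpha> - Q - 1)) * (ennreal (C1 * (1 + ln (\<tau> / r)) * \<tau> powr (Q * (1 - 1 / p))) * Lp_ball p u g \<tau>)"
          unfolding m_def using True r by (intro mult_left_mono C1(2)) auto
        also have "\<dots> = ennreal (((Q - \<alpha>) * \<tau> powr (\<alpha> - Q - 1)) * (C1 * (1 + ln (\<tau> / r)) * \<tau> powr (Q * (1 - 1 / p)))) * Lp_ball p u g \<tau>"
          using Q\<alpha> C1 \<tau> by (subst ennreal_mult[of "(Q - \<alpha>) * \<tau> powr (\<alpha> - Q - 1)"]) (auto simp: mult.assoc)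
        also have "((Q - \<alpha>) * \<tau> powr (\<alpha> - Q - 1)) * (C1 * (1 + ln (\<tau> / r)) * \<tau> powr (Q * (1 - 1 / p))) =
            ((Q - \<alpha>) * C1) * ((1 + ln (\<tau> / r)) * \<tau> powr (- (Q / q) - 1))"
          unfolding exps[symmetric] powr_add[of \<tau> "\<alpha> - Q - 1"] by (simp add: mult_ac)
        also have "ennreal (((Q - \<alpha>) * C1) * ((1 + ln (\<tau> / r)) * \<tau> powr (- (Q / q) - 1))) * Lp_ball p u g \<tau>
          = ennreal ((Q - \<alpha>) * C1) * (ennreal (1 + ln (\<tau> / r)) * Lp_ball p u g \<tau> * ennreal (\<tau> powr (- (Q / q) - 1)))"
        proof -
          have "ennreal (((Q - \<alpha>) * C1) * ((1 + ln (\<tau> / r)) * \<tau> powr (- (Q / q) - 1))) =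
              ennreal ((Q - \<alpha>) * C1) * (ennreal (1 + ln (\<tau> / r)) * ennreal (\<tau> powr (- (Q / q) - 1)))"
            using Q\<alpha> C1 \<tau> by (subst ennreal_mult, simp, simp, subst (2) ennreal_mult) auto
          then show ?thesis by (simp only: mult_ac)
        qed
        finally show ?thesis using True by simp
      qed
    qed
    also have "\<dots> = ennreal ((Q - \<alpha>) * C1) * ?I"
      unfolding log_integral_def Q_def by (intro nn_integral_cmult) measurable
    finally have "pos_comm b \<alpha> (\<lambda>h. u h * indicator ?D h) x \<le> m x * ennreal k * (ennreal ((Q - \<alpha>) * C1) * ?I)"
      by (simp add: mult_left_mono)
    also have "\<dots> = (ennreal k * ennreal ((Q - \<alpha>) * C1) * m x) * ?I"
      by (simp only: mult_ac)
    also have "ennreal k * ennreal ((Q - \<alpha>) * C1) * m x = ennreal (C * (1 + \<bar>b x - ravg b g r\<bar>))"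
      unfolding C_def m_def using k Q\<alpha> C1 by (subst ennreal_mult, simp, simp, subst (2) ennreal_mult) auto
    finally show "pos_comm b \<alpha> (\<lambda>h. u h * indicator ?D h) x \<le> ennreal (C * (1 + \<bar>b x - ravg b g r\<bar>)) * ?I" .
  qed
qed

text \<open>The part of \<open>u\<close> in B(g, 2r) is left to the global bound. Its norm fits into
  \<open>log_integral\<close> because \<open>Lp_ball\<close> increases with the radius: the tail
  over \<tau> > 2r alone is at least that norm times (2r)^(-Q/q) / (Q/q). For the far part the
  factor 1 + |b - b_B| of \<open>pos_comm_far\<close> is integrated by means of its q-th
  moment.\<close>

lemma pos_comm_local:
  fixes b :: "'n::finite heis \<Rightarrow> real"
  assumes b: "bmo_bound b N" and p: "1 < p" and \<alpha>: "0 < \<alpha>" "\<alpha> < heis_dim TYPE('n) / p"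
    and q: "1 / q = 1 / p - \<alpha> / heis_dim TYPE('n)"
  shows "\<exists>C>0. \<forall>u\<in>borel_measurable borel. \<forall>g. \<forall>r>0. \<forall>W>0.
    log_integral p q u g r \<le> ennreal W \<longrightarrow>
    (\<integral>\<^sup>+ x\<in>heis_ball g r. epowr (pos_comm b \<alpha> u x) q \<partial>lborel) \<le> ennreal (C * r powr heis_dim TYPE('n) * W powr q)"
proof -
  define Q where "Q = heis_dim TYPE('n)"
  note cb = conjugate_exponent_bounds[OF p \<alpha> q, folded Q_def]
  have q1: "q > 1" using cb p by linarith
  have bm [measurable]: "b \<in> borel_measurable borel" by (rule bmo_boundD[OF b])
  have V: "heis_vol TYPE('n) > 0" by (rule heis_vol_pos)
  obtain C1 where C1: "C1 > 0" "\<And>u T. u \<in> borel_measurable borel \<Longrightarrow> T > 0 \<Longrightarrow>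
    (\<integral>\<^sup>+ x. epowr (u x) p \<partial>lborel) \<le> ennreal (T powr p) \<Longrightarrow>
    (\<integral>\<^sup>+ x. epowr (pos_comm b \<alpha> u x) q \<partial>lborel) \<le> ennreal ((C1 * T) powr q)"
    using pos_comm_strong[OF b p \<alpha> q] by blast
  obtain C2 where C2: "C2 > 0" "\<And>u g r x. u \<in> borel_measurable borel \<Longrightarrow> r > 0 \<Longrightarrow> x \<in> heis_ball g r \<Longrightarrow>
    pos_comm b \<alpha> (\<lambda>h. u h * indicator (- heis_ball g (2 * r)) h) x \<le> ennreal (C2 * (1 + \<bar>b x - ravg b g r\<bar>)) *
      log_integral p q u g r"
    using pos_comm_far[OF b p \<alpha> q, folded Q_def] by blast
  obtain C3 where C3: "C3 > 0" "\<And>g R. R > 0 \<Longrightarrow> havg (\<lambda>h. ennreal ((1 + \<bar>b h - ravg b g R\<bar>) powr q)) g R \<le> ennreal C3"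
    using bmo_moments[OF b, of q] q1 by auto
  \<comment> \<open>\<open>K\<close> belongs to the near part, where C1 T = K r^(Q/q) W. In
    \<open>C\<close> the factor 2^q comes from \<open>epowr_add_le\<close> and the second summand
    from the far part.\<close>
  define K where "K = C1 * (Q / q * 2 powr (Q / q))"
  define C where "C = 2 powr q * (K powr q + C2 powr q * (heis_vol TYPE('n) * C3))"
  have Qq: "Q / q > 0" using cb q1 by simp
  have K: "K > 0" unfolding K_def using C1 Qq by (intro mult_pos_pos) auto
  show ?thesis unfolding Q_def[symmetric]
  proof (intro exI[of _ C] conjI ballI allI impI)
    show "C > 0" using K C2 C3 V unfolding C_def by (intro mult_pos_pos add_pos_pos) auto
    fix u :: "'n heis \<Rightarrow> ennreal" and g :: "'n heis" and r W :: real
    assume u [measurable]: "u \<in> borel_measurable borel" and r: "r > 0" and W: "W > 0"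
    let ?I = "log_integral p q u g r"
    assume IW: "?I \<le> ennreal W"
    let ?B = "heis_ball g r" and ?B2 = "heis_ball g (2 * r)"
    define u1 where "u1 h = u h * indicator ?B2 h" for h
    define u2 where "u2 h = u h * indicator (- ?B2) h" for h
    have [measurable]: "u1 \<in> borel_measurable borel" "u2 \<in> borel_measurable borel"
      unfolding u1_def u2_def by measurable
    \<comment> \<open>The solution of T (2r)^(-Q/q) / (Q/q) = W.\<close>
    define T where "T = W * (Q / q) * (2 * r) powr (Q / q)"
    have T: "T > 0" unfolding T_def using W Qq r by (intro mult_pos_pos) auto
    have near: "(\<integral>\<^sup>+ x. epowr (pos_comm b \<alpha> u1 x) q \<partial>lborel) \<le> ennreal ((C1 * T) powr q)"
    proof (rule C1(2)[OF _ T])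
      let ?G = "Lp_ball p u g (2 * r)" and ?c = "(2 * r) powr (- (Q / q)) / (Q / q)"
      have c: "?c > 0" by (intro divide_pos_pos) (use cb(1) q1 r in auto)
      have "?G * ennreal ?c = ?G * (\<integral>\<^sup>+ \<tau>\<in>{2 * r<..}. ennreal (\<tau> powr (- (Q / q) - 1)) \<partial>lborel)"
        using nn_integral_powr_greater[OF Qq, of "2 * r"] r by simp
      also have "\<dots> = (\<integral>\<^sup>+ \<tau>. ?G * (ennreal (\<tau> powr (- (Q / q) - 1)) * indicator {2 * r<..} \<tau>) \<partial>lborel)"
        by (rule nn_integral_cmult[symmetric]) measurable
      also have "\<dots> \<le> ?I"
        unfolding log_integral_def Q_def[symmetric]
      proof (rule nn_integral_mono)
        fix \<tau> :: real
        show "?G * (ennreal (\<tau> powr (- (Q / q) - 1)) * indicator {2 * r<..} \<tau>)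
          \<le> ennreal (1 + ln (\<tau> / r)) * Lp_ball p u g \<tau> * ennreal (\<tau> powr (- (Q / q) - 1)) * indicator {r<..} \<tau>"
        proof (cases "2 * r < \<tau>")
          case True
          have "1 * ?G \<le> ennreal (1 + ln (\<tau> / r)) * Lp_ball p u g \<tau>"
            using True r p by (intro mult_mono Lp_ball_mono) (auto simp flip: ennreal_1 intro!: ennreal_leI)
          then have "1 * ?G * ennreal (\<tau> powr (- (Q / q) - 1)) \<le> ennreal (1 + ln (\<tau> / r)) * Lp_ball p u g \<tau> * ennreal (\<tau> powr (- (Q / q) - 1))"
            by (rule mult_right_mono) simp
          then show ?thesis using True r by simp
        qed simp
      qed
      also note IW
      finally have "?G * ennreal ?c * ennreal (1 / ?c) \<le> ennreal W * ennreal (1 / ?c)" by (rule mult_right_mono) simp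
      moreover have "ennreal ?c * ennreal (1 / ?c) = 1"
        using c by (subst ennreal_mult[symmetric]) (auto simp del: divide_divide_eq_right)
      moreover have "ennreal W * ennreal (1 / ?c) = ennreal T"
      proof -
        have "W * (1 / ?c) = T" by (simp add: T_def powr_minus field_simps)
        moreover have "0 \<le> 1 / ?c" using c by (intro divide_nonneg_pos) auto
        ultimately show ?thesis using W by (metis ennreal_mult less_imp_le)
      qed
      ultimately have "?G \<le> ennreal T" by (simp add: mult.assoc)
      then have "epowr ?G p \<le> epowr (ennreal T) p" using p by (intro epowr_mono) auto
      then have "(\<integral>\<^sup>+ h\<in>?B2. epowr (u h) p \<partial>lborel) \<le> ennreal (T powr p)"
        using p T by (simp add: Lp_ball_def epowr_ennreal epowr_epowr)
      moreover have "(\<integral>\<^sup>+ h\<in>?B2. epowr (u h) p \<partial>lborel) = (\<integral>\<^sup>+ x. epowr (u1 x) p \<partial>lborel)"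
        by (intro nn_integral_cong) (simp add: u1_def indicator_def)
      ultimately show "(\<integral>\<^sup>+ x. epowr (u1 x) p \<partial>lborel) \<le> ennreal (T powr p)" by simp
    qed measurable
    have CT: "(C1 * T) powr q = K powr q * (r powr Q * W powr q)"
    proof -
      have "C1 * T = K * (r powr (Q / q) * W)" using r by (simp add: T_def K_def powr_mult)
      also have "\<dots> powr q = K powr q * ((r powr (Q / q)) powr q * W powr q)"
        using K W r by (simp add: powr_mult)
      finally show ?thesis using q1 by (simp add: powr_powr)
    qed
    define m where "m h = ennreal ((1 + \<bar>b h - ravg b g r\<bar>) powr q)" for h
    have [measurable]: "m \<in> borel_measurable borel" unfolding m_def by measurable
    have split: "epowr (pos_comm b \<alpha> u x) q * indicator ?B x \<le>
        ennreal (2 powr q) * (epowr (pos_comm b \<alpha> u1 x) q + ennreal ((C2 * W) powr q) * (m x * indicator ?B x))" for x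
    proof (cases "x \<in> ?B")
      case True
      have "u = (\<lambda>h. u1 h + u2 h)" by (auto simp: u1_def u2_def indicator_def fun_eq_iff)
      then have "pos_comm b \<alpha> u x = pos_comm b \<alpha> u1 x + pos_comm b \<alpha> u2 x"
        using pos_comm_add[of b u1 u2 \<alpha> x] by simp
      then have "epowr (pos_comm b \<alpha> u x) q \<le> ennreal (2 powr q) * (epowr (pos_comm b \<alpha> u1 x) q + epowr (pos_comm b \<alpha> u2 x) q)"
        using epowr_add_le[of q] q1 by simp
      moreover have "epowr (pos_comm b \<alpha> u2 x) q \<le> ennreal ((C2 * W) powr q) * m x"
      proof -
        have "pos_comm b \<alpha> u2 x \<le> ennreal (C2 * (1 + \<bar>b x - ravg b g r\<bar>)) * ?I"
          unfolding u2_def by (rule C2(2)[OF u r True])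
        also have "\<dots> \<le> ennreal (C2 * (1 + \<bar>b x - ravg b g r\<bar>)) * ennreal W"
          by (intro mult_left_mono IW) simp
        also have "\<dots> = ennreal ((C2 * W) * (1 + \<bar>b x - ravg b g r\<bar>))"
          using C2 W by (subst ennreal_mult[symmetric]) (auto simp: mult_ac)
        finally have "epowr (pos_comm b \<alpha> u2 x) q \<le> epowr (ennreal ((C2 * W) * (1 + \<bar>b x - ravg b g r\<bar>))) q"
          using q1 by (intro epowr_mono) auto
        also have "\<dots> = ennreal (((C2 * W) * (1 + \<bar>b x - ravg b g r\<bar>)) powr q)"
          using C2 W by (intro epowr_ennreal) auto
        also have "((C2 * W) * (1 + \<bar>b x - ravg b g r\<bar>)) powr q = (C2 * W) powr q * (1 + \<bar>b x - ravg b g r\<bar>) powr q"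
          by (rule powr_mult)
        also have "ennreal \<dots> = ennreal ((C2 * W) powr q) * m x"
          unfolding m_def by (intro ennreal_mult) auto
        finally show ?thesis .
      qed
      ultimately have "epowr (pos_comm b \<alpha> u x) q \<le> ennreal (2 powr q) * (epowr (pos_comm b \<alpha> u1 x) q + ennreal ((C2 * W) powr q) * m x)"
        by (meson add_left_mono mult_left_mono order_trans zero_le)
      then show ?thesis using True by simp
    qed simp
    have "(\<integral>\<^sup>+ x\<in>?B. epowr (pos_comm b \<alpha> u x) q \<partial>lborel)
      \<le> (\<integral>\<^sup>+ x. ennreal (2 powr q) * (epowr (pos_comm b \<alpha> u1 x) q + ennreal ((C2 * W) powr q) * (m x * indicator ?B x)) \<partial>lborel)"
      by (intro nn_integral_mono split)
    also have "\<dots> = ennreal (2 powr q) * ((\<integral>\<^sup>+ x. epowr (pos_comm b \<alpha> u1 x) q \<partial>lborel)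
        + ennreal ((C2 * W) powr q) * (\<integral>\<^sup>+ x\<in>?B. m x \<partial>lborel))"
      by (simp add: nn_integral_cmult nn_integral_add)
    also have "\<dots> \<le> ennreal (2 powr q) * (ennreal ((C1 * T) powr q) + ennreal ((C2 * W) powr q) * (ennreal (hvol TYPE('n) r) * ennreal C3))"
    proof (intro mult_left_mono add_mono near)
      show "(\<integral>\<^sup>+ x\<in>?B. m x \<partial>lborel) \<le> ennreal (hvol TYPE('n) r) * ennreal C3"
        unfolding nn_integral_heis_ball_eq_havg[OF r] m_def by (intro mult_left_mono C3(2) r) simp
    qed simp_all
    also have "\<dots> = ennreal (2 powr q * ((C1 * T) powr q + (C2 * W) powr q * (hvol TYPE('n) r * C3)))"
      using hvol_pos[OF r, where 'n='n] C3 by (simp add: less_imp_le flip: ennreal_mult ennreal_plus)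
    also have "2 powr q * ((C1 * T) powr q + (C2 * W) powr q * (hvol TYPE('n) r * C3)) = C * r powr Q * W powr q"
      unfolding CT using C2 W by (simp add: C_def hvol_def Q_def powr_mult algebra_simps)
    finally show "(\<integral>\<^sup>+ x\<in>?B. epowr (pos_comm b \<alpha> u x) q \<partial>lborel) \<le> ennreal (C * r powr Q * W powr q)" .
  qed
qed

subsection \<open>Borel representatives\<close>

text \<open>
  The operators at a point \<open>g\<close> depend on \<open>b g\<close> and on the almost everywhere classes of \<open>b\<close> and \<open>f\<close>,
  so passing to Borel representatives changes them on a null set only.
\<close>

lemma Lp_loc_borel_rep:
  assumes "f \<in> Lp_loc p"
  obtains f' where "f' \<in> borel_measurable borel" "AE x in lborel. f x = f' x"
  using assms completion_ex_borel_measurable_real[of f lborel] by (auto simp: Lp_loc_def)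

text \<open>Completeness of \<open>lebesgue\<close> makes \<open>f\<close> measurable, after which
  the integrals are compared almost everywhere.\<close>

lemma LINT_lebesgue_borel_rep:
  fixes f f' :: "'a::euclidean_space \<Rightarrow> real"
  assumes f': "f' \<in> borel_measurable borel" and ae: "AE x in lborel. f x = f' x" and A: "A \<in> sets borel"
  shows "(LINT h:A|lebesgue. f h) = (LINT h:A|lborel. f' h)"
proof -
  have [measurable]: "f' \<in> borel_measurable lborel" "A \<in> sets lborel" using f' A by auto
  have m: "(\<lambda>h. indicator A h *\<^sub>R f' h) \<in> borel_measurable lborel" by measurable
  have ae': "AE h in lebesgue. f' h = f h" using AE_completion[OF ae] by eventually_elim simp
  have "f \<in> borel_measurable lebesgue"
    by (rule borel_measurable_AE[OF measurable_completion ae']) (use f' in simp)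
  moreover have "A \<in> sets lebesgue" using A by simp
  ultimately have "(\<lambda>h. indicator A h *\<^sub>R f h) \<in> borel_measurable lebesgue"
    by (intro borel_measurable_scaleR borel_measurable_indicator)
  then have "(LINT h:A|lebesgue. f h) = integral\<^sup>L lebesgue (\<lambda>h. indicator A h *\<^sub>R f' h)"
    unfolding set_lebesgue_integral_def
    by (intro integral_cong_AE measurable_completion[OF m]) (use ae' in \<open>auto elim: eventually_mono\<close>)
  then show ?thesis unfolding set_lebesgue_integral_def integral_completion[OF m] .
qed

lemma measure_lebesgue_heis_ball:
  "r > 0 \<Longrightarrow> measure lebesgue (heis_ball (g::'n::finite heis) r) = hvol TYPE('n) r"
  "r > 0 \<Longrightarrow> measure lborel (heis_ball (g::'n::finite heis) r) = hvol TYPE('n) r"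
  by (simp_all add: measure_heis_ball hvol_def)

text \<open>Local integrability, applied to the closure of the ball, ensures that the real integral
  is not the default 0, so that real norms can be computed by integrals in [0, infinity].\<close>

lemma nn_integral_heis_ball_Lp_loc:
  fixes f :: "'n::finite heis \<Rightarrow> real"
  assumes f: "f \<in> Lp_loc p"
  shows "(\<integral>\<^sup>+ h\<in>heis_ball g r. ennreal (\<bar>f h\<bar> powr p) \<partial>lborel) = ennreal (LINT h:heis_ball g r|lebesgue. \<bar>f h\<bar> powr p)"
    "set_integrable lebesgue (heis_ball g r) (\<lambda>h. \<bar>f h\<bar> powr p)"
proof -
  let ?B = "heis_ball g r"
  have "compact (closure ?B)" using bounded_heis_ball by (simp add: compact_closure)
  then have "set_integrable lebesgue (closure ?B) (\<lambda>h. \<bar>f h\<bar> powr p)" using f by (simp add: Lp_loc_def)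
  then show int: "set_integrable lebesgue ?B (\<lambda>h. \<bar>f h\<bar> powr p)"
    by (rule set_integrable_subset) (auto simp: closure_subset)
  have "(\<integral>\<^sup>+ h\<in>?B. ennreal (\<bar>f h\<bar> powr p) \<partial>lborel) = (\<integral>\<^sup>+ h. ennreal (indicator ?B h * \<bar>f h\<bar> powr p) \<partial>lebesgue)"
    unfolding nn_integral_completion by (intro nn_integral_cong) (simp add: indicator_def)
  also have "\<dots> = ennreal (LINT h:?B|lebesgue. \<bar>f h\<bar> powr p)"
    using int unfolding set_lebesgue_integral_def set_integrable_def
    by (subst nn_integral_eq_integral) auto
  finally show "(\<integral>\<^sup>+ h\<in>?B. ennreal (\<bar>f h\<bar> powr p) \<partial>lborel) = ennreal (LINT h:?B|lebesgue. \<bar>f h\<bar> powr p)" .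
qed

lemma BMO_imp_bmo_bound:
  fixes b :: "'n::finite heis \<Rightarrow> real"
  assumes b: "b \<in> BMO" and b': "b' \<in> borel_measurable borel" "AE x in lborel. b x = b' x"
  shows "\<exists>N. bmo_bound b' N"
proof -
  \<comment> \<open>The summand 1 keeps \<open>N\<close> positive for a function of norm 0.\<close>
  define N where "N = enn2real (BMO_norm b) + 1"
  have fin: "BMO_norm b < top" and loc: "b \<in> Lp_loc 1" using b by (auto simp: BMO_def)
  have NN: "BMO_norm b \<le> ennreal N" "N > 0"
    using fin by (cases "BMO_norm b"; simp add: N_def ennreal_leI add_nonneg_pos)+
  have [measurable]: "b' \<in> borel_measurable lborel" using b' by simp
  have int: "set_integrable lborel (heis_ball g r) b'" for g r
    unfolding set_integrable_def
  proof (rule integrableI_bounded)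
    show "(\<lambda>x. indicator (heis_ball g r) x *\<^sub>R b' x) \<in> borel_measurable lborel" by measurable
    have "(\<integral>\<^sup>+ x. ennreal (norm (indicator (heis_ball g r) x *\<^sub>R b' x)) \<partial>lborel) = (\<integral>\<^sup>+ h\<in>heis_ball g r. ennreal (\<bar>b h\<bar> powr 1) \<partial>lborel)"
      by (intro nn_integral_cong_AE, use b'(2) in eventually_elim) (simp add: indicator_def)
    also have "\<dots> < \<infinity>" unfolding nn_integral_heis_ball_Lp_loc(1)[OF loc] by simp
    finally show "(\<integral>\<^sup>+ x. ennreal (norm (indicator (heis_ball g r) x *\<^sub>R b' x)) \<partial>lborel) < \<infinity>" .
  qed
  have "havg (\<lambda>h. ennreal \<bar>b' h - ravg b' g r\<bar>) g r \<le> ennreal N" if r: "r > 0" for g r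
  proof -
    let ?B = "heis_ball g r" and ?c = "ravg b' g r"
    have V: "hvol TYPE('n) r > 0" using r by simp
    have c: "heis_avg b g r = ?c"
      unfolding heis_avg_def ravg_def using LINT_lebesgue_borel_rep[OF b'] r by (simp add: measure_lebesgue_heis_ball)
    have "(LINT h:?B|lebesgue. \<bar>b h - heis_avg b g r\<bar>) = (LINT h:?B|lborel. \<bar>b' h - ?c\<bar>)"
      unfolding c
    proof (rule LINT_lebesgue_borel_rep)
      show "AE x in lborel. \<bar>b x - ?c\<bar> = \<bar>b' x - ?c\<bar>" using b'(2) by eventually_elim simp
    qed (use b'(1) in measurable)
    then have "ennreal ((LINT h:?B|lborel. \<bar>b' h - ?c\<bar>) / hvol TYPE('n) r) \<le> BMO_norm b"
      unfolding BMO_norm_def using r by (intro SUP_upper2[of g] SUP_upper2[of r]) (auto simp: measure_lebesgue_heis_ball)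
    moreover have "havg (\<lambda>h. ennreal \<bar>b' h - ?c\<bar>) g r = ennreal ((LINT h:?B|lborel. \<bar>b' h - ?c\<bar>) / hvol TYPE('n) r)"
    proof -
      have "set_integrable lborel ?B (\<lambda>h. \<bar>b' h - ?c\<bar>)"
        by (intro set_integrable_abs set_integral_diff int set_integrable_const_heis_ball)
      then have i: "integrable lborel (\<lambda>h. indicator ?B h * \<bar>b' h - ?c\<bar>)" by (simp add: set_integrable_def)
      have "(\<integral>\<^sup>+ h\<in>?B. ennreal \<bar>b' h - ?c\<bar> \<partial>lborel) = (\<integral>\<^sup>+ h. ennreal (indicator ?B h * \<bar>b' h - ?c\<bar>) \<partial>lborel)"
        by (intro nn_integral_cong) (simp add: indicator_def)
      also have "\<dots> = ennreal (LINT h:?B|lborel. \<bar>b' h - ?c\<bar>)"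
        using i by (simp add: nn_integral_eq_integral set_lebesgue_integral_def)
      finally have "havg (\<lambda>h. ennreal \<bar>b' h - ?c\<bar>) g r = ennreal (1 / hvol TYPE('n) r) * ennreal (LINT h:?B|lborel. \<bar>b' h - ?c\<bar>)"
        by (simp add: havg_def)
      also have "\<dots> = ennreal (1 / hvol TYPE('n) r * (LINT h:?B|lborel. \<bar>b' h - ?c\<bar>))"
        using V by (intro ennreal_mult[symmetric]) (auto simp: set_lebesgue_integral_def)
      finally show ?thesis by simp
    qed
    ultimately show ?thesis using NN(1) by simp
  qed
  then show ?thesis using b'(1) NN(2) int unfolding bmo_bound_def by blast
qed

section \<open>Domination of both commutators by the positive one\<close>

lemma max_commutator_cong_AE:
  fixes b :: "'n::finite heis \<Rightarrow> real"
  assumes "AE h in lborel. b h = b' h" "AE h in lborel. f h = f' h" "b g = b' g"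
  shows "max_commutator b \<alpha> f g = max_commutator b' \<alpha> f' g"
proof -
  have "(\<integral>\<^sup>+ h\<in>heis_ball g r. ennreal (\<bar>b g - b h\<bar> * \<bar>f h\<bar>) \<partial>lebesgue) =
      (\<integral>\<^sup>+ h\<in>heis_ball g r. ennreal (\<bar>b' g - b' h\<bar> * \<bar>f' h\<bar>) \<partial>lebesgue)" for r
    unfolding nn_integral_completion
    by (intro nn_integral_cong_AE, use assms(1,2) in eventually_elim) (simp add: assms(3))
  then show ?thesis by (simp add: max_commutator_def)
qed

text \<open>The volume factor decreases in the radius because \<alpha> < Q, which is the
  monotonicity that \<open>borel_measurable_SUP_heis_ball\<close> asks for.\<close>

lemma borel_measurable_max_commutator:
  fixes b f :: "'n::finite heis \<Rightarrow> real"
  assumes [measurable]: "b \<in> borel_measurable borel" "f \<in> borel_measurable borel" and \<alpha>: "\<alpha> < heis_dim TYPE('n)"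
  shows "max_commutator b \<alpha> f \<in> borel_measurable borel"
proof -
  let ?e = "- 1 + \<alpha> / heis_dim TYPE('n)"
  have e: "?e \<le> 0" using \<alpha> heis_dim_pos[where 'n='n] by simp
  have "max_commutator b \<alpha> f = (\<lambda>g. SUP r\<in>{0<..}. ennreal (hvol TYPE('n) r powr ?e)
       * (\<integral>\<^sup>+ h\<in>heis_ball g r. ennreal (\<bar>b g - b h\<bar> * \<bar>f h\<bar>) \<partial>lborel))"
    unfolding max_commutator_def[abs_def] nn_integral_completion
    by (intro ext SUP_cong refl) (simp add: measure_lebesgue_heis_ball)
  also have "\<dots> \<in> borel_measurable borel"
  proof (rule borel_measurable_SUP_heis_ball)
    show "ennreal (hvol TYPE('n) s powr ?e) \<le> ennreal (hvol TYPE('n) r powr ?e)" if "0 < r" "r \<le> s" for r s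
      using that e by (intro ennreal_leI powr_mono2' hvol_mono) auto
  qed measurable
  finally show ?thesis .
qed

text \<open>The volume factor is a multiple of r^(\<alpha> - Q), and since this exponent is negative
  it is at most d(g, h)^(\<alpha> - Q) for the points h of B(g, r) other than g.\<close>

lemma max_commutator_le_pos_comm:
  fixes b f :: "'n::finite heis \<Rightarrow> real"
  assumes [measurable]: "b \<in> borel_measurable borel" "f \<in> borel_measurable borel" and \<alpha>: "\<alpha> < heis_dim TYPE('n)"
  shows "max_commutator b \<alpha> f g \<le> ennreal (heis_vol TYPE('n) powr (- 1 + \<alpha> / heis_dim TYPE('n))) * pos_comm b \<alpha> (\<lambda>h. ennreal \<bar>f h\<bar>) g"
proof -
  define Q where "Q = heis_dim TYPE('n)"
  have Q: "Q > 0" unfolding Q_def by (rule heis_dim_pos)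
  let ?e = "- 1 + \<alpha> / Q" and ?k = "heis_vol TYPE('n) powr (- 1 + \<alpha> / heis_dim TYPE('n))"
  show ?thesis unfolding max_commutator_def nn_integral_completion
  proof (rule SUP_least)
    fix r :: real assume "r \<in> {0<..}"
    then have r: "r > 0" by simp
    have "measure lebesgue (heis_ball g r) powr ?e = ?k * r powr (\<alpha> - Q)"
    proof -
      have "Q * ?e = \<alpha> - Q" using Q by (simp add: algebra_simps)
      then show ?thesis using r by (simp add: measure_lebesgue_heis_ball hvol_def powr_mult powr_powr flip: Q_def)
    qed
    then have "ennreal (measure lebesgue (heis_ball g r) powr ?e) * (\<integral>\<^sup>+ h\<in>heis_ball g r. ennreal (\<bar>b g - b h\<bar> * \<bar>f h\<bar>) \<partial>lborel) =
      ennreal ?k * (ennreal (r powr (\<alpha> - Q)) * (\<integral>\<^sup>+ h\<in>heis_ball g r. ennreal (\<bar>b g - b h\<bar> * \<bar>f h\<bar>) \<partial>lborel))"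
      by (simp add: ennreal_mult mult.assoc)
    also have "ennreal (r powr (\<alpha> - Q)) * (\<integral>\<^sup>+ h\<in>heis_ball g r. ennreal (\<bar>b g - b h\<bar> * \<bar>f h\<bar>) \<partial>lborel) =
      (\<integral>\<^sup>+ h. ennreal (r powr (\<alpha> - Q)) * (ennreal (\<bar>b g - b h\<bar> * \<bar>f h\<bar>) * indicator (heis_ball g r) h) \<partial>lborel)"
      by (rule nn_integral_cmult[symmetric]) measurable
    also have "\<dots> \<le> pos_comm b \<alpha> (\<lambda>h. ennreal \<bar>f h\<bar>) g"
      unfolding pos_comm_def Q_def[symmetric]
    proof (rule nn_integral_mono)
      fix h
      show "ennreal (r powr (\<alpha> - Q)) * (ennreal (\<bar>b g - b h\<bar> * \<bar>f h\<bar>) * indicator (heis_ball g r) h)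
        \<le> ennreal \<bar>b g - b h\<bar> * ennreal \<bar>f h\<bar> * ennreal (heis_dist g h powr (\<alpha> - Q))"
      \<comment> \<open>At h = g the kernel is 0 by \<open>0 powr a = 0\<close>, but there the
        factor |b(g) - b(h)| vanishes as well.\<close>
      proof (cases "h \<in> heis_ball g r \<and> h \<noteq> g")
        case True
        then have "0 < heis_dist g h" "heis_dist g h < r"
          by (auto simp: mem_heis_ball heis_dist_eq_0_iff less_le)
        then have "r powr (\<alpha> - Q) \<le> heis_dist g h powr (\<alpha> - Q)"
          using \<alpha> by (intro powr_mono2') (auto simp: Q_def)
        then have "ennreal (\<bar>b g - b h\<bar> * \<bar>f h\<bar>) * ennreal (r powr (\<alpha> - Q)) \<le> ennreal (\<bar>b g - b h\<bar> * \<bar>f h\<bar>) * ennreal (heis_dist g h powr (\<alpha> - Q))"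
          by (intro mult_left_mono ennreal_leI) auto
        then show ?thesis using True by (simp add: ennreal_mult mult_ac)
      qed auto
    qed
    finally show "ennreal (measure lebesgue (heis_ball g r) powr (- 1 + \<alpha> / heis_dim TYPE('n))) * (\<integral>\<^sup>+ h\<in>heis_ball g r. ennreal (\<bar>b g - b h\<bar> * \<bar>f h\<bar>) \<partial>lborel)
      \<le> ennreal ?k * pos_comm b \<alpha> (\<lambda>h. ennreal \<bar>f h\<bar>) g"
      unfolding Q_def by (simp add: mult_left_mono)
  qed
qed

lemma riesz_commutator_kernel_eq:
  fixes b f :: "'n::finite heis \<Rightarrow> real"
  shows "riesz_commutator_kernel b \<alpha> f g h = (b g - b h) * f h * heis_dist g h powr (\<alpha> - heis_dim TYPE('n))"
  unfolding riesz_commutator_kernel_def heis_dist_def[symmetric]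
  using powr_minus_divide[of "heis_dist g h" "heis_dim TYPE('n) - \<alpha>"] by simp

lemma borel_measurable_riesz_commutator_kernel:
  fixes b f :: "'n::finite heis \<Rightarrow> real"
  assumes [measurable]: "b \<in> borel_measurable borel" "f \<in> borel_measurable borel"
  shows "riesz_commutator_kernel b \<alpha> f g \<in> borel_measurable borel"
  unfolding riesz_commutator_kernel_eq[abs_def] by measurable

lemma nn_integral_riesz_commutator_kernel:
  fixes b f :: "'n::finite heis \<Rightarrow> real"
  shows "(\<integral>\<^sup>+ h. ennreal \<bar>riesz_commutator_kernel b \<alpha> f g h\<bar> \<partial>lborel) = pos_comm b \<alpha> (\<lambda>h. ennreal \<bar>f h\<bar>) g"
  unfolding pos_comm_def riesz_commutator_kernel_eq
  by (intro nn_integral_cong) (simp add: abs_mult ennreal_mult)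

lemma riesz_commutator_kernel_rep:
  fixes b f :: "'n::finite heis \<Rightarrow> real"
  assumes b': "b' \<in> borel_measurable borel" "AE h in lborel. b h = b' h"
    and f': "f' \<in> borel_measurable borel" "AE h in lborel. f h = f' h" and g: "b g = b' g"
  shows "integrable lebesgue (riesz_commutator_kernel b \<alpha> f g) \<longleftrightarrow> integrable lborel (riesz_commutator_kernel b' \<alpha> f' g)"
    "riesz_commutator b \<alpha> f g = integral\<^sup>L lborel (riesz_commutator_kernel b' \<alpha> f' g)"
proof -
  let ?k = "riesz_commutator_kernel b \<alpha> f g" and ?k' = "riesz_commutator_kernel b' \<alpha> f' g"
  have ae: "AE h in lborel. ?k' h = ?k h"
    using b'(2) f'(2) by eventually_elim (simp add: riesz_commutator_kernel_def g)
  have m: "?k' \<in> borel_measurable lborel"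
    using borel_measurable_riesz_commutator_kernel[OF b'(1) f'(1)] by simp
  have m': "?k \<in> borel_measurable lebesgue"
    by (rule borel_measurable_AE[OF measurable_completion[OF m] AE_completion[OF ae]])
  show "integrable lebesgue ?k \<longleftrightarrow> integrable lborel ?k'"
    using integrable_cong_AE[OF m' measurable_completion[OF m]] AE_completion[OF ae] integrable_completion[OF m]
    by (simp add: eq_commute)
  show "riesz_commutator b \<alpha> f g = integral\<^sup>L lborel ?k'"
    unfolding riesz_commutator_def
    using integral_cong_AE[OF m' measurable_completion[OF m]] AE_completion[OF ae] integral_completion[OF m]
    by (simp add: eq_commute)
qed

text \<open>A kernel that is not integrable has integral 0 by convention; otherwise this is the
  triangle inequality for integrals.\<close>

lemma abs_riesz_commutator_le:
  fixes b f :: "'n::finite heis \<Rightarrow> real"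
  shows "ennreal \<bar>integral\<^sup>L lborel (riesz_commutator_kernel b \<alpha> f g)\<bar> \<le> pos_comm b \<alpha> (\<lambda>h. ennreal \<bar>f h\<bar>) g"
proof (cases "integrable lborel (riesz_commutator_kernel b \<alpha> f g)")
  case True
  from integral_norm_bound_ennreal[OF this] show ?thesis
    by (simp add: nn_integral_riesz_commutator_kernel)
qed (simp add: not_integrable_integral_eq)

lemma borel_measurable_integral_riesz_commutator_kernel:
  fixes b f :: "'n::finite heis \<Rightarrow> real"
  assumes [measurable]: "b \<in> borel_measurable borel" "f \<in> borel_measurable borel"
  shows "(\<lambda>g. integral\<^sup>L lborel (riesz_commutator_kernel b \<alpha> f g)) \<in> borel_measurable borel"
proof -
  have "(\<lambda>(g, h). riesz_commutator_kernel b \<alpha> f g h) \<in> borel_measurable (borel \<Otimes>\<^sub>M lborel)"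
    unfolding case_prod_beta riesz_commutator_kernel_eq by measurable
  from lborel.borel_measurable_lebesgue_integral[OF this] show ?thesis by simp
qed

subsection \<open>Generalized Morrey norms\<close>

lemma morrey_Lp_ball_le:
  fixes f :: "'n::finite heis \<Rightarrow> real"
  assumes f: "f \<in> Lp_loc p" "morrey_norm p \<phi> f \<le> ennreal T" and p: "p > 0" and r: "r > 0" and T: "T \<ge> 0" and \<phi>: "\<phi> g r > 0"
  shows "Lp_ball p (\<lambda>h. ennreal \<bar>f h\<bar>) g r \<le> ennreal (T * \<phi> g r * hvol TYPE('n) r powr (1 / p))"
proof -
  have V: "hvol TYPE('n) r > 0" using r by simp
  have L: "Lp_norm_on p (heis_ball g r) f \<ge> 0" by (simp add: Lp_norm_on_def)
  have "ennreal (inverse (\<phi> g r) * measure lebesgue (heis_ball g r) powr (- 1 / p) * Lp_norm_on p (heis_ball g r) f) \<le> morrey_norm p \<phi> f"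
    unfolding morrey_norm_def using r by (intro SUP_upper2[of g] SUP_upper2[of r]) auto
  also note f(2)
  finally have "inverse (\<phi> g r) * hvol TYPE('n) r powr (- 1 / p) * Lp_norm_on p (heis_ball g r) f \<le> T"
    using T r by (simp add: measure_lebesgue_heis_ball)
  then have "Lp_norm_on p (heis_ball g r) f \<le> T * \<phi> g r * hvol TYPE('n) r powr (1 / p)"
    using \<phi> V by (simp add: powr_minus field_simps)
  moreover have "Lp_ball p (\<lambda>h. ennreal \<bar>f h\<bar>) g r = ennreal (Lp_norm_on p (heis_ball g r) f)"
  proof -
    have "Lp_ball p (\<lambda>h. ennreal \<bar>f h\<bar>) g r = epowr (ennreal (LINT h:heis_ball g r|lebesgue. \<bar>f h\<bar> powr p)) (1 / p)"
      unfolding Lp_ball_def nn_integral_heis_ball_Lp_loc(1)[OF f(1), symmetric] by (simp add: epowr_ennreal)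
    also have "\<dots> = ennreal (Lp_norm_on p (heis_ball g r) f)"
      unfolding Lp_norm_on_def by (rule epowr_ennreal) (simp add: set_lebesgue_integral_def)
    finally show ?thesis .
  qed
  ultimately show ?thesis by (simp add: ennreal_leI)
qed

text \<open>Membership in \<open>Lp_loc\<close> comes first, since it turns the real integrals in
  the norm into those of the hypothesis. Compact sets are enclosed in balls around 0.\<close>

lemma morrey_normI:
  fixes F :: "'n::finite heis \<Rightarrow> real"
  assumes F: "F \<in> borel_measurable lebesgue" and q: "q > 0" and K: "K \<ge> 0" and \<phi>: "\<And>g r. r > 0 \<Longrightarrow> \<phi> g r > 0"
    and bound: "\<And>g r. r > 0 \<Longrightarrow>
      (\<integral>\<^sup>+ h\<in>heis_ball g r. ennreal (\<bar>F h\<bar> powr q) \<partial>lborel) \<le> ennreal ((K * \<phi> g r) powr q * hvol TYPE('n) r)"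
  shows "F \<in> Lp_loc q" "morrey_norm q \<phi> F \<le> ennreal K"
proof -
  show loc: "F \<in> Lp_loc q"
    unfolding Lp_loc_def
  proof (intro CollectI conjI F allI impI)
    fix C :: "'n heis set" assume C: "compact C"
    obtain r where r: "r > 0" "C \<subseteq> heis_ball 0 r" using compact_subset_heis_ball[OF C] .
    have Cs: "C \<in> sets lebesgue" using C by (intro lmeasurable_compact[THEN fmeasurableD])
    show "set_integrable lebesgue C (\<lambda>h. \<bar>F h\<bar> powr q)"
      unfolding set_integrable_def
    proof (rule integrableI_bounded)
      show "(\<lambda>x. indicator C x *\<^sub>R \<bar>F x\<bar> powr q) \<in> borel_measurable lebesgue"
        using F Cs by measurable
      have "(\<integral>\<^sup>+ x. ennreal (norm (indicator C x *\<^sub>R \<bar>F x\<bar> powr q)) \<partial>lebesgue) \<le> (\<integral>\<^sup>+ h\<in>heis_ball 0 r. ennreal (\<bar>F h\<bar> powr q) \<partial>lborel)"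
        unfolding nn_integral_completion using r(2) by (intro nn_integral_mono) (auto simp: indicator_def dest: subsetD)
      also have "\<dots> < \<infinity>" using bound[OF r(1), of 0] by (auto intro: order.strict_trans1)
      finally show "(\<integral>\<^sup>+ x. ennreal (norm (indicator C x *\<^sub>R \<bar>F x\<bar> powr q)) \<partial>lebesgue) < \<infinity>" .
    qed
  qed
  show "morrey_norm q \<phi> F \<le> ennreal K"
    unfolding morrey_norm_def
  proof (intro SUP_least ennreal_leI)
    fix g :: "'n heis" and r :: real assume "r \<in> {0<..}"
    then have r: "r > 0" by simp
    have V: "hvol TYPE('n) r > 0" using r by simp
    let ?L = "LINT h:heis_ball g r|lebesgue. \<bar>F h\<bar> powr q"
    have L0: "?L \<ge> 0" by (simp add: set_lebesgue_integral_def)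
    have "ennreal ?L \<le> ennreal ((K * \<phi> g r) powr q * hvol TYPE('n) r)"
      using bound[OF r, of g] unfolding nn_integral_heis_ball_Lp_loc(1)[OF loc] .
    then have "?L \<le> (K * \<phi> g r) powr q * hvol TYPE('n) r" using V by (subst (asm) ennreal_le_iff) auto
    then have "?L powr (1 / q) \<le> ((K * \<phi> g r) powr q * hvol TYPE('n) r) powr (1 / q)"
      using L0 q by (intro powr_mono2) auto
    also have "\<dots> = K * \<phi> g r * hvol TYPE('n) r powr (1 / q)"
      using K \<phi>[OF r, of g] q by (simp add: powr_mult powr_powr less_imp_le)
    finally have "Lp_norm_on q (heis_ball g r) F \<le> K * \<phi> g r * hvol TYPE('n) r powr (1 / q)"
      unfolding Lp_norm_on_def .
    then have le: "Lp_norm_on q (heis_ball g r) F \<le> K * (\<phi> g r * hvol TYPE('n) r powr (1 / q))"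
      by (simp add: mult.assoc)
    have W: "\<phi> g r * hvol TYPE('n) r powr (1 / q) > 0" using \<phi>[OF r, of g] V by simp
    have "inverse (\<phi> g r) * measure lebesgue (heis_ball g r) powr (- 1 / q) * Lp_norm_on q (heis_ball g r) F
        = Lp_norm_on q (heis_ball g r) F / (\<phi> g r * hvol TYPE('n) r powr (1 / q))"
      using r by (simp add: measure_lebesgue_heis_ball powr_minus field_simps)
    also have "\<dots> \<le> K" using le unfolding pos_divide_le_eq[OF W] .
    finally show "inverse (\<phi> g r) * measure lebesgue (heis_ball g r) powr (- 1 / q) * Lp_norm_on q (heis_ball g r) F \<le> K" .
  qed
qed

text \<open>A positive real \<open>T\<close> stands for the Morrey norm of \<open>f\<close>, which
  may vanish, and \<open>f'\<close> for a Borel representative; \<open>K\<close> depends on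
  neither.\<close>

lemma pos_comm_morrey:
  fixes b :: "'n::finite heis \<Rightarrow> real" and \<phi>\<^sub>1 \<phi>\<^sub>2 :: "'n heis \<Rightarrow> real \<Rightarrow> real"
  assumes b: "bmo_bound b N" and p: "1 < p" and \<alpha>: "0 < \<alpha>" "\<alpha> < heis_dim TYPE('n) / p"
    and q: "1 / q = 1 / p - \<alpha> / heis_dim TYPE('n)"
    and \<phi>: "\<And>g r. r > 0 \<Longrightarrow> \<phi>\<^sub>1 g r > 0" "\<And>g r. r > 0 \<Longrightarrow> \<phi>\<^sub>2 g r > 0"
    and C: "\<And>g r. r > 0 \<Longrightarrow>
      (\<integral>\<^sup>+ \<tau>\<in>{r<..}. ennreal (1 + ln (\<tau> / r))
          * (ess_inf (lebesgue_on {\<tau><..}) (\<lambda>s. ennreal (\<phi>\<^sub>1 g s * s powr (heis_dim TYPE('n) / p)))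
             / ennreal (\<tau> powr (heis_dim TYPE('n) / q + 1))) \<partial>lebesgue)
        \<le> ennreal (C * \<phi>\<^sub>2 g r)"
  obtains K where "K > 0" and "\<And>f f' T g r. f \<in> Lp_loc p \<Longrightarrow> f' \<in> borel_measurable borel \<Longrightarrow>
      (AE x in lborel. f x = f' x) \<Longrightarrow> T > 0 \<Longrightarrow> morrey_norm p \<phi>\<^sub>1 f \<le> ennreal T \<Longrightarrow> r > 0 \<Longrightarrow>
      (\<integral>\<^sup>+ x\<in>heis_ball g r. epowr (pos_comm b \<alpha> (\<lambda>h. ennreal \<bar>f' h\<bar>) x) q \<partial>lborel)
        \<le> ennreal ((K * T * \<phi>\<^sub>2 g r) powr q * hvol TYPE('n) r)"
proof -
  define Q where "Q = heis_dim TYPE('n)"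
  note cb = conjugate_exponent_bounds[OF p \<alpha> q, folded Q_def]
  have q1: "q > 1" using cb p by linarith
  define V where "V = heis_vol TYPE('n)"
  have V: "V > 0" unfolding V_def by (rule heis_vol_pos)
  obtain C1 where C1: "C1 > 0" "\<And>u g r W. u \<in> borel_measurable borel \<Longrightarrow> r > 0 \<Longrightarrow> W > 0 \<Longrightarrow>
    log_integral p q u g r \<le> ennreal W \<Longrightarrow>
    (\<integral>\<^sup>+ x\<in>heis_ball g r. epowr (pos_comm b \<alpha> u x) q \<partial>lborel) \<le> ennreal (C1 * r powr Q * W powr q)"
    using pos_comm_local[OF b p \<alpha> q, folded Q_def] by blast
  \<comment> \<open>The constant of the hypothesis may be any real number; a positive one is needed
    because \<open>pos_comm_local\<close> takes a positive bound \<open>W\<close>.\<close>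
  define C' where "C' = max C 1"
  have C': "C' > 0" "C \<le> C'" by (auto simp: C'_def)
  \<comment> \<open>Chosen so that C1 r^Q W^q with W = c C' \<phi>_2(g, r) takes the form (K T
    \<phi>_2(g, r))^q |B(g, r)|; this is why \<open>C1\<close> is divided by \<open>V\<close> under
    the root.\<close>
  define K where "K = (C1 / V) powr (1 / q) * (V powr (1 / p) * C')"
  show ?thesis
  proof (rule that[of K])
    show "K > 0" using C1 V C' by (simp add: K_def)
    fix f f' :: "'n heis \<Rightarrow> real" and T :: real and g :: "'n heis" and r :: real
    assume f: "f \<in> Lp_loc p" and f' [measurable]: "f' \<in> borel_measurable borel" and ae: "AE x in lborel. f x = f' x"
      and T: "T > 0" and fT: "morrey_norm p \<phi>\<^sub>1 f \<le> ennreal T" and r: "r > 0"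
    let ?u = "\<lambda>h. ennreal \<bar>f' h\<bar>"
    have Lp_eq: "Lp_ball p ?u g \<tau> = Lp_ball p (\<lambda>h. ennreal \<bar>f h\<bar>) g \<tau>" for \<tau>
      unfolding Lp_ball_def
      by (intro arg_cong2[where f = epowr] nn_integral_cong_AE refl, use ae in eventually_elim) simp
    define c where "c = T * V powr (1 / p)"
    have c: "c > 0" using T V by (simp add: c_def)
    define E where "E \<tau> = ess_inf (lebesgue_on {\<tau><..}) (\<lambda>s. ennreal (\<phi>\<^sub>1 g s * s powr (Q / p)))" for \<tau>
    \<comment> \<open>By monotonicity in the radius the scaled norm over B(g, \<tau>) is a lower
      bound at every s > \<tau>, and \<open>ess_inf\<close> is the supremum of such bounds. The
      scale \<open>c\<close> is what remains of the Morrey bound without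
      \<open>\<phi>\<^sub>1 g s * s powr (Q / p)\<close>.\<close>
    have LE: "ennreal (1 / c) * Lp_ball p ?u g \<tau> \<le> E \<tau>" if \<tau>: "\<tau> > 0" for \<tau>
      unfolding E_def ess_inf_def
    proof (rule Sup_upper, rule CollectI, rule AE_I2)
      fix s assume "s \<in> space (lebesgue_on {\<tau><..})"
      then have s: "\<tau> < s" by (simp add: space_restrict_space)
      then have s0: "s > 0" using \<tau> by simp
      have "Lp_ball p ?u g \<tau> \<le> Lp_ball p ?u g s" using s p by (intro Lp_ball_mono) auto
      also have "\<dots> \<le> ennreal (T * \<phi>\<^sub>1 g s * hvol TYPE('n) s powr (1 / p))"
        unfolding Lp_eq using T p by (intro morrey_Lp_ball_le f fT s0 \<phi>) auto
      also have "T * \<phi>\<^sub>1 g s * hvol TYPE('n) s powr (1 / p) = c * (\<phi>\<^sub>1 g s * s powr (Q / p))"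
        by (simp add: hvol_def c_def powr_mult powr_powr flip: V_def Q_def)
      finally have "ennreal (1 / c) * Lp_ball p ?u g \<tau> \<le> ennreal (1 / c) * ennreal (c * (\<phi>\<^sub>1 g s * s powr (Q / p)))"
        by (rule mult_left_mono) simp
      also have "\<dots> = ennreal (1 / c * (c * (\<phi>\<^sub>1 g s * s powr (Q / p))))"
        using c \<phi>(1)[OF s0, of g] by (intro ennreal_mult[symmetric]) auto
      finally show "ennreal (1 / c) * Lp_ball p ?u g \<tau> \<le> ennreal (\<phi>\<^sub>1 g s * s powr (Q / p))"
        using c by simp
    qed
    let ?I = "log_integral p q ?u g r"
    have "ennreal (1 / c) * ?I = (\<integral>\<^sup>+ \<tau>. ennreal (1 / c) *
        (ennreal (1 + ln (\<tau> / r)) * Lp_ball p ?u g \<tau> * ennreal (\<tau> powr (- (Q / q) - 1)) * indicator {r<..} \<tau>) \<partial>lborel)"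
      unfolding log_integral_def Q_def[symmetric] by (rule nn_integral_cmult[symmetric]) measurable
    also have "\<dots> \<le> (\<integral>\<^sup>+ \<tau>\<in>{r<..}. ennreal (1 + ln (\<tau> / r)) * (E \<tau> / ennreal (\<tau> powr (Q / q + 1))) \<partial>lborel)"
    proof (rule nn_integral_mono)
      fix \<tau> :: real
      show "ennreal (1 / c) * (ennreal (1 + ln (\<tau> / r)) * Lp_ball p ?u g \<tau> * ennreal (\<tau> powr (- (Q / q) - 1)) * indicator {r<..} \<tau>)
        \<le> ennreal (1 + ln (\<tau> / r)) * (E \<tau> / ennreal (\<tau> powr (Q / q + 1))) * indicator {r<..} \<tau>"
      proof (cases "r < \<tau>")
        case True
        then have \<tau>: "\<tau> > 0" using r by simp
        have "E \<tau> / ennreal (\<tau> powr (Q / q + 1)) = E \<tau> * ennreal (\<tau> powr (- (Q / q) - 1))"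
          using \<tau> powr_minus[of \<tau> "Q / q + 1"] by (simp add: divide_ennreal_def inverse_ennreal)
        moreover have "(ennreal (1 / c) * Lp_ball p ?u g \<tau>) * (ennreal (1 + ln (\<tau> / r)) * ennreal (\<tau> powr (- (Q / q) - 1)))
          \<le> E \<tau> * (ennreal (1 + ln (\<tau> / r)) * ennreal (\<tau> powr (- (Q / q) - 1)))"
          by (intro mult_right_mono LE \<tau>) simp
        ultimately show ?thesis using True by (simp add: mult_ac)
      qed simp
    qed
    also have "\<dots> \<le> ennreal (C * \<phi>\<^sub>2 g r)"
      using C[OF r, of g] unfolding nn_integral_completion E_def Q_def .
    also have "\<dots> \<le> ennreal (C' * \<phi>\<^sub>2 g r)"
      using C' \<phi>(2)[OF r, of g] by (intro ennreal_leI mult_right_mono) auto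
    finally have "ennreal c * (ennreal (1 / c) * ?I) \<le> ennreal c * ennreal (C' * \<phi>\<^sub>2 g r)"
      by (rule mult_left_mono) simp
    moreover have "ennreal c * (ennreal (1 / c) * ?I) = ?I"
      using c by (simp flip: mult.assoc ennreal_mult)
    moreover have "ennreal c * ennreal (C' * \<phi>\<^sub>2 g r) = ennreal (c * (C' * \<phi>\<^sub>2 g r))"
      using c C' \<phi>(2)[OF r, of g] by (intro ennreal_mult[symmetric]) auto
    ultimately have I: "?I \<le> ennreal (c * (C' * \<phi>\<^sub>2 g r))" by simp
    have W: "c * (C' * \<phi>\<^sub>2 g r) > 0" using c C' \<phi>(2)[OF r, of g] by simp
    have "(\<integral>\<^sup>+ x\<in>heis_ball g r. epowr (pos_comm b \<alpha> ?u x) q \<partial>lborel) \<le> ennreal (C1 * r powr Q * (c * (C' * \<phi>\<^sub>2 g r)) powr q)"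
      by (rule C1(2)[OF _ r W I]) measurable
    also have "C1 * r powr Q * (c * (C' * \<phi>\<^sub>2 g r)) powr q = (K * T * \<phi>\<^sub>2 g r) powr q * hvol TYPE('n) r"
    proof -
      have "K * T * \<phi>\<^sub>2 g r = (C1 / V) powr (1 / q) * (c * (C' * \<phi>\<^sub>2 g r))"
        by (simp add: K_def c_def)
      then have "(K * T * \<phi>\<^sub>2 g r) powr q = ((C1 / V) powr (1 / q)) powr q * (c * (C' * \<phi>\<^sub>2 g r)) powr q"
        by (simp only: powr_mult)
      moreover have "((C1 / V) powr (1 / q)) powr q = C1 / V"
        using C1(1) V q1 by (simp add: powr_powr)
      ultimately have "(K * T * \<phi>\<^sub>2 g r) powr q = C1 / V * (c * (C' * \<phi>\<^sub>2 g r)) powr q" by simp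
      then show ?thesis using V by (simp add: hvol_def flip: V_def Q_def)
    qed
    finally show "(\<integral>\<^sup>+ x\<in>heis_ball g r. epowr (pos_comm b \<alpha> ?u x) q \<partial>lborel)
        \<le> ennreal ((K * T * \<phi>\<^sub>2 g r) powr q * hvol TYPE('n) r)" .
  qed
qed

text \<open>Serves both operators at once: of \<open>S\<close> only the measurability of its values
  and the domination almost everywhere by the positive commutator enter.\<close>

lemma morrey_bounded_of_pos_comm_le:
  fixes b :: "'n::finite heis \<Rightarrow> real" and S :: "('n heis \<Rightarrow> real) \<Rightarrow> 'n heis \<Rightarrow> real"
  assumes b [measurable]: "b \<in> borel_measurable borel"
    and k: "k > 0" and K: "K > 0" and q: "q > 0" and \<phi>: "\<And>g r. r > 0 \<Longrightarrow> \<phi>\<^sub>2 g r > 0"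
    and pos: "\<And>f f' T g r. f \<in> Lp_loc p \<Longrightarrow> f' \<in> borel_measurable borel \<Longrightarrow> (AE x in lborel. f x = f' x) \<Longrightarrow>
      T > 0 \<Longrightarrow> morrey_norm p \<phi>\<^sub>1 f \<le> ennreal T \<Longrightarrow> r > 0 \<Longrightarrow>
      (\<integral>\<^sup>+ x\<in>heis_ball g r. epowr (pos_comm b \<alpha> (\<lambda>h. ennreal \<bar>f' h\<bar>) x) q \<partial>lborel)
        \<le> ennreal ((K * T * \<phi>\<^sub>2 g r) powr q * hvol TYPE('n) r)"
    and S: "\<And>f f'. f \<in> Lp_loc p \<Longrightarrow> f' \<in> borel_measurable borel \<Longrightarrow> (AE x in lborel. f x = f' x) \<Longrightarrow>
      S f \<in> borel_measurable lebesgue \<and> (AE x in lborel. ennreal \<bar>S f x\<bar> \<le> ennreal k * pos_comm b \<alpha> (\<lambda>h. ennreal \<bar>f' h\<bar>) x)"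
  shows "morrey_bounded S p \<phi>\<^sub>1 q \<phi>\<^sub>2"
  unfolding morrey_bounded_def
proof (intro exI[of _ "k * K"] ballI conjI)
  fix f assume f: "f \<in> morrey p \<phi>\<^sub>1"
  then have loc: "f \<in> Lp_loc p" and fin: "morrey_norm p \<phi>\<^sub>1 f < top" by (auto simp: morrey_def)
  obtain f' where f': "f' \<in> borel_measurable borel" "AE x in lborel. f x = f' x"
    using Lp_loc_borel_rep[OF loc] .
  have meas: "S f \<in> borel_measurable lebesgue"
    and le: "AE x in lborel. ennreal \<bar>S f x\<bar> \<le> ennreal k * pos_comm b \<alpha> (\<lambda>h. ennreal \<bar>f' h\<bar>) x"
    using S[OF loc f'] by auto
  have *: "S f \<in> Lp_loc q \<and> morrey_norm q \<phi>\<^sub>2 (S f) \<le> ennreal (k * K * T)"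
    if T: "T > 0" "morrey_norm p \<phi>\<^sub>1 f \<le> ennreal T" for T
  proof -
    have "(\<integral>\<^sup>+ h\<in>heis_ball g r. ennreal (\<bar>S f h\<bar> powr q) \<partial>lborel) \<le> ennreal ((k * K * T * \<phi>\<^sub>2 g r) powr q * hvol TYPE('n) r)"
      if r: "r > 0" for g r
    proof -
      let ?P = "\<integral>\<^sup>+ x\<in>heis_ball g r. epowr (pos_comm b \<alpha> (\<lambda>h. ennreal \<bar>f' h\<bar>) x) q \<partial>lborel"
      let ?X = "(K * T * \<phi>\<^sub>2 g r) powr q * hvol TYPE('n) r"
      have V: "hvol TYPE('n) r > 0" using r by simp
      have "(\<integral>\<^sup>+ h\<in>heis_ball g r. ennreal (\<bar>S f h\<bar> powr q) \<partial>lborel)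
        \<le> (\<integral>\<^sup>+ h. epowr (ennreal k * pos_comm b \<alpha> (\<lambda>h. ennreal \<bar>f' h\<bar>) h) q * indicator (heis_ball g r) h \<partial>lborel)"
      proof (rule nn_integral_mono_AE, use le in eventually_elim)
        fix h assume "ennreal \<bar>S f h\<bar> \<le> ennreal k * pos_comm b \<alpha> (\<lambda>h. ennreal \<bar>f' h\<bar>) h"
        then have "epowr (ennreal \<bar>S f h\<bar>) q \<le> epowr (ennreal k * pos_comm b \<alpha> (\<lambda>h. ennreal \<bar>f' h\<bar>) h) q"
          using q by (intro epowr_mono) auto
        then show "ennreal (\<bar>S f h\<bar> powr q) * indicator (heis_ball g r) h
          \<le> epowr (ennreal k * pos_comm b \<alpha> (\<lambda>h. ennreal \<bar>f' h\<bar>) h) q * indicator (heis_ball g r) h"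
          by (simp add: epowr_ennreal mult_right_mono)
      qed
      also have "\<dots> \<le> ennreal (k powr q) * ?P"
      proof -
        have "epowr (ennreal k * y) q = ennreal (k powr q) * epowr y q" for y
          using k by (simp add: epowr_mult epowr_ennreal)
        moreover have "(\<lambda>h. epowr (pos_comm b \<alpha> (\<lambda>h. ennreal \<bar>f' h\<bar>) h) q * indicator (heis_ball g r) h) \<in> borel_measurable lborel"
          using f'(1) by measurable
        ultimately show ?thesis by (simp add: mult.assoc nn_integral_cmult)
      qed
      also have "\<dots> \<le> ennreal (k powr q) * ennreal ?X"
        by (intro mult_left_mono pos[OF loc f' T r]) simp
      also have "\<dots> = ennreal ((k * K * T * \<phi>\<^sub>2 g r) powr q * hvol TYPE('n) r)"
        using V by (simp add: powr_mult mult.assoc less_imp_le flip: ennreal_mult)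
      finally show ?thesis .
    qed
    moreover have "k * K * T \<ge> 0" using k K T by simp
    ultimately show ?thesis using morrey_normI[OF meas q, of "k * K * T" \<phi>\<^sub>2] \<phi> by blast
  qed
  obtain m where m: "morrey_norm p \<phi>\<^sub>1 f = ennreal m" "m \<ge> 0" using fin by (cases "morrey_norm p \<phi>\<^sub>1 f") auto
  have kK: "k * K > 0" using k K by simp
  \<comment> \<open>The estimate above is for strictly positive \<open>T\<close>, while the norm
    \<open>m\<close> may be 0. It is applied to T = m + e / (k K) with e tending to 0.\<close>
  show le': "morrey_norm q \<phi>\<^sub>2 (S f) \<le> ennreal (k * K) * morrey_norm p \<phi>\<^sub>1 f"
  proof (rule ennreal_le_epsilon)
    fix e :: real assume e: "0 < e"
    have "morrey_norm q \<phi>\<^sub>2 (S f) \<le> ennreal (k * K * (m + e / (k * K)))"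
    proof -
      have "e / (k * K) > 0" using e kK by (rule divide_pos_pos)
      then have "m + e / (k * K) > 0" "morrey_norm p \<phi>\<^sub>1 f \<le> ennreal (m + e / (k * K))"
        using m by (auto intro!: ennreal_leI simp del: zero_less_divide_iff)
      then show ?thesis using * by blast
    qed
    also have "k * K * (m + e / (k * K)) = k * K * m + e" using k K by (simp add: field_simps)
    also have "ennreal \<dots> = ennreal (k * K) * morrey_norm p \<phi>\<^sub>1 f + ennreal e"
    proof -
      have "ennreal (k * K * m + e) = ennreal (k * K * m) + ennreal e"
        using m(2) e k K by (intro ennreal_plus mult_nonneg_nonneg) auto
      then show ?thesis using m kK by (simp add: ennreal_mult'')
    qed
    finally show "morrey_norm q \<phi>\<^sub>2 (S f) \<le> ennreal (k * K) * morrey_norm p \<phi>\<^sub>1 f + ennreal e" .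
  qed
  have "S f \<in> Lp_loc q" using *[of "m + 1"] m by (auto intro!: ennreal_leI)
  moreover have "morrey_norm q \<phi>\<^sub>2 (S f) < top"
    using le' fin by (auto simp: ennreal_mult_less_top intro: order.strict_trans1)
  ultimately show "S f \<in> morrey q \<phi>\<^sub>2" by (simp add: morrey_def)
qed

theorem corollary1:
  fixes p q \<alpha> Q :: real
    and b :: "'n::finite heis \<Rightarrow> real"
    and \<phi>\<^sub>1 \<phi>\<^sub>2 :: "'n heis \<Rightarrow> real \<Rightarrow> real"
  assumes "Q = heis_dim TYPE('n)"
    and "1 < p" and "0 < \<alpha>" and "\<alpha> < Q / p" and "1 / q = 1 / p - \<alpha> / Q"
    and "b \<in> BMO"
    and "pos_measurable \<phi>\<^sub>1" and "pos_measurable \<phi>\<^sub>2"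
    and "\<exists>C::real. \<forall>g. \<forall>r>0.
      (\<integral>\<^sup>+ \<tau>\<in>{r<..}. ennreal (1 + ln (\<tau> / r))
          * (ess_inf (lebesgue_on {\<tau><..}) (\<lambda>s. ennreal (\<phi>\<^sub>1 g s * s powr (Q / p)))
             / ennreal (\<tau> powr (Q / q + 1))) \<partial>lebesgue)
        \<le> ennreal (C * \<phi>\<^sub>2 g r)"
  shows "(\<forall>f\<in>morrey p \<phi>\<^sub>1. AE g in lebesgue. max_commutator b \<alpha> f g < \<infinity>)
    \<and> morrey_bounded (\<lambda>f g. enn2real (max_commutator b \<alpha> f g)) p \<phi>\<^sub>1 q \<phi>\<^sub>2
    \<and> (\<forall>f\<in>morrey p \<phi>\<^sub>1. AE g in lebesgue. integrable lebesgue (riesz_commutator_kernel b \<alpha> f g))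
    \<and> morrey_bounded (riesz_commutator b \<alpha>) p \<phi>\<^sub>1 q \<phi>\<^sub>2"
proof -
  note Q = assms(1) and p = assms(2) and \<alpha> = assms(3) assms(4)[unfolded Q] and q = assms(5)[unfolded Q]
  have \<phi>: "\<And>g r. r > 0 \<Longrightarrow> \<phi>\<^sub>1 g r > 0" "\<And>g r. r > 0 \<Longrightarrow> \<phi>\<^sub>2 g r > 0"
    using assms(7,8) by (auto simp: pos_measurable_def)
  note cb = conjugate_exponent_bounds[OF p \<alpha> q]
  have q0: "q > 0" using cb p by linarith
  obtain C where C: "\<And>g r. r > 0 \<Longrightarrow>
      (\<integral>\<^sup>+ \<tau>\<in>{r<..}. ennreal (1 + ln (\<tau> / r))
          * (ess_inf (lebesgue_on {\<tau><..}) (\<lambda>s. ennreal (\<phi>\<^sub>1 g s * s powr (heis_dim TYPE('n) / p)))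
             / ennreal (\<tau> powr (heis_dim TYPE('n) / q + 1))) \<partial>lebesgue)
        \<le> ennreal (C * \<phi>\<^sub>2 g r)"
    using assms(9) unfolding Q by blast
  have "b \<in> Lp_loc 1" using assms(6) by (simp add: BMO_def)
  then obtain b' where b' [measurable]: "b' \<in> borel_measurable borel" and bb': "AE x in lborel. b x = b' x"
    by (rule Lp_loc_borel_rep)
  obtain N where N: "bmo_bound b' N" using BMO_imp_bmo_bound[OF assms(6) b' bb'] by blast
  obtain K where K: "K > 0" and pos: "\<And>f f' T g r. f \<in> Lp_loc p \<Longrightarrow> f' \<in> borel_measurable borel \<Longrightarrow> (AE x in lborel. f x = f' x) \<Longrightarrow>
      T > 0 \<Longrightarrow> morrey_norm p \<phi>\<^sub>1 f \<le> ennreal T \<Longrightarrow> r > 0 \<Longrightarrow>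
      (\<integral>\<^sup>+ x\<in>heis_ball g r. epowr (pos_comm b' \<alpha> (\<lambda>h. ennreal \<bar>f' h\<bar>) x) q \<partial>lborel)
        \<le> ennreal ((K * T * \<phi>\<^sub>2 g r) powr q * hvol TYPE('n) r)"
    by (rule pos_comm_morrey[where \<phi>\<^sub>1 = \<phi>\<^sub>1 and \<phi>\<^sub>2 = \<phi>\<^sub>2, OF N p \<alpha> q])
      ((erule \<phi> C)+, rule that)
  define k where "k = heis_vol TYPE('n) powr (- 1 + \<alpha> / heis_dim TYPE('n))"
  have k: "k > 0" using heis_vol_pos[where 'n='n] by (simp add: k_def)
  \<comment> \<open>The local L_q bound gives finiteness almost everywhere in each B(0, n + 1), and
    countably many of these balls exhaust the group.\<close>
  have fin: "AE x in lborel. pos_comm b' \<alpha> (\<lambda>h. ennreal \<bar>f' h\<bar>) x < top"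
    if f: "f \<in> morrey p \<phi>\<^sub>1" and f' [measurable]: "f' \<in> borel_measurable borel" and ff': "AE x in lborel. f x = f' x" for f f'
  proof -
    have loc: "f \<in> Lp_loc p" and "morrey_norm p \<phi>\<^sub>1 f < top" using f by (auto simp: morrey_def)
    then obtain m where m: "morrey_norm p \<phi>\<^sub>1 f = ennreal m" "m \<ge> 0" by (cases "morrey_norm p \<phi>\<^sub>1 f") auto
    let ?S = "pos_comm b' \<alpha> (\<lambda>h. ennreal \<bar>f' h\<bar>)"
    have "AE x in lborel. x \<in> heis_ball 0 (real (Suc n)) \<longrightarrow> ?S x < top" for n
    proof -
      have "(\<integral>\<^sup>+ x\<in>heis_ball 0 (real (Suc n)). epowr (?S x) q \<partial>lborel) \<noteq> \<infinity>"
        using pos[OF loc f' ff', of "m + 1" "real (Suc n)" 0] m by (auto simp: top_unique intro!: ennreal_leI)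
      then have "AE x in lborel. epowr (?S x) q * indicator (heis_ball 0 (real (Suc n))) x \<noteq> \<infinity>"
        by (intro nn_integral_PInf_AE) auto
      then show ?thesis
        by eventually_elim (auto simp: indicator_def less_top[symmetric] split: if_splits)
    qed
    then have "AE x in lborel. \<forall>n. x \<in> heis_ball 0 (real (Suc n)) \<longrightarrow> ?S x < top"
      unfolding AE_all_countable by (rule allI)
    then show ?thesis
    proof eventually_elim
      case (elim x)
      obtain n :: nat where "heis_dist 0 x < real n" using reals_Archimedean2 by blast
      then have "x \<in> heis_ball 0 (real (Suc n))" by (simp add: mem_heis_ball)
      then show ?case using elim by blast
    qed
  qed
  have max_le: "AE x in lborel. max_commutator b \<alpha> f x = max_commutator b' \<alpha> f' x \<and>
      max_commutator b' \<alpha> f' x \<le> ennreal k * pos_comm b' \<alpha> (\<lambda>h. ennreal \<bar>f' h\<bar>) x"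
    if f': "f' \<in> borel_measurable borel" and ff': "AE x in lborel. f x = f' x" for f f'
    using bb'
  proof eventually_elim
    case (elim x)
    then show ?case
      using max_commutator_cong_AE[OF bb' ff', of x \<alpha>] max_commutator_le_pos_comm[OF b' f' cb(2), of x]
      by (simp add: k_def)
  qed
  have "AE g in lebesgue. max_commutator b \<alpha> f g < \<infinity>" if f: "f \<in> morrey p \<phi>\<^sub>1" for f
  proof (rule AE_completion)
    have "f \<in> Lp_loc p" using f by (simp add: morrey_def)
    then obtain f' where f': "f' \<in> borel_measurable borel" "AE x in lborel. f x = f' x" by (rule Lp_loc_borel_rep)
    show "AE g in lborel. max_commutator b \<alpha> f g < \<infinity>"
      using fin[OF f f'] max_le[OF f'] by eventually_elim (auto simp: ennreal_mult_less_top intro: order.strict_trans1)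
  qed
  moreover have "AE g in lebesgue. integrable lebesgue (riesz_commutator_kernel b \<alpha> f g)" if f: "f \<in> morrey p \<phi>\<^sub>1" for f
  proof (rule AE_completion)
    have "f \<in> Lp_loc p" using f by (simp add: morrey_def)
    then obtain f' where f': "f' \<in> borel_measurable borel" "AE x in lborel. f x = f' x" by (rule Lp_loc_borel_rep)
    show "AE g in lborel. integrable lebesgue (riesz_commutator_kernel b \<alpha> f g)"
      using fin[OF f f'] bb'
    proof eventually_elim
      case (elim g)
      have "integrable lborel (riesz_commutator_kernel b' \<alpha> f' g)"
      proof (rule integrableI_bounded)
        show "riesz_commutator_kernel b' \<alpha> f' g \<in> borel_measurable lborel"
          using borel_measurable_riesz_commutator_kernel[OF b' f'(1)] by simp
        show "(\<integral>\<^sup>+ h. ennreal (norm (riesz_commutator_kernel b' \<alpha> f' g h)) \<partial>lborel) < \<infinity>"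
          using elim(1) by (simp add: nn_integral_riesz_commutator_kernel)
      qed
      then show ?case using riesz_commutator_kernel_rep(1)[OF b' bb' f'] elim(2) by blast
    qed
  qed
  moreover have "morrey_bounded (\<lambda>f g. enn2real (max_commutator b \<alpha> f g)) p \<phi>\<^sub>1 q \<phi>\<^sub>2"
  proof (rule morrey_bounded_of_pos_comm_le[OF b' k K q0 \<phi>(2) pos])
    fix f f' :: "'n heis \<Rightarrow> real"
    assume f': "f' \<in> borel_measurable borel" "AE x in lborel. f x = f' x"
    have m: "(\<lambda>g. enn2real (max_commutator b' \<alpha> f' g)) \<in> borel_measurable lborel"
      using borel_measurable_max_commutator[OF b' f'(1) cb(2)] by simp
    have "AE g in lborel. enn2real (max_commutator b' \<alpha> f' g) = enn2real (max_commutator b \<alpha> f g)"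
      using max_le[OF f'] by eventually_elim simp
    then have "(\<lambda>g. enn2real (max_commutator b \<alpha> f g)) \<in> borel_measurable lebesgue"
      by (intro borel_measurable_AE[OF measurable_completion[OF m]] AE_completion)
    moreover have "AE x in lborel. ennreal \<bar>enn2real (max_commutator b \<alpha> f x)\<bar> \<le> ennreal k * pos_comm b' \<alpha> (\<lambda>h. ennreal \<bar>f' h\<bar>) x"
      using max_le[OF f']
    proof eventually_elim
      case (elim x)
      \<comment> \<open>Also true where the supremum is infinite, as
        \<open>enn2real top = 0\<close>.\<close>
      have "ennreal \<bar>enn2real (max_commutator b \<alpha> f x)\<bar> \<le> max_commutator b \<alpha> f x"
        by (cases "max_commutator b \<alpha> f x") auto
      also have "\<dots> \<le> ennreal k * pos_comm b' \<alpha> (\<lambda>h. ennreal \<bar>f' h\<bar>) x" using elim by simp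
      finally show ?case .
    qed
    ultimately show "(\<lambda>g. enn2real (max_commutator b \<alpha> f g)) \<in> borel_measurable lebesgue \<and>
      (AE x in lborel. ennreal \<bar>enn2real (max_commutator b \<alpha> f x)\<bar> \<le> ennreal k * pos_comm b' \<alpha> (\<lambda>h. ennreal \<bar>f' h\<bar>) x)" ..
  qed
  moreover have "morrey_bounded (riesz_commutator b \<alpha>) p \<phi>\<^sub>1 q \<phi>\<^sub>2"
  proof (rule morrey_bounded_of_pos_comm_le[OF b' zero_less_one K q0 \<phi>(2) pos])
    fix f f' :: "'n heis \<Rightarrow> real"
    assume f': "f' \<in> borel_measurable borel" "AE x in lborel. f x = f' x"
    have m: "(\<lambda>g. integral\<^sup>L lborel (riesz_commutator_kernel b' \<alpha> f' g)) \<in> borel_measurable lborel"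
      using borel_measurable_integral_riesz_commutator_kernel[OF b' f'(1)] by simp
    have ae: "AE g in lborel. integral\<^sup>L lborel (riesz_commutator_kernel b' \<alpha> f' g) = riesz_commutator b \<alpha> f g"
      using bb' by eventually_elim (use riesz_commutator_kernel_rep(2)[OF b' bb' f'] in simp)
    then have "riesz_commutator b \<alpha> f \<in> borel_measurable lebesgue"
      by (intro borel_measurable_AE[OF measurable_completion[OF m]] AE_completion)
    moreover have "AE x in lborel. ennreal \<bar>riesz_commutator b \<alpha> f x\<bar> \<le> ennreal 1 * pos_comm b' \<alpha> (\<lambda>h. ennreal \<bar>f' h\<bar>) x"
      using ae by eventually_elim (use abs_riesz_commutator_le[of b' \<alpha> f'] in \<open>auto dest: sym\<close>)
    ultimately show "riesz_commutator b \<alpha> f \<in> borel_measurable lebesgue \<and>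
      (AE x in lborel. ennreal \<bar>riesz_commutator b \<alpha> f x\<bar> \<le> ennreal 1 * pos_comm b' \<alpha> (\<lambda>h. ennreal \<bar>f' h\<bar>) x)" ..
  qed
  ultimately show ?thesis by blast
qed

end
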